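(* Let $F:\mathbb{R}\to\mathbb{R}$ be analytic. The equation $$\ddot u\,u+\tfrac12\dot u^2+F'(u)=0$$ has fronts, solitary and plateau-shaped singular TWS (in the sense specified in the context) if and only if - $F'(0)=0$ and $F''(0)<0$, and - there exists $m>0$ such that $F(m)=F(0)$, $F(u)<F(0)$ for all $u\in(0,m)$, and $F'(m)=0$. The solitary waves are strong (classical) solutions of $\ddot u\,u+\frac12\dot u^2+F'(u)=0$ on $\mathbb{R}$ and therefore analytic. The fronts and plateau-shaped waves are strong singular TWS which are at most $C^1$ (that is, of class $C^1(\mathbb{R})$ but not $C^2(\mathbb{R})$) and piecewise analytic. Moreover, the fronts have finite-time decay on one side.
   Context: Throughout, only solutions with values in $\{u\ge 0\}$ are considered. Traveling wave solution (TWS): a bounded function $u\in H^1_{loc}(\mathbb{R})$ satisfying the equation $\ddot u\,u+\frac12\dot u^2+F'(u)=0$ in the sense of distributions, i.e. $$\int_{\mathbb{R}}(u^2)_t\phi_t+(u_t)^2\phi-2F'(u)\phi\,dt=0\quad\text{for all }\phi\in C_c^\infty(\mathbb{R}).$$ A non-constant TWS $u$ is a strong singular TWS if, for some constant $h\in\mathbb{R}$, it is a classical solution on $\mathbb{R}$ of $$\frac{u\dot u^2}{2}+F(u)=h;\qquad(\ast)$$ it is a weak singular TWS if, for some constant $h\in\mathbb{R}$, it is a classical solution of $(\ast)$ on $\mathbb{R}\setminus\mathcal{S}$, where $\mathcal{S}$ is a countable set of points $t_k$ at which $\lim_{t\to t_k}\big(\frac{u(t)\dot u(t)^2}{2}+F(u(t))\big)=h$.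 A singular TWS is one of either kind. In this statement: a front is a singular TWS that vanishes identically on a closed half-line, is positive on the complementary open half-line, and tends to a positive limit at the infinite end of the latter. Finite-time decay on one side means that the front reaches the value $0$ at a finite time and is identically $0$ beyond it. A plateau-shaped wave is a singular TWS that vanishes exactly on a compact interval of positive length and tends to one and the same positive limit as $t\to\pm\infty$. A solitary wave is a singular TWS that vanishes at exactly one point $t_1$, with $\lim_{t\to t_1}\dot u(t)=0$, and tends to one and the same positive limit as $t\to\pm\infty$. *)

theory Defs
  imports "HOL-Analysis.Analysis"
begin

text \<open>
  For an interval containing one of its endpoints, the definition below amounts to analyticity up
  to that endpoint: the function is locally the restriction of a convergent power series.
\<close>

definition real_analytic_on :: "(real \<Rightarrow> real) \<Rightarrow> real set \<Rightarrow> bool" where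
  "real_analytic_on f X \<longleftrightarrow>
     (\<forall>x\<in>X. \<exists>r>0. \<exists>c. \<forall>y\<in>X. \<bar>y - x\<bar> < r \<longrightarrow> (\<lambda>n. c n * (y - x) ^ n) sums f y)"

definition piecewise_analytic :: "(real \<Rightarrow> real) \<Rightarrow> bool" where
  "piecewise_analytic f \<longleftrightarrow>
     (\<exists>P. finite P \<and> (\<forall>C\<in>components (- P). real_analytic_on f (closure C)))"

definition class_C2 :: "(real \<Rightarrow> real) \<Rightarrow> bool" where
  "class_C2 f \<longleftrightarrow> f C1_differentiable_on UNIV \<and> deriv f C1_differentiable_on UNIV"

definition test_function :: "(real \<Rightarrow> real) \<Rightarrow> bool" where
  "test_function \<phi> \<longleftrightarrow>
     (\<forall>n t. (deriv ^^ n) \<phi> differentiable (at t)) \<and> compact (closure {t. \<phi> t \<noteq> 0})"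

definition L1_loc :: "(real \<Rightarrow> real) \<Rightarrow> bool" where
  "L1_loc f \<longleftrightarrow> (\<forall>a b. set_integrable lebesgue {a..b} f)"

definition L2_loc :: "(real \<Rightarrow> real) \<Rightarrow> bool" where
  "L2_loc f \<longleftrightarrow>
     f \<in> borel_measurable lebesgue \<and> (\<forall>a b. set_integrable lebesgue {a..b} (\<lambda>t. (f t)\<^sup>2))"

definition weak_derivative :: "(real \<Rightarrow> real) \<Rightarrow> (real \<Rightarrow> real) \<Rightarrow> bool" where
  "weak_derivative f g \<longleftrightarrow> L1_loc f \<and> L1_loc g \<and>
     (\<forall>\<phi>. test_function \<phi> \<longrightarrow>
        (LINT t|lebesgue. f t * deriv \<phi> t) = - (LINT t|lebesgue. g t * \<phi> t))"

definition H1_loc :: "(real \<Rightarrow> real) \<Rightarrow> bool" where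
  "H1_loc f \<longleftrightarrow> L2_loc f \<and> (\<exists>g. weak_derivative f g \<and> L2_loc g)"

text \<open>
  Elements of \<open>H1_loc\<close> are functions up to null sets, whereas the zeros of a wave are a pointwise
  notion; \<open>u\<close> is therefore the continuous representative. The weak derivatives \<open>v\<close> of \<open>u\<close> and
  \<open>w\<close> of \<open>u\<^sup>2\<close> are unique almost everywhere, so their choice is immaterial.
\<close>

definition TWS :: "(real \<Rightarrow> real) \<Rightarrow> (real \<Rightarrow> real) \<Rightarrow> bool" where
  "TWS F u \<longleftrightarrow>
     continuous_on UNIV u \<and> (\<forall>t. 0 \<le> u t) \<and> bounded (range u) \<and> H1_loc u \<and>
     (\<exists>v w. weak_derivative u v \<and> weak_derivative (\<lambda>t. (u t)\<^sup>2) w \<and>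
        (\<forall>\<phi>. test_function \<phi> \<longrightarrow>
           (LINT t|lebesgue. w t * deriv \<phi> t + (v t)\<^sup>2 * \<phi> t - 2 * deriv F (u t) * \<phi> t) = 0))"

definition energy :: "(real \<Rightarrow> real) \<Rightarrow> (real \<Rightarrow> real) \<Rightarrow> real \<Rightarrow> real" where
  "energy F u t = u t * (deriv u t)\<^sup>2 / 2 + F (u t)"

definition classical_energy_solution_on ::
    "(real \<Rightarrow> real) \<Rightarrow> real \<Rightarrow> real set \<Rightarrow> (real \<Rightarrow> real) \<Rightarrow> bool" where
  "classical_energy_solution_on F h X u \<longleftrightarrow>
     u C1_differentiable_on X \<and> (\<forall>t\<in>X. energy F u t = h)"

definition classical_solution :: "(real \<Rightarrow> real) \<Rightarrow> (real \<Rightarrow> real) \<Rightarrow> bool" where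
  "classical_solution F u \<longleftrightarrow> class_C2 u \<and>
     (\<forall>t. deriv (deriv u) t * u t + (deriv u t)\<^sup>2 / 2 + deriv F (u t) = 0)"

definition strong_singular_TWS :: "(real \<Rightarrow> real) \<Rightarrow> (real \<Rightarrow> real) \<Rightarrow> bool" where
  "strong_singular_TWS F u \<longleftrightarrow>
     TWS F u \<and> \<not> u constant_on UNIV \<and> (\<exists>h. classical_energy_solution_on F h UNIV u)"

text \<open>The limits are taken off \<open>S\<close> because \<open>deriv u\<close> need not be meaningful at other points of \<open>S\<close>.\<close>

definition weak_singular_TWS :: "(real \<Rightarrow> real) \<Rightarrow> (real \<Rightarrow> real) \<Rightarrow> bool" where
  "weak_singular_TWS F u \<longleftrightarrow>
     TWS F u \<and> \<not> u constant_on UNIV \<and>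
     (\<exists>h S. countable S \<and> classical_energy_solution_on F h (- S) u \<and>
        (\<forall>s\<in>S. (energy F u \<longlongrightarrow> h) (at s within - S)))"

definition singular_TWS :: "(real \<Rightarrow> real) \<Rightarrow> (real \<Rightarrow> real) \<Rightarrow> bool" where
  "singular_TWS F u \<longleftrightarrow> strong_singular_TWS F u \<or> weak_singular_TWS F u"

definition front :: "(real \<Rightarrow> real) \<Rightarrow> (real \<Rightarrow> real) \<Rightarrow> bool" where
  "front F u \<longleftrightarrow> singular_TWS F u \<and>
     (\<exists>T. \<exists>l>0.
        (\<forall>t\<le>T. u t = 0) \<and> (\<forall>t>T. u t > 0) \<and> (u \<longlongrightarrow> l) at_top \<or>
        (\<forall>t\<ge>T. u t = 0) \<and> (\<forall>t<T. u t > 0) \<and> (u \<longlongrightarrow> l) at_bot)"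

definition plateau_wave :: "(real \<Rightarrow> real) \<Rightarrow> (real \<Rightarrow> real) \<Rightarrow> bool" where
  "plateau_wave F u \<longleftrightarrow> singular_TWS F u \<and>
     (\<exists>a b. a < b \<and> {t. u t = 0} = {a..b}) \<and>
     (\<exists>l>0. (u \<longlongrightarrow> l) at_top \<and> (u \<longlongrightarrow> l) at_bot)"

definition solitary_wave :: "(real \<Rightarrow> real) \<Rightarrow> (real \<Rightarrow> real) \<Rightarrow> bool" where
  "solitary_wave F u \<longleftrightarrow> singular_TWS F u \<and>
     (\<exists>t\<^sub>1. {t. u t = 0} = {t\<^sub>1} \<and>
        (deriv u \<longlongrightarrow> 0) (at t\<^sub>1 within {t. u differentiable (at t)})) \<and>
     (\<exists>l>0. (u \<longlongrightarrow> l) at_top \<and> (u \<longlongrightarrow> l) at_bot)"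

definition finite_time_decay_right :: "(real \<Rightarrow> real) \<Rightarrow> bool" where
  "finite_time_decay_right u \<longleftrightarrow> (\<exists>T. (\<forall>t<T. u t > 0) \<and> (\<forall>t\<ge>T. u t = 0))"

definition finite_time_decay_left :: "(real \<Rightarrow> real) \<Rightarrow> bool" where
  "finite_time_decay_left u \<longleftrightarrow> (\<exists>T. (\<forall>t>T. u t > 0) \<and> (\<forall>t\<le>T. u t = 0))"

end

theory Submission
  imports Defs "HOL-Complex_Analysis.Complex_Analysis"
begin

text \<open>
  Fronts, plateaus and solitary waves all have the energy \<open>F 0\<close> of their zeros, so that
  \<open>u * u'\<^sup>2 / 2 = F 0 - F u\<close>. When \<open>deriv F 0 = 0\<close>, the right-hand side is \<open>u\<^sup>2 * Q u\<close> with \<open>Q\<close>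
  analytic, and the substitution \<open>u = y\<^sup>2\<close> removes the degeneracy at \<open>u = 0\<close>: the equation becomes
  \<open>y'\<^sup>2 = Q (y\<^sup>2) / 2\<close>. If \<open>deriv (deriv F) 0 < 0\<close>, then \<open>Q 0 > 0\<close>, and \<open>y' = sqrt (Q (y\<^sup>2) / 2)\<close> is a
  regular analytic equation whose solution passes through \<open>0\<close> with nonzero speed. Since
  \<open>m\<close> is a double zero of \<open>F 0 - F\<close>, the solution \<open>Y\<close> with \<open>Y 0 = 0\<close> needs infinite time to reach
  \<open>\<plusminus> sqrt m\<close>. Its square \<open>V\<close> is the solitary wave (\<open>wave_profile_construction\<close>).

  All other waves are this one with a pause at the zero: fronts and plateaus are \<open>V (g t)\<close>, where \<open>g\<close> is a
  translation of the time axis away from its zeros. Such a function is \<open>C\<^sup>1\<close> because \<open>V'\<close> vanishes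
  at \<open>0\<close>, and its flux \<open>2 * u * u'\<close> is still differentiable there, so it is a weak solution. Its second
  derivative jumps from \<open>0\<close> to \<open>V'' 0 > 0\<close> (\<open>wave_profile.kink_not_class_C2\<close>).

  Conversely, every wave of one of the three kinds has this form. The main obstacle is that the derivative
  of a weak singular wave is controlled only off a countable set and could change sign there. The weak
  equation excludes this. Off the exceptional set \<open>u'\<^sup>2\<close> is a continuous function of \<open>u\<close>, so the equation says
  that \<open>(u\<^sup>2)''\<close> is continuous in the sense of distributions; hence \<open>u\<close> is a classical
  solution wherever it is positive (\<open>singular_TWS_regular_where_positive\<close>). It has no critical point
  between its zero and infinity, for it would be symmetric about such a point and vanish once more
  (\<open>half_wave_no_critical_point\<close>). So it increases from \<open>0\<close> to its limit \<open>l\<close>, and \<open>F < F 0\<close> on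
  \<open>(0, l)\<close>. The behaviour at infinity forces \<open>F l = F 0\<close> and \<open>deriv F l = 0\<close>, and reaching \<open>0\<close> in
  finite time forces \<open>deriv (deriv F) 0 < 0\<close> (\<open>half_wave\<close>). Separation of variables then identifies it with a
  translate of \<open>V\<close>. The condition \<open>deriv F 0 = 0\<close> comes from the weak equation on an interval of zeros for
  fronts and plateaus, and from \<open>u' \<rightarrow> 0\<close> for solitary waves.
\<close>

section \<open>Real analytic functions and their holomorphic extensions\<close>

text \<open>
  Analyticity through a holomorphic extension: products, compositions, removable singularities and
  inverse functions are then those of complex analysis.
\<close>

definition real_analytic_at :: "(real \<Rightarrow> real) \<Rightarrow> real \<Rightarrow> bool" where
  "real_analytic_at f x \<longleftrightarrow>
     (\<exists>g. g analytic_on {of_real x} \<and> (\<forall>\<^sub>F y in nhds x. g (of_real y) = complex_of_real (f y)))"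

lemma eventually_nhds_of_real:
  assumes "open S" "complex_of_real x \<in> S"
  shows "\<forall>\<^sub>F y in nhds x. complex_of_real y \<in> S"
proof -
  have "open (complex_of_real -` S)"
    by (intro open_vimage assms continuous_intros)
  then show ?thesis
    using eventually_nhds_in_open[of "complex_of_real -` S" x] assms by simp
qed

lemma has_vector_derivative_eventually_eq:
  assumes "(f has_vector_derivative d) (at x)" "\<forall>\<^sub>F y in nhds x. f y = g y"
  shows "(g has_vector_derivative d) (at x)"
  using assms has_vector_derivative_transform_within_open
  unfolding eventually_nhds by metis

text \<open>
  A real power series that converges on an interval converges on the complex disc of the same radius.
  Conversely, the real parts of the Taylor coefficients of an extension represent the function itself.
\<close>

lemma real_analytic_on_UNIV_iff: "real_analytic_on f UNIV \<longleftrightarrow> (\<forall>x. real_analytic_at f x)"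
proof (intro iffI allI)
  fix x assume "real_analytic_on f UNIV"
  then obtain r c where r: "r > 0" and c: "\<And>y. \<bar>y - x\<bar> < r \<Longrightarrow> (\<lambda>n. c n * (y - x) ^ n) sums f y"
    unfolding real_analytic_on_def by blast
  define a where "a n = complex_of_real (c n)" for n
  define g where "g w = (\<Sum>n. a n * (w - of_real x) ^ n)" for w
  have "(\<lambda>n. a n * (w - of_real x) ^ n) sums g w" if "w \<in> ball (of_real x) r" for w
  proof -
    define s where "s = (cmod (w - of_real x) + r) / 2"
    have s: "cmod (w - of_real x) < s" "s < r" "s > 0"
      using that r by (auto simp: s_def dist_norm norm_minus_commute add_nonneg_pos)
    have "summable (\<lambda>n. c n * s ^ n)"
      using c[of "x + s"] s by (auto simp: sums_iff)
    then have "summable (\<lambda>n. complex_of_real (c n * s ^ n))"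
      by (rule summable_of_real)
    then have "summable (\<lambda>n. a n * complex_of_real s ^ n)"
      by (simp add: a_def)
    then have "summable (\<lambda>n. a n * (w - of_real x) ^ n)"
      by (rule powser_inside) (use s in simp)
    then show ?thesis by (simp add: g_def summable_sums)
  qed
  then have "g analytic_on ball (of_real x) r" by (rule power_series_analytic)
  then have "g analytic_on {of_real x}" using r by (auto intro: analytic_on_subset)
  moreover have "g (of_real y) = of_real (f y)" if "\<bar>y - x\<bar> < r" for y
  proof -
    have "(\<lambda>n. complex_of_real (c n * (y - x) ^ n)) sums of_real (f y)"
      by (rule sums_of_real[OF c[OF that]])
    then show ?thesis by (simp add: g_def a_def sums_iff)
  qed
  then have "\<forall>\<^sub>F y in nhds x. g (of_real y) = complex_of_real (f y)"
    unfolding eventually_nhds_metric dist_real_def using r by blast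
  ultimately show "real_analytic_at f x" unfolding real_analytic_at_def by blast
next
  assume *: "\<forall>x. real_analytic_at f x"
  have "\<exists>r>0. \<exists>c. \<forall>y\<in>UNIV. \<bar>y - x\<bar> < r \<longrightarrow> (\<lambda>n. c n * (y - x) ^ n) sums f y" for x
  proof -
    obtain g where g: "g analytic_on {of_real x}" "\<forall>\<^sub>F y in nhds x. g (of_real y) = complex_of_real (f y)"
      using * unfolding real_analytic_at_def by blast
    obtain r1 where r1: "r1 > 0" "g holomorphic_on ball (of_real x) r1"
      using g(1) by (auto simp: analytic_on_def)
    obtain r2 where r2: "r2 > 0" "\<And>y. \<bar>y - x\<bar> < r2 \<Longrightarrow> g (of_real y) = of_real (f y)"
      using g(2) unfolding eventually_nhds_metric dist_real_def by blast
    define c where "c n = Re ((deriv ^^ n) g (of_real x) / fact n)" for n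
    have "(\<lambda>n. c n * (y - x) ^ n) sums f y" if y: "\<bar>y - x\<bar> < min r1 r2" for y
    proof -
      have "(\<lambda>n. (deriv ^^ n) g (of_real x) / fact n * (of_real y - of_real x) ^ n) sums g (of_real y)"
        using y by (intro holomorphic_power_series[OF r1(2)])
          (auto simp: dist_norm norm_minus_commute simp flip: of_real_diff)
      then have "(\<lambda>n. Re ((deriv ^^ n) g (of_real x) / fact n * (of_real y - of_real x) ^ n)) sums Re (g (of_real y))"
        by (rule sums_Re)
      moreover have "Re (z * (of_real y - of_real x) ^ n) = Re z * (y - x) ^ n" for z n
        by (simp flip: of_real_diff of_real_power)
      ultimately have "(\<lambda>n. c n * (y - x) ^ n) sums Re (g (of_real y))"
        unfolding c_def by (simp only:)
      then show ?thesis using r2 y by simp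
    qed
    then show ?thesis using r1 r2 by (intro exI[of _ "min r1 r2"]) auto
  qed
  then show "real_analytic_on f UNIV" unfolding real_analytic_on_def by blast
qed

text \<open>
  On a set \<open>X\<close> the power series need to represent the function only at points of \<open>X\<close>. So a piece of a
  wave is analytic up to its endpoints as soon as it agrees there with a function that is analytic on the
  whole line.
\<close>

lemma real_analytic_on_cong_subset:
  assumes "real_analytic_on f UNIV" "\<And>x. x \<in> X \<Longrightarrow> g x = f x"
  shows "real_analytic_on g X"
  unfolding real_analytic_on_def
proof
  fix x assume "x \<in> X"
  obtain r c where "r > 0" "\<And>y. \<bar>y - x\<bar> < r \<Longrightarrow> (\<lambda>n. c n * (y - x) ^ n) sums f y"
    using assms(1) unfolding real_analytic_on_def by blast
  then show "\<exists>r>0. \<exists>c. \<forall>y\<in>X. \<bar>y - x\<bar> < r \<longrightarrow> (\<lambda>n. c n * (y - x) ^ n) sums g y"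
    using assms(2) by auto
qed

text \<open>
  The extension takes real values on the real axis, hence so does its complex derivative, which therefore
  extends the real one.
\<close>

lemma real_analytic_at_derivative:
  assumes "real_analytic_at f x"
  shows "f differentiable (at x)" "real_analytic_at (deriv f) x"
proof -
  obtain g where g: "g analytic_on {of_real x}" "\<forall>\<^sub>F y in nhds x. g (of_real y) = complex_of_real (f y)"
    using assms unfolding real_analytic_at_def by blast
  obtain S where S: "open S" "of_real x \<in> S" "g holomorphic_on S"
    using g(1) by (auto simp: analytic_at)
  have *: "(f has_real_derivative Re (deriv g (of_real y))) (at y) \<and> deriv g (of_real y) = of_real (deriv f y)"
    if "of_real y \<in> S" "\<forall>\<^sub>F y in nhds y. g (of_real y) = complex_of_real (f y)" for y
  proof -
    have "(g has_field_derivative deriv g (of_real y)) (at (of_real y))"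
      using S that by (intro holomorphic_derivI)
    then have "((\<lambda>y. g (of_real y)) has_vector_derivative deriv g (of_real y)) (at y)"
      by (rule has_vector_derivative_real_field)
    then have d: "((\<lambda>y. complex_of_real (f y)) has_vector_derivative deriv g (of_real y)) (at y)"
      by (rule has_vector_derivative_eventually_eq[OF _ that(2)])
    have "((\<lambda>y. Re (complex_of_real (f y))) has_vector_derivative Re (deriv g (of_real y))) (at y)"
      by (rule bounded_linear.has_vector_derivative[OF bounded_linear_Re d])
    then have r: "(f has_real_derivative Re (deriv g (of_real y))) (at y)"
      by (simp add: has_real_derivative_iff_has_vector_derivative)
    have "((\<lambda>y. Im (complex_of_real (f y))) has_vector_derivative Im (deriv g (of_real y))) (at y)"
      by (rule bounded_linear.has_vector_derivative[OF bounded_linear_Im d])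
    then have "Im (deriv g (of_real y)) = 0"
      using vector_derivative_unique_at[OF _ has_vector_derivative_const, of "0"] by simp
    then show ?thesis using r DERIV_imp_deriv[OF r] by (auto simp: complex_eq_iff)
  qed
  have ev: "\<forall>\<^sub>F z in nhds x. \<forall>\<^sub>F y in nhds z. g (of_real y) = complex_of_real (f y)"
    using g(2) by (simp add: eventually_eventually)
  have "\<forall>\<^sub>F y in nhds x. deriv g (of_real y) = of_real (deriv f y)"
    using ev eventually_nhds_of_real[OF S(1,2)] by eventually_elim (use * in blast)
  moreover have "deriv g analytic_on {of_real x}" using g(1) by (rule analytic_deriv)
  ultimately show "real_analytic_at (deriv f) x" unfolding real_analytic_at_def by blast
  show "f differentiable (at x)"
    using *[OF S(2) g(2)] by (auto simp: real_differentiable_def)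
qed

lemma real_analytic_at_isCont: "real_analytic_at f x \<Longrightarrow> isCont f x"
  by (auto intro: differentiable_imp_continuous_within dest: real_analytic_at_derivative(1))

lemma real_analytic_at_compose:
  assumes "real_analytic_at f x" "real_analytic_at h (f x)"
  shows "real_analytic_at (\<lambda>y. h (f y)) x"
proof -
  obtain g where g: "g analytic_on {of_real x}" "\<forall>\<^sub>F y in nhds x. g (of_real y) = complex_of_real (f y)"
    using assms unfolding real_analytic_at_def by blast
  obtain k where k: "k analytic_on {of_real (f x)}" "\<forall>\<^sub>F y in nhds (f x). k (of_real y) = complex_of_real (h y)"
    using assms unfolding real_analytic_at_def by blast
  have gx: "g (of_real x) = of_real (f x)" using g(2) by (rule eventually_nhds_x_imp_x)
  have "(k \<circ> g) analytic_on {of_real x}"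
    using g k gx by (intro analytic_on_compose) auto
  moreover have "\<forall>\<^sub>F y in nhds x. k (of_real (f y)) = complex_of_real (h (f y))"
    by (rule eventually_compose_filterlim[OF k(2)])
      (use real_analytic_at_isCont[OF assms(1)] in \<open>simp add: isCont_def tendsto_nhds_iff\<close>)
  then have "\<forall>\<^sub>F y in nhds x. (k \<circ> g) (of_real y) = complex_of_real (h (f y))"
    using g(2) by eventually_elim simp
  ultimately show ?thesis unfolding real_analytic_at_def by blast
qed

lemma real_analytic_at_mult:
  assumes "real_analytic_at f x" "real_analytic_at h x"
  shows "real_analytic_at (\<lambda>y. f y * h y) x"
proof -
  obtain g where g: "g analytic_on {of_real x}" "\<forall>\<^sub>F y in nhds x. g (of_real y) = complex_of_real (f y)"
    using assms unfolding real_analytic_at_def by blast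
  obtain k where k: "k analytic_on {of_real x}" "\<forall>\<^sub>F y in nhds x. k (of_real y) = complex_of_real (h y)"
    using assms unfolding real_analytic_at_def by blast
  have "\<forall>\<^sub>F y in nhds x. g (of_real y) * k (of_real y) = complex_of_real (f y * h y)"
    using g(2) k(2) by eventually_elim simp
  moreover have "(\<lambda>z. g z * k z) analytic_on {of_real x}"
    using g k by (intro analytic_intros)
  ultimately show ?thesis unfolding real_analytic_at_def by blast
qed

lemma real_analytic_at_sqrt:
  assumes "x > 0"
  shows "real_analytic_at sqrt x"
proof -
  have "csqrt analytic_on {of_real x}"
    by (rule analytic_on_subset[OF analytic_on_csqrt])
      (use assms in \<open>auto simp: complex_nonpos_Reals_iff\<close>)
  moreover have "\<forall>\<^sub>F y in nhds x. csqrt (of_real y) = of_real (sqrt y)"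
    using eventually_nhds_in_open[of "{0<..}" x] assms
    by (auto elim!: eventually_mono)
  ultimately show ?thesis unfolding real_analytic_at_def by blast
qed

lemma real_analytic_at_affine: "real_analytic_at (\<lambda>y. a * y + b) x"
  unfolding real_analytic_at_def
  by (rule exI[of _ "\<lambda>z. of_real a * z + of_real b"]) (auto intro!: analytic_intros)

text \<open>Dividing out a zero: the quotient is a removable singularity of the complex extension.\<close>

lemma real_analytic_factor_zero:
  assumes "\<And>x. real_analytic_at f x" "f 0 = 0"
  obtains h where "\<And>x. real_analytic_at h x" "\<And>x. f x = x * h x" "h 0 = deriv f 0"
proof
  define h where "h x = (if x = 0 then deriv f 0 else f x / x)" for x
  show "f x = x * h x" for x using assms(2) by (simp add: h_def)
  show "h 0 = deriv f 0" by (simp add: h_def)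
  show "real_analytic_at h x" for x
  proof -
    obtain g where g: "g analytic_on {of_real x}" "\<forall>\<^sub>F y in nhds x. g (of_real y) = complex_of_real (f y)"
      using assms unfolding real_analytic_at_def by blast
    define k where "k z = (if z = 0 then complex_of_real (deriv f 0) else g z / z)" for z
    have "k analytic_on {of_real x}"
    proof (cases "x = 0")
      case False
      have "(\<lambda>z. g z / z) analytic_on {of_real x}" using False g by (intro analytic_intros) auto
      moreover have "\<forall>\<^sub>F z in nhds (complex_of_real x). g z / z = k z"
        using eventually_nhds_in_open[of "- {0}" "complex_of_real x"] False
        by (simp add: open_Compl) (erule eventually_mono, auto simp: k_def)
      ultimately show ?thesis by (subst (asm) analytic_at_cong[OF _ refl])
    next
      case True
      obtain S where S: "open S" "of_real x \<in> S" "g holomorphic_on S"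
        using g(1) by (auto simp: analytic_at)
      have g0: "g 0 = 0" using g(2) assms(2) True by (auto dest: eventually_nhds_x_imp_x)
      have "(g has_field_derivative deriv g (of_real 0)) (at (of_real 0))"
        using S True by (intro holomorphic_derivI) auto
      then have "((\<lambda>y. g (of_real y)) has_vector_derivative deriv g 0) (at 0)"
        using has_vector_derivative_real_field by fastforce
      then have "((\<lambda>y. complex_of_real (f y)) has_vector_derivative deriv g 0) (at 0)"
        by (rule has_vector_derivative_eventually_eq) (use g(2) True in simp)
      moreover have "(f has_real_derivative deriv f 0) (at 0)"
        using real_analytic_at_derivative(1)[OF assms(1), of 0]
        by (simp add: DERIV_deriv_iff_real_differentiable)
      then have "((\<lambda>y. complex_of_real (f y)) has_vector_derivative of_real (deriv f 0)) (at 0)"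
        by (rule has_vector_derivative_of_real)
      ultimately have "deriv g 0 = of_real (deriv f 0)" by (rule vector_derivative_unique_at)
      then have "k holomorphic_on S"
        by (intro pole_theorem_open_0[OF S(3,1), of 0]) (auto simp: k_def g0)
      then show ?thesis using S by (auto simp: analytic_at)
    qed
    moreover have "\<forall>\<^sub>F y in nhds x. k (of_real y) = complex_of_real (h y)"
      using g(2) by eventually_elim (auto simp: k_def h_def)
    ultimately show ?thesis unfolding real_analytic_at_def by blast
  qed
qed

text \<open>
  Separation of variables. With a complex primitive \<open>\<Phi>\<close> of \<open>1 / \<sigma>\<close>, the difference \<open>\<Phi> (Y s) - s\<close> is locally
  constant, so \<open>Y\<close> is a translate of the holomorphic local inverse of \<open>\<Phi>\<close>.
\<close>

lemma real_analytic_at_autonomous_ode: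
  assumes ode: "\<forall>\<^sub>F s in nhds t. (Y has_real_derivative \<sigma> (Y s)) (at s)"
    and \<sigma>: "real_analytic_at \<sigma> (Y t)" "\<sigma> (Y t) \<noteq> 0"
  shows "real_analytic_at Y t"
proof -
  let ?c = "complex_of_real"
  obtain G where G: "G analytic_on {?c (Y t)}" "\<forall>\<^sub>F y in nhds (Y t). G (?c y) = ?c (\<sigma> y)"
    using \<sigma> unfolding real_analytic_at_def by blast
  obtain S0 where S0: "open S0" "?c (Y t) \<in> S0" "G holomorphic_on S0"
    using G(1) by (auto simp: analytic_at)
  have Gt: "G (?c (Y t)) = ?c (\<sigma> (Y t))" using G(2) by (rule eventually_nhds_x_imp_x)
  obtain S1 where S1: "open S1" "?c (Y t) \<in> S1" "\<forall>z\<in>S1. G z \<noteq> 0"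
  proof -
    have "open (S0 \<inter> G -` (- {0}))"
      using S0 by (intro continuous_open_preimage holomorphic_on_imp_continuous_on) auto
    then show ?thesis using that[of "S0 \<inter> G -` (- {0})"] S0 Gt \<sigma>(2) by auto
  qed
  obtain r where r: "r > 0" "ball (?c (Y t)) r \<subseteq> S0 \<inter> S1"
    using S0 S1 by (meson Int_iff open_Int open_contains_ball)
  have "(\<lambda>z. 1 / G z) holomorphic_on ball (?c (Y t)) r"
    using r S0 S1 by (intro holomorphic_intros) (auto intro: holomorphic_on_subset)
  then obtain \<Phi> where "\<And>z. z \<in> ball (?c (Y t)) r \<Longrightarrow>
      (\<Phi> has_field_derivative 1 / G z) (at z within ball (?c (Y t)) r)"
    using holomorphic_convex_primitive'[of "ball (?c (Y t)) r" "\<lambda>z. 1 / G z"] by auto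
  then have \<Phi>: "(\<Phi> has_field_derivative 1 / G z) (at z)" if "z \<in> ball (?c (Y t)) r" for z
    using that by (metis at_within_open open_ball)
  have hol: "\<Phi> holomorphic_on ball (?c (Y t)) r"
    unfolding holomorphic_on_open[OF open_ball] using \<Phi> by blast
  have "deriv \<Phi> (?c (Y t)) \<noteq> 0"
    using DERIV_imp_deriv[OF \<Phi>] r Gt \<sigma>(2) by simp
  then obtain d where d: "d > 0" "ball (?c (Y t)) d \<subseteq> ball (?c (Y t)) r"
      "open (\<Phi> ` ball (?c (Y t)) d)" "inj_on \<Phi> (ball (?c (Y t)) d)"
    using has_complex_derivative_locally_invertible[OF hol] r
    by (metis centre_in_ball open_ball)
  obtain \<Psi> where \<Psi>: "\<Psi> holomorphic_on (\<Phi> ` ball (?c (Y t)) d)"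
      "\<And>z. z \<in> ball (?c (Y t)) d \<Longrightarrow> \<Psi> (\<Phi> z) = z"
    using holomorphic_has_inverse[of \<Phi> "ball (?c (Y t)) d"] hol d
    by (metis holomorphic_on_subset open_ball)
  have cont: "isCont Y t"
    using eventually_nhds_x_imp_x[OF ode] DERIV_isCont by blast
  then have lim: "filterlim Y (nhds (Y t)) (nhds t)"
    by (simp add: isCont_def tendsto_nhds_iff)
  have "\<forall>\<^sub>F s in nhds t. ?c (Y s) \<in> ball (?c (Y t)) d"
    by (rule eventually_compose_filterlim[OF eventually_nhds_of_real lim]) (use d in auto)
  moreover have "\<forall>\<^sub>F s in nhds t. G (?c (Y s)) = ?c (\<sigma> (Y s))"
    by (rule eventually_compose_filterlim[OF G(2) lim])
  ultimately have "\<forall>\<^sub>F s in nhds t. ?c (Y s) \<in> ball (?c (Y t)) d \<and> G (?c (Y s)) = ?c (\<sigma> (Y s))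
      \<and> (Y has_real_derivative \<sigma> (Y s)) (at s)"
    using ode by eventually_elim simp
  then obtain e where e: "e > 0" and loc: "\<And>s. \<bar>s - t\<bar> < e \<Longrightarrow> ?c (Y s) \<in> ball (?c (Y t)) d \<and> G (?c (Y s)) = ?c (\<sigma> (Y s))
      \<and> (Y has_real_derivative \<sigma> (Y s)) (at s)"
    unfolding eventually_nhds_metric dist_real_def by blast
  have der: "((\<lambda>s. \<Phi> (?c (Y s)) - ?c s) has_vector_derivative 0) (at s)" if s: "\<bar>s - t\<bar> < e" for s
  proof -
    have z: "?c (Y s) \<in> ball (?c (Y t)) r" "?c (Y s) \<in> S1" using loc[OF s] d(2) r(2) by blast+
    have Ys: "((\<lambda>s. ?c (Y s)) has_vector_derivative ?c (\<sigma> (Y s))) (at s)"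
      using loc[OF s] by (intro has_vector_derivative_of_real)
        (simp add: has_real_derivative_iff_has_vector_derivative)
    have "((\<Phi> \<circ> (\<lambda>s. ?c (Y s))) has_vector_derivative ?c (\<sigma> (Y s)) * (1 / G (?c (Y s)))) (at s)"
      by (rule field_vector_diff_chain_at[OF Ys \<Phi>[OF z(1)]])
    then have "((\<lambda>s. \<Phi> (?c (Y s))) has_vector_derivative 1) (at s)"
      using loc[OF s] S1(3) z(2) by (auto simp: o_def)
    moreover have "(?c has_vector_derivative 1) (at s)"
      using has_vector_derivative_of_real[of "\<lambda>s. s" 1 "at s"] by simp
    ultimately show ?thesis using has_vector_derivative_diff by fastforce
  qed
  have eq: "\<Phi> (?c (Y s)) = \<Phi> (?c (Y t)) + (?c s - ?c t)" if s: "\<bar>s - t\<bar> < e" for s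
  proof -
    obtain c where "\<And>s. s \<in> ball t e \<Longrightarrow> \<Phi> (?c (Y s)) - ?c s = c"
      by (rule has_vector_derivative_zero_constant[of "ball t e" "\<lambda>s. \<Phi> (?c (Y s)) - ?c s"])
        (use der in \<open>auto simp: dist_real_def abs_minus_commute intro: has_vector_derivative_at_within\<close>)
    then have c: "\<And>s. \<bar>s - t\<bar> < e \<Longrightarrow> \<Phi> (?c (Y s)) - ?c s = c"
      by (auto simp: dist_real_def abs_minus_commute)
    show ?thesis using c[OF s] c[of t] e by (simp add: algebra_simps)
  qed
  define g where "g z = \<Psi> (\<Phi> (?c (Y t)) + (z - ?c t))" for z
  have "\<Psi> analytic_on {\<Phi> (?c (Y t))}"
    using \<Psi>(1) d by (auto simp: analytic_at)
  moreover have "(\<lambda>z. \<Phi> (?c (Y t)) + (z - ?c t)) analytic_on {?c t}"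
    by (intro analytic_intros)
  ultimately have "\<Psi> \<circ> (\<lambda>z. \<Phi> (?c (Y t)) + (z - ?c t)) analytic_on {?c t}"
    by (intro analytic_on_compose) simp_all
  then have "g analytic_on {?c t}" by (simp add: g_def[abs_def] o_def)
  moreover have "g (?c s) = ?c (Y s)" if "\<bar>s - t\<bar> < e" for s
    using \<Psi>(2) loc[OF that] unfolding g_def eq[OF that, symmetric] by blast
  then have "\<forall>\<^sub>F s in nhds t. g (?c s) = ?c (Y s)"
    unfolding eventually_nhds_metric dist_real_def using e by blast
  ultimately show ?thesis unfolding real_analytic_at_def by blast
qed

section \<open>The wave profile by separation of variables\<close>

text \<open>
  \<open>Y\<close> is the inverse of \<open>\<Phi> y = \<integral> 1 / \<sigma>\<close>, the integral from \<open>0\<close> to \<open>y\<close>. By the bound on \<open>\<sigma>\<close> this time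
  grows at least like \<open>- ln (r - y) / C\<close>, so it takes every real value, and \<open>Y\<close> exists for all time. The last
  clause is uniqueness: \<open>\<Phi> (z s) - s\<close> is constant along any solution. It asks nothing of the equation at the
  initial time \<open>a\<close>, where the square root of a wave is not known to be differentiable.
\<close>

lemma profile_exists:
  fixes \<sigma> :: "real \<Rightarrow> real"
  assumes r: "r > 0" and C: "C > 0"
    and cont: "\<And>y. \<bar>y\<bar> < r \<Longrightarrow> isCont \<sigma> y"
    and pos: "\<And>y. \<bar>y\<bar> < r \<Longrightarrow> \<sigma> y > 0"
    and even: "\<And>y. \<sigma> (- y) = \<sigma> y"
    and bound: "\<And>y. 0 \<le> y \<Longrightarrow> y < r \<Longrightarrow> \<sigma> y \<le> C * (r - y)"
  obtains Y where "Y 0 = 0" "\<And>t. \<bar>Y t\<bar> < r" "\<And>t. (Y has_real_derivative \<sigma> (Y t)) (at t)"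
    "\<And>t. Y (- t) = - Y t" "(Y \<longlongrightarrow> r) at_top"
    "\<And>z a t. a \<le> t \<Longrightarrow> continuous_on {a..t} z \<Longrightarrow> z a = 0 \<Longrightarrow>
        \<forall>s\<in>{a<..t}. \<bar>z s\<bar> < r \<and> (z has_real_derivative \<sigma> (z s)) (at s) \<Longrightarrow>
        z t = Y (t - a)"
proof -
  have "\<exists>F. \<forall>x :: real. ereal (- r) < x \<longrightarrow> x < ereal r \<longrightarrow>
      (F has_vector_derivative (1 / \<sigma> x)) (at x)"
  proof (rule einterval_antiderivative)
    show "isCont (\<lambda>x. 1 / \<sigma> x) x" if "ereal (- r) < ereal x" "ereal x < ereal r" for x
      using that pos[of x] by (intro isCont_divide cont) (auto simp: abs_less_iff)
  qed (use r in simp)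
  then obtain \<Phi>0 :: "real \<Rightarrow> real" where
    "\<forall>x. ereal (- r) < ereal x \<longrightarrow> ereal x < ereal r \<longrightarrow> (\<Phi>0 has_vector_derivative 1 / \<sigma> x) (at x)"
    by blast
  then have \<Phi>0: "(\<Phi>0 has_real_derivative 1 / \<sigma> y) (at y)" if "\<bar>y\<bar> < r" for y
    using that by (auto simp: has_real_derivative_iff_has_vector_derivative abs_less_iff)
  define \<Phi> where "\<Phi> y = \<Phi>0 y - \<Phi>0 0" for y
  have \<Phi>[simp]: "\<Phi> 0 = 0" by (simp add: \<Phi>_def)
  have D\<Phi>: "(\<Phi> has_real_derivative 1 / \<sigma> y) (at y)" if "\<bar>y\<bar> < r" for y
    unfolding \<Phi>_def using \<Phi>0[OF that] by (auto intro!: derivative_eq_intros)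
  have cont\<Phi>: "isCont \<Phi> y" if "\<bar>y\<bar> < r" for y using D\<Phi>[OF that] by (rule DERIV_isCont)
  have less: "\<Phi> x < \<Phi> y" if "x < y" "\<bar>x\<bar> < r" "\<bar>y\<bar> < r" for x y
  proof (rule DERIV_pos_imp_increasing[OF that(1)])
    fix w assume "x \<le> w" "w \<le> y"
    then have "\<bar>w\<bar> < r" using that by linarith
    then show "\<exists>d. (\<Phi> has_real_derivative d) (at w) \<and> d > 0"
      using D\<Phi>[of w] pos[of w] by (intro exI[of _ "1 / \<sigma> w"]) simp
  qed
  have inj: "x = y" if "\<Phi> x = \<Phi> y" "\<bar>x\<bar> < r" "\<bar>y\<bar> < r" for x y
    using less[of x y] less[of y x] that by (cases x y rule: linorder_cases) auto
  have odd: "\<Phi> (- y) = - \<Phi> y" if "\<bar>y\<bar> < r" for y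
  proof -
    have der0: "((\<lambda>y. \<Phi> y + \<Phi> (- y)) has_real_derivative 0) (at y)" if "\<bar>y\<bar> < r" for y
    proof -
      have "((\<lambda>y. \<Phi> (- y)) has_real_derivative (1 / \<sigma> (- y)) * (- 1)) (at y)"
        by (rule DERIV_chain'[of uminus, OF _ D\<Phi>]) (use that in \<open>auto intro!: derivative_eq_intros\<close>)
      from DERIV_add[OF D\<Phi>[OF that] this] show ?thesis by (simp add: even)
    qed
    have const: "((\<lambda>y. \<Phi> y + \<Phi> (- y)) has_vector_derivative 0) (at y within {- r<..<r})"
      if "y \<in> {- r<..<r}" for y
      by (rule has_vector_derivative_at_within)
        (use that der0[of y] in \<open>simp add: has_real_derivative_iff_has_vector_derivative abs_less_iff\<close>)
    obtain c where "\<And>y. y \<in> {- r<..<r} \<Longrightarrow> \<Phi> y + \<Phi> (- y) = c"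
      using has_vector_derivative_zero_constant[of "{- r<..<r}" "\<lambda>y. \<Phi> y + \<Phi> (- y)", OF _ const]
      by (meson convex_real_interval(8))
    from this[of y] this[of 0] show ?thesis using that r by (simp add: abs_less_iff)
  qed
  have lower: "\<Phi> y \<ge> (ln r - ln (r - y)) / C" if y: "0 \<le> y" "y < r" for y
  proof -
    have "\<Phi> 0 + ln (r - 0) / C \<le> \<Phi> y + ln (r - y) / C"
    proof (rule DERIV_nonneg_imp_nondecreasing[OF y(1)], goal_cases)
      case (1 x)
      have "((\<lambda>y. ln (r - y) / C) has_real_derivative - (1 / (C * (r - x)))) (at x)"
        using 1 y C by (auto intro!: derivative_eq_intros simp: divide_simps)
      from DERIV_add[OF D\<Phi> this]
      have "((\<lambda>y. \<Phi> y + ln (r - y) / C) has_real_derivative 1 / \<sigma> x - 1 / (C * (r - x))) (at x)"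
        using 1 y by simp
      moreover have "1 / (C * (r - x)) \<le> 1 / \<sigma> x"
        using bound[of x] pos[of x] 1 y by (intro divide_left_mono) auto
      ultimately show ?case by (metis diff_ge_0_iff_ge)
    qed
    then show ?thesis by (simp add: diff_divide_distrib)
  qed
  have surj_nonneg: "\<exists>y. \<bar>y\<bar> < r \<and> \<Phi> y = t" if "t \<ge> 0" for t
  proof -
    \<comment> \<open>the point that the lower bound for \<open>\<Phi>\<close> sends exactly to \<open>t\<close>\<close>
    define y where "y = r - r * exp (- C * t)"
    have y: "0 \<le> y" "y < r" using r C that by (auto simp: y_def)
    have "t \<le> \<Phi> y" using lower[OF y] C r by (simp add: y_def ln_mult)
    then have "\<exists>x\<ge>0. x \<le> y \<and> \<Phi> x = t"
      using y that by (intro IVT) (auto intro!: cont\<Phi>)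
    then show ?thesis using y by force
  qed
  have "\<exists>y. \<bar>y\<bar> < r \<and> \<Phi> y = t" for t
  proof (cases "t \<ge> 0")
    case False
    then obtain y where "\<bar>y\<bar> < r" "\<Phi> y = - t" using surj_nonneg[of "- t"] by auto
    then show ?thesis using odd[of y] by (intro exI[of _ "- y"]) simp
  qed (rule surj_nonneg)
  then obtain Y where Y: "\<And>t. \<bar>Y t\<bar> < r" "\<And>t. \<Phi> (Y t) = t" by metis
  have Y\<Phi>: "Y (\<Phi> y) = y" if "\<bar>y\<bar> < r" for y using inj Y that by blast
  have contY: "isCont Y t" for t
  proof -
    define d where "d = (r - \<bar>Y t\<bar>) / 2"
    have d: "d > 0" using Y(1)[of t] by (simp add: d_def)
    have near: "\<bar>z\<bar> < r" if "\<bar>z - Y t\<bar> \<le> d" for z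
      using that Y(1)[of t] abs_triangle_ineq[of "z - Y t" "Y t"] by (simp add: d_def field_simps)
    have "isCont Y (\<Phi> (Y t))"
      by (rule isCont_inverse_function[of d]) (use d near Y\<Phi> cont\<Phi> in blast)+
    then show ?thesis by (simp add: Y)
  qed
  have DY: "(Y has_real_derivative \<sigma> (Y t)) (at t)" for t
  proof -
    have "(Y has_real_derivative inverse (1 / \<sigma> (Y t))) (at t)"
      by (rule DERIV_inverse_function[of \<Phi> _ _ _ "t - 1" "t + 1"])
        (use D\<Phi>[OF Y(1)[of t]] Y(2) pos[OF Y(1)[of t]] contY in simp_all)
    then show ?thesis by simp
  qed
  have "Y 0 = 0" using Y\<Phi>[of 0] r by simp
  moreover have "Y (- t) = - Y t" for t
    using Y\<Phi>[of "- Y t"] odd[of "Y t"] Y by simp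
  moreover have "(Y \<longlongrightarrow> r) at_top"
  proof (rule order_tendstoI)
    fix y assume "y < r"
    define x where "x = max 0 y"
    have x: "\<bar>x\<bar> < r" "y \<le> x" using \<open>y < r\<close> r by (auto simp: x_def)
    have "y < Y t" if "t > \<Phi> x" for t
      using less[of "Y t" x] that x Y by (metis linorder_cases not_less_iff_gr_or_eq order.strict_trans1)
    then show "\<forall>\<^sub>F t in at_top. y < Y t"
      by (intro eventually_mono[OF eventually_gt_at_top[of "\<Phi> x"]])
  next
    fix y assume "r < y"
    then show "\<forall>\<^sub>F t in at_top. Y t < y"
      using Y(1) by (intro always_eventually) (smt (verit))
  qed
  moreover have "z t = Y (t - a)"
    if at: "a \<le> t" and cz: "continuous_on {a..t} z" and za: "z a = 0"
      and ode: "\<forall>s\<in>{a<..t}. \<bar>z s\<bar> < r \<and> (z has_real_derivative \<sigma> (z s)) (at s)"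
    for z a t
  proof (cases "a = t")
    case True then show ?thesis using za \<open>Y 0 = 0\<close> by simp
  next
    case False
    then have "a < t" using at by simp
    have zr: "\<bar>z s\<bar> < r" if "s \<in> {a..t}" for s
      using ode that za r by (cases "s = a") auto
    have "continuous_on {- r<..<r} \<Phi>"
      using cont\<Phi> by (intro continuous_at_imp_continuous_on) (auto simp: abs_less_iff)
    then have "continuous_on {a..t} (\<lambda>s. \<Phi> (z s))"
      by (rule continuous_on_compose2[OF _ cz]) (use zr in \<open>force simp: abs_less_iff\<close>)
    moreover have "((\<lambda>s. \<Phi> (z s)) has_real_derivative 1) (at s)" if s: "a < s" "s < t" for s
    proof -
      have "((\<lambda>s. \<Phi> (z s)) has_real_derivative (1 / \<sigma> (z s)) * \<sigma> (z s)) (at s)"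
        by (rule DERIV_chain2[OF D\<Phi>]) (use ode s in auto)
      then show ?thesis using pos[of "z s"] zr[of s] s by simp
    qed
    moreover from this have "(\<lambda>s. \<Phi> (z s)) differentiable (at s)" if "a < s" "s < t" for s
      using that real_differentiable_def by blast
    ultimately obtain s l where "a < s" "s < t" "((\<lambda>s. \<Phi> (z s)) has_real_derivative l) (at s)"
      "\<Phi> (z t) - \<Phi> (z a) = (t - a) * l" "((\<lambda>s. \<Phi> (z s)) has_real_derivative 1) (at s)"
      using MVT[OF \<open>a < t\<close>, of "\<lambda>s. \<Phi> (z s)"] by blast
    then have "\<Phi> (z t) - \<Phi> (z a) = (t - a) * 1"
      using DERIV_unique by blast
    then have "\<Phi> (z t) = t - a" using za by simp
    then show ?thesis using Y\<Phi>[of "z t"] zr[of t] at by simp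
  qed
  ultimately show thesis using that[of Y] Y DY by blast
qed

lemma real_analytic_at_has_derivative:
  "real_analytic_at f x \<Longrightarrow> (f has_real_derivative deriv f x) (at x)"
  using real_analytic_at_derivative(1) by (simp add: DERIV_deriv_iff_real_differentiable)

text \<open>
  Dividing out the zero twice leaves a factor that is bounded on the interval. So \<open>sqrt s\<close> is at most
  proportional to the distance from a double zero, as \<open>profile_exists\<close> requires.
\<close>

lemma analytic_double_zero_bound:
  assumes s: "\<And>x. real_analytic_at s x" and "s r = 0" "(s has_real_derivative 0) (at r)"
  obtains K where "K > 0" "\<And>y. 0 \<le> y \<Longrightarrow> y \<le> r \<Longrightarrow> s y \<le> K * (r - y)\<^sup>2"
proof -
  define p where "p x = s (- 1 * x + r)" for x
  have p: "real_analytic_at p x" for x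
    unfolding p_def by (rule real_analytic_at_compose[OF real_analytic_at_affine s])
  have "((\<lambda>x. - 1 * x + r) has_real_derivative - 1) (at 0)"
    by (auto intro!: derivative_eq_intros)
  then have "(p has_real_derivative 0 * - 1) (at 0)"
    unfolding p_def by (intro DERIV_chain2) (use assms in auto)
  then have p0: "deriv p 0 = 0" by (simp add: DERIV_imp_deriv)
  obtain h1 where h1: "\<And>x. real_analytic_at h1 x" "\<And>x. p x = x * h1 x" "h1 0 = deriv p 0"
    using real_analytic_factor_zero[of p] p assms(2) by (metis p_def add_0 mult_zero_right)
  obtain h where h: "\<And>x. real_analytic_at h x" "\<And>x. h1 x = x * h x"
    using real_analytic_factor_zero[of h1] h1 p0 by metis
  have "continuous_on {0..r} h"
    by (intro continuous_at_imp_continuous_on ballI real_analytic_at_isCont h)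
  then have "bounded (h ` {0..r})"
    by (intro compact_imp_bounded compact_continuous_image) auto
  then obtain K where K: "K > 0" "\<And>x. x \<in> {0..r} \<Longrightarrow> \<bar>h x\<bar> \<le> K"
    unfolding bounded_pos by auto
  show thesis
  proof
    fix y assume "0 \<le> y" "y \<le> r"
    then have "h (r - y) \<le> K" using K(2)[of "r - y"] by auto
    moreover have "s y = (r - y)\<^sup>2 * h (r - y)"
      using h1(2)[of "r - y"] h(2)[of "r - y"] by (simp add: p_def power2_eq_square)
    ultimately show "s y \<le> K * (r - y)\<^sup>2" by (simp add: mult.commute[of _ "h (r - y)"] mult_right_mono)
  qed (rule K)
qed

lemma analytic_quadratic_factor:
  assumes F: "\<And>x. real_analytic_at F x" and F0: "deriv F 0 = 0"
  obtains Q where "\<And>x. real_analytic_at Q x" "\<And>x. F 0 - F x = x\<^sup>2 * Q x"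
    "Q 0 = - deriv (deriv F) 0 / 2"
proof -
  define f where "f x = F 0 - F x" for x
  have f: "real_analytic_at f x" for x
    using real_analytic_at_compose[OF F real_analytic_at_affine[of "- 1" "F 0"]]
    by (simp add: f_def[abs_def])
  have df: "deriv f = (\<lambda>x. - deriv F x)"
    by (rule ext, rule DERIV_imp_deriv)
      (auto simp: f_def[abs_def] intro!: derivative_eq_intros real_analytic_at_has_derivative F)
  obtain h1 where h1: "\<And>x. real_analytic_at h1 x" "\<And>x. f x = x * h1 x" "h1 0 = deriv f 0"
    using real_analytic_factor_zero[of f] f by (auto simp: f_def)
  have h10: "h1 0 = 0" using h1(3) F0 df by simp
  obtain Q where Q: "\<And>x. real_analytic_at Q x" "\<And>x. h1 x = x * Q x" "Q 0 = deriv h1 0"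
    using real_analytic_factor_zero[of h1] h1 h10 by metis
  have fQ: "F 0 - F x = x\<^sup>2 * Q x" for x
    using h1(2)[of x] Q(2)[of x] by (simp add: f_def power2_eq_square)
  have Q0: "Q 0 = - deriv (deriv F) 0 / 2"
  proof -
    have "deriv f = (\<lambda>x. 1 * h1 x + deriv h1 x * x)"
      unfolding h1(2)[abs_def]
      by (rule ext, rule DERIV_imp_deriv)
        (intro DERIV_mult DERIV_ident real_analytic_at_has_derivative h1)
    then have "deriv f = (\<lambda>x. h1 x + deriv h1 x * x)" by simp
    moreover have "((\<lambda>x. h1 x + deriv h1 x * x) has_real_derivative
        deriv h1 0 + (deriv (deriv h1) 0 * 0 + 1 * deriv h1 0)) (at 0)"
      by (rule derivative_eq_intros real_analytic_at_has_derivative h1 real_analytic_at_derivative(2) refl)+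
    ultimately have "deriv (deriv f) 0 = 2 * deriv h1 0" by (simp add: DERIV_imp_deriv)
    moreover have "deriv (deriv f) 0 = - deriv (deriv F) 0"
      unfolding df by (rule DERIV_imp_deriv)
        (intro DERIV_minus real_analytic_at_has_derivative real_analytic_at_derivative(2) F)
    ultimately show ?thesis using Q(3) by simp
  qed
  show thesis using that Q(1) fQ Q0 by blast
qed

text \<open>
  With \<open>V = Y\<^sup>2\<close> the energy equation reads \<open>2 * Y ^ 4 * Y'\<^sup>2 = F 0 - F (Y\<^sup>2) = Y ^ 4 * Q (Y\<^sup>2)\<close>. So \<open>Y\<close> may be
  taken as the solution of \<open>Y' = sqrt (Q (Y\<^sup>2) / 2)\<close>, which passes through \<open>0\<close> with positive speed.
  The last clause recovers any wave that rises from \<open>0\<close>, since its square root solves the same equation.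
\<close>

lemma wave_profile_construction:
  assumes F: "\<And>x. real_analytic_at F x" and F0: "deriv F 0 = 0" "deriv (deriv F) 0 < 0"
    and m: "m > 0" "F m = F 0" "\<And>x. x \<in> {0<..<m} \<Longrightarrow> F x < F 0" "deriv F m = 0"
  obtains V where "\<And>t. real_analytic_at V t"
    "V 0 = 0" "\<And>t. V (- t) = V t" "\<And>t. t \<noteq> 0 \<Longrightarrow> 0 < V t" "\<And>t. V t < m" "(V \<longlongrightarrow> m) at_top"
    "deriv V 0 = 0" "deriv (deriv V) 0 > 0"
    "\<And>t. V t * (deriv V t)\<^sup>2 / 2 + F (V t) = F 0"
    "\<And>t. deriv (deriv V) t * V t + (deriv V t)\<^sup>2 / 2 + deriv F (V t) = 0"
    "\<And>u u' a t. a \<le> t \<Longrightarrow> continuous_on {a..t} u \<Longrightarrow> u a = 0 \<Longrightarrow>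
        \<forall>s\<in>{a<..t}. 0 < u s \<and> u s < m \<and> 0 < u' s \<and> (u has_real_derivative u' s) (at s) \<and>
            u s * (u' s)\<^sup>2 / 2 + F (u s) = F 0 \<Longrightarrow>
        u t = V (t - a)"
proof -
  define f where "f x = F 0 - F x" for x
  have f: "real_analytic_at f x" for x
    using real_analytic_at_compose[OF F real_analytic_at_affine[of "- 1" "F 0"]]
    by (simp add: f_def[abs_def])
  obtain Q where Q: "\<And>x. real_analytic_at Q x" "\<And>x. F 0 - F x = x\<^sup>2 * Q x"
    "Q 0 = - deriv (deriv F) 0 / 2"
    using analytic_quadratic_factor[OF F F0(1)] by blast
  have fQ: "f x = x\<^sup>2 * Q x" for x using Q(2) by (simp add: f_def)
  have df: "deriv f = (\<lambda>x. - deriv F x)"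
    by (rule ext, rule DERIV_imp_deriv)
      (auto simp: f_def[abs_def] intro!: derivative_eq_intros real_analytic_at_has_derivative F)
  have Q0: "Q 0 > 0" using Q(3) F0(2) by simp
  have Qpos: "Q x > 0" if "0 \<le> x" "x < m" for x
  proof (cases "x = 0")
    case False
    then have "0 < x\<^sup>2 * Q x" using m(3)[of x] that fQ[of x] by (simp add: f_def)
    then show ?thesis by (simp add: zero_less_mult_iff)
  qed (use Q0 in simp)
  have Qm: "Q m = 0" using fQ[of m] m by (simp add: f_def)
  \<comment> \<open>differentiate \<open>F 0 - F x = x\<^sup>2 * Q x\<close> at the common zero \<open>m\<close> of both sides\<close>
  have Q'm: "(Q has_real_derivative 0) (at m)"
  proof -
    have "(f has_real_derivative 2 * m * Q m + deriv Q m * m\<^sup>2) (at m)"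
      unfolding fQ[abs_def]
      by (rule derivative_eq_intros real_analytic_at_has_derivative Q refl)+ simp
    then have "deriv Q m * m\<^sup>2 = 0"
      using DERIV_imp_deriv[of f] df m(4) Qm by fastforce
    then show ?thesis using real_analytic_at_has_derivative[OF Q(1), of m] m(1) by simp
  qed
  define r where "r = sqrt m"
  have r: "r > 0" "r\<^sup>2 = m" using m(1) by (simp_all add: r_def)
  define s where "s y = Q (y * y) * (1 / 2)" for y
  define \<sigma> where "\<sigma> y = sqrt (s y)" for y
  have s: "real_analytic_at s y" for y
  proof -
    have id: "real_analytic_at (\<lambda>y. y) y" and half: "real_analytic_at (\<lambda>y. 1 / 2) y"
      using real_analytic_at_affine[of 1 0 y] real_analytic_at_affine[of 0 "1/2" y] by simp_all
    have "real_analytic_at (\<lambda>y. Q (y * y)) y"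
      by (rule real_analytic_at_compose[OF real_analytic_at_mult[OF id id] Q(1)])
    from real_analytic_at_mult[OF this half] show ?thesis unfolding s_def .
  qed
  have sq: "y * y < m" if "\<bar>y\<bar> < r" for y
    using that r abs_square_less_1 by (metis abs_ge_zero abs_mult_self_eq power2_eq_square power_strict_mono zero_less_numeral)
  have spos: "s y > 0" if "\<bar>y\<bar> < r" for y
    using Qpos[of "y * y"] sq[OF that] by (simp add: s_def)
  have "(s has_real_derivative 0) (at r)"
  proof -
    have "((\<lambda>y. y * y) has_real_derivative 2 * r) (at r)"
      by (auto intro!: derivative_eq_intros)
    then have "((\<lambda>y. Q (y * y)) has_real_derivative 0 * (2 * r)) (at r)"
      by (rule DERIV_chain2[rotated]) (use Q'm r in \<open>simp add: power2_eq_square\<close>)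
    then show ?thesis unfolding s_def by (auto intro!: derivative_eq_intros)
  qed
  then obtain K where K: "K > 0" "\<And>y. 0 \<le> y \<Longrightarrow> y \<le> r \<Longrightarrow> s y \<le> K * (r - y)\<^sup>2"
    by (rule analytic_double_zero_bound[of s r, rotated 2]) (use s Qm r in \<open>auto simp: s_def power2_eq_square\<close>)
  have \<sigma>bound: "\<sigma> y \<le> sqrt K * (r - y)" if "0 \<le> y" "y < r" for y
  proof -
    have "\<sigma> y \<le> sqrt (K * (r - y)\<^sup>2)" unfolding \<sigma>_def using K that by simp
    then show ?thesis using that by (simp add: real_sqrt_mult)
  qed
  have \<sigma>an: "real_analytic_at \<sigma> y" if "\<bar>y\<bar> < r" for y
    unfolding \<sigma>_def by (intro real_analytic_at_compose[OF s] real_analytic_at_sqrt spos that)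
  have \<sigma>pos: "\<sigma> y > 0" if "\<bar>y\<bar> < r" for y using spos[OF that] by (simp add: \<sigma>_def)
  have \<sigma>cont: "isCont \<sigma> y" if "\<bar>y\<bar> < r" for y
    using \<sigma>an[OF that] by (rule real_analytic_at_isCont)
  have \<sigma>even: "\<sigma> (- y) = \<sigma> y" for y by (simp add: \<sigma>_def s_def)
  have sK: "sqrt K > 0" using K by simp
  obtain Y where Y: "Y 0 = 0" "\<And>t. \<bar>Y t\<bar> < r" "\<And>t. (Y has_real_derivative \<sigma> (Y t)) (at t)"
    "\<And>t. Y (- t) = - Y t" "(Y \<longlongrightarrow> r) at_top"
    and Yuniq: "\<And>z a t. a \<le> t \<Longrightarrow> continuous_on {a..t} z \<Longrightarrow> z a = 0 \<Longrightarrow>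
        \<forall>s\<in>{a<..t}. \<bar>z s\<bar> < r \<and> (z has_real_derivative \<sigma> (z s)) (at s) \<Longrightarrow>
        z t = Y (t - a)"
    using profile_exists[of r "sqrt K" \<sigma>] r(1) sK \<sigma>cont \<sigma>pos \<sigma>even \<sigma>bound by blast
  have Yan: "real_analytic_at Y t" for t
    by (rule real_analytic_at_autonomous_ode[of Y \<sigma>])
      (use Y(2)[of t] \<sigma>an \<sigma>pos[of "Y t"] Y(3) in auto)
  define V where "V t = Y t * Y t" for t
  have Van: "real_analytic_at V t" for t unfolding V_def by (intro real_analytic_at_mult Yan)
  have DV: "(V has_real_derivative 2 * Y t * \<sigma> (Y t)) (at t)" for t
    unfolding V_def by (auto intro!: derivative_eq_intros Y)
  then have dV: "deriv V = (\<lambda>t. 2 * Y t * \<sigma> (Y t))" by (auto intro: DERIV_imp_deriv)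
  have Ysgn: "Y t \<noteq> 0" if "t \<noteq> 0" for t
  proof -
    have inc: "Y x < Y y" if "x < y" for x y
      by (rule DERIV_pos_imp_increasing[OF that]) (use Y \<sigma>pos in blast)
    show ?thesis using inc[of t 0] inc[of 0 t] that Y(1) by (cases t "0::real" rule: linorder_cases) auto
  qed
  have energy: "V t * (deriv V t)\<^sup>2 / 2 + F (V t) = F 0" for t
  proof -
    have "(\<sigma> (Y t))\<^sup>2 = Q (V t) / 2"
      using spos[OF Y(2)] by (simp add: \<sigma>_def s_def V_def less_imp_le)
    then have "V t * (deriv V t)\<^sup>2 / 2 = (V t)\<^sup>2 * Q (V t)"
      by (simp add: dV V_def power_mult_distrib power2_eq_square)
    then show ?thesis using fQ[of "V t"] by (simp add: f_def)
  qed
  have V0: "V 0 = 0" "deriv V 0 = 0" using Y by (simp_all add: V_def dV)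
  have dVan: "real_analytic_at (deriv V) t" for t using Van by (rule real_analytic_at_derivative)
  have second: "deriv (deriv V) t * V t + (deriv V t)\<^sup>2 / 2 + deriv F (V t) = 0" for t
  proof (cases "t = 0")
    case False
    have "((\<lambda>t. V t * (deriv V t)\<^sup>2 / 2 + F (V t)) has_real_derivative
        (V t * (2 * deriv V t * deriv (deriv V) t) + deriv V t * (deriv V t)\<^sup>2) / 2
          + deriv F (V t) * deriv V t) (at t)"
    proof (rule DERIV_add)
      show "((\<lambda>t. F (V t)) has_real_derivative deriv F (V t) * deriv V t) (at t)"
        by (rule DERIV_chain2[OF real_analytic_at_has_derivative[OF F] real_analytic_at_has_derivative[OF Van]])
      have "((\<lambda>t. (deriv V t)\<^sup>2) has_real_derivative 2 * deriv V t * deriv (deriv V) t) (at t)"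
        using DERIV_power[OF real_analytic_at_has_derivative[OF dVan[of t]], of 2] by (simp add: mult_ac)
      from DERIV_cdivide[OF DERIV_mult'[OF real_analytic_at_has_derivative[OF Van[of t]] this], of 2]
      show "((\<lambda>t. V t * (deriv V t)\<^sup>2 / 2) has_real_derivative
        (V t * (2 * deriv V t * deriv (deriv V) t) + deriv V t * (deriv V t)\<^sup>2) / 2) (at t)" .
    qed
    then have "(V t * (2 * deriv V t * deriv (deriv V) t) + deriv V t * (deriv V t)\<^sup>2) / 2
          + deriv F (V t) * deriv V t = 0"
      unfolding energy using DERIV_unique DERIV_const by blast
    then have "deriv V t * (deriv (deriv V) t * V t + (deriv V t)\<^sup>2 / 2 + deriv F (V t)) = 0"
      by (simp add: field_simps)
    moreover have "deriv V t \<noteq> 0" using Ysgn[OF False] \<sigma>pos[OF Y(2)[of t]] by (simp add: dV)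
    ultimately show ?thesis by simp
  qed (use V0 F0 in simp)
  have second0: "deriv (deriv V) 0 > 0"
  proof -
    have "((\<lambda>t. \<sigma> (Y t)) has_real_derivative deriv \<sigma> 0 * \<sigma> 0) (at 0)"
      using DERIV_chain2[OF real_analytic_at_has_derivative[OF \<sigma>an] Y(3), of 0] Y(1) r by simp
    then have "((\<lambda>t. (2 * Y t) * \<sigma> (Y t)) has_real_derivative
        (2 * \<sigma> (Y 0)) * \<sigma> (Y 0) + (deriv \<sigma> 0 * \<sigma> 0) * (2 * Y 0)) (at 0)"
      by (intro DERIV_mult DERIV_cmult Y)
    then have "deriv (deriv V) 0 = 2 * \<sigma> 0 * \<sigma> 0" unfolding dV using Y(1) by (simp add: DERIV_imp_deriv)
    then show ?thesis using \<sigma>pos[of 0] r by simp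
  qed
  have Vlim: "(V \<longlongrightarrow> m) at_top"
    using tendsto_mult[OF Y(5) Y(5)] r by (simp add: V_def[abs_def] power2_eq_square)
  have uniq: "u t = V (t - a)"
    if at: "a \<le> t" and cu: "continuous_on {a..t} u" and ua: "u a = 0"
      and u: "\<forall>s\<in>{a<..t}. 0 < u s \<and> u s < m \<and> 0 < u' s \<and> (u has_real_derivative u' s) (at s) \<and>
            u s * (u' s)\<^sup>2 / 2 + F (u s) = F 0"
    for u u' a t
  proof -
    have upos: "0 \<le> u t" using u[rule_format, of t] ua at by (cases "a = t") (auto intro: less_imp_le)
    have "sqrt (u t) = Y (t - a)"
    proof (rule Yuniq[OF at])
      show "continuous_on {a..t} (\<lambda>t. sqrt (u t))" by (intro continuous_intros cu)
      show "sqrt (u a) = 0" by (simp add: ua)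
      show "\<forall>x\<in>{a<..t}. \<bar>sqrt (u x)\<bar> < r \<and> ((\<lambda>t. sqrt (u t)) has_real_derivative \<sigma> (sqrt (u x))) (at x)"
      proof
        fix x assume "x \<in> {a<..t}"
        note ux = u[rule_format, OF this]
        have "sqrt (u x) * sqrt (u x) = u x" using ux by simp
        then have "\<sigma> (sqrt (u x)) = sqrt (Q (u x) / 2)" by (simp add: \<sigma>_def s_def)
        also have "Q (u x) / 2 = (u' x / (2 * sqrt (u x)))\<^sup>2"
          using ux fQ[of "u x"] by (auto simp add: f_def power_divide power_mult_distrib field_simps power2_eq_square)
        also have "sqrt \<dots> = u' x / (2 * sqrt (u x))" using ux by simp
        finally have \<sigma>: "\<sigma> (sqrt (u x)) = u' x / (2 * sqrt (u x))" .
        have "((\<lambda>t. sqrt (u t)) has_real_derivative inverse (sqrt (u x)) / 2 * u' x) (at x)"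
          using ux by (intro DERIV_chain2[OF DERIV_real_sqrt]) auto
        then show "\<bar>sqrt (u x)\<bar> < r \<and> ((\<lambda>t. sqrt (u t)) has_real_derivative \<sigma> (sqrt (u x))) (at x)"
          using ux by (simp add: \<sigma> r_def field_simps)
      qed
    qed
    then show ?thesis using upos by (simp add: V_def flip: \<open>sqrt (u t) = _\<close>)
  qed
  show thesis
  proof (rule that[of V])
    show "V (- t) = V t" "V t < m" for t using Y(4) sq[OF Y(2)] by (simp_all add: V_def)
    show "0 < V t" if "t \<noteq> 0" for t using Ysgn[OF that] by (auto simp: V_def zero_less_mult_iff linorder_neq_iff)
  qed (fact Van V0 Vlim second0 energy second uniq)+
qed

section \<open>Smooth test functions\<close>

text \<open>
  The recursion on the derivative lets the product rule be iterated by induction on the order.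
\<close>

primrec differentiable_upto :: "nat \<Rightarrow> (real \<Rightarrow> real) \<Rightarrow> bool" where
  "differentiable_upto 0 f \<longleftrightarrow> (\<forall>t. f differentiable (at t))"
| "differentiable_upto (Suc n) f \<longleftrightarrow> (\<forall>t. f differentiable (at t)) \<and> differentiable_upto n (deriv f)"

definition smooth :: "(real \<Rightarrow> real) \<Rightarrow> bool" where
  "smooth f \<longleftrightarrow> (\<forall>n t. (deriv ^^ n) f differentiable (at t))"

lemma smooth_iff_differentiable_upto: "smooth f \<longleftrightarrow> (\<forall>n. differentiable_upto n f)"
proof -
  have *: "differentiable_upto n f \<longleftrightarrow> (\<forall>k\<le>n. \<forall>t. (deriv ^^ k) f differentiable (at t))" for n f
  proof (induction n arbitrary: f)
    case (Suc n)
    show ?case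
    proof
      assume L: "differentiable_upto (Suc n) f"
      show "\<forall>k\<le>Suc n. \<forall>t. (deriv ^^ k) f differentiable (at t)"
      proof (intro allI impI)
        fix k t assume "k \<le> Suc n"
        then show "(deriv ^^ k) f differentiable (at t)"
          using L Suc.IH[of "deriv f"] by (cases k) (auto simp: funpow_swap1)
      qed
    next
      assume R: "\<forall>k\<le>Suc n. \<forall>t. (deriv ^^ k) f differentiable (at t)"
      have "\<forall>k\<le>n. \<forall>t. (deriv ^^ k) (deriv f) differentiable (at t)"
      proof (intro allI impI)
        fix k t assume "k \<le> n"
        then show "(deriv ^^ k) (deriv f) differentiable (at t)"
          using R[rule_format, of "Suc k" t] by (simp add: funpow_swap1)
      qed
      then show "differentiable_upto (Suc n) f"
        using R[rule_format, of 0] Suc.IH by simp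
    qed
  qed auto
  show ?thesis unfolding smooth_def * by blast
qed

lemma smooth_unfold: "smooth f \<longleftrightarrow> (\<forall>t. f differentiable (at t)) \<and> smooth (deriv f)"
proof -
  have "(\<forall>n. differentiable_upto n f) \<longleftrightarrow>
      (\<forall>t. f differentiable (at t)) \<and> (\<forall>n. differentiable_upto n (deriv f))"
    by (metis differentiable_upto.simps not0_implies_Suc)
  then show ?thesis unfolding smooth_iff_differentiable_upto .
qed

lemma smooth_DERIV: "smooth f \<Longrightarrow> (f has_real_derivative deriv f t) (at t)"
  using smooth_unfold[of f] by (simp add: DERIV_deriv_iff_real_differentiable)

lemma smooth_deriv: "smooth f \<Longrightarrow> smooth (deriv f)"
  using smooth_unfold by blast

lemma smooth_isCont: "smooth f \<Longrightarrow> isCont f t"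
  using smooth_DERIV DERIV_isCont by blast

lemma smooth_continuous_on: "smooth f \<Longrightarrow> continuous_on A f"
  by (simp add: continuous_at_imp_continuous_on smooth_isCont)

lemma smoothI_DERIV:
  assumes "\<And>t. (f has_real_derivative g t) (at t)" "smooth g"
  shows "smooth f"
proof -
  have "deriv f = g" using assms(1) by (auto intro: DERIV_imp_deriv)
  then show ?thesis using assms smooth_unfold[of f] by (auto simp: real_differentiable_def)
qed

text \<open>
  A family of functions closed under differentiation consists of smooth functions.
\<close>

lemma smooth_coinduct:
  assumes "f \<in> X" "\<And>f. f \<in> X \<Longrightarrow> \<exists>g\<in>X. \<forall>t. (f has_real_derivative g t) (at t)"
  shows "smooth f"
  unfolding smooth_iff_differentiable_upto
proof
  have step: "(\<forall>t. f differentiable (at t)) \<and> deriv f \<in> X" if fX: "f \<in> X" for f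
  proof -
    obtain g where g: "g \<in> X" "\<And>t. (f has_real_derivative g t) (at t)"
      using assms(2)[OF fX] by blast
    moreover have "deriv f = g" using g(2) by (auto intro: DERIV_imp_deriv)
    ultimately show ?thesis by (auto simp: real_differentiable_def)
  qed
  show "differentiable_upto n f" for n
    using assms(1) by (induction n arbitrary: f) (use step in auto)
qed

lemma differentiable_upto_add:
  "differentiable_upto n f \<Longrightarrow> differentiable_upto n g \<Longrightarrow> differentiable_upto n (\<lambda>t. f t + g t)"
proof (induction n arbitrary: f g)
  case (Suc n)
  have D: "((\<lambda>t. f t + g t) has_real_derivative deriv f t + deriv g t) (at t)" for t
    using Suc.prems by (intro DERIV_add) (auto simp: DERIV_deriv_iff_real_differentiable)
  have eq: "deriv (\<lambda>t. f t + g t) = (\<lambda>t. deriv f t + deriv g t)"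
    using D by (auto intro: DERIV_imp_deriv)
  have "differentiable_upto n (\<lambda>t. deriv f t + deriv g t)"
    using Suc.prems by (intro Suc.IH) auto
  with D eq show ?case by (auto simp: real_differentiable_def)
qed auto

lemma differentiable_upto_pred: "differentiable_upto (Suc n) f \<Longrightarrow> differentiable_upto n f"
  by (induction n arbitrary: f) auto

lemma differentiable_upto_mult:
  "differentiable_upto n f \<Longrightarrow> differentiable_upto n g \<Longrightarrow> differentiable_upto n (\<lambda>t. f t * g t)"
proof (induction n arbitrary: f g)
  case (Suc n)
  have D: "((\<lambda>t. f t * g t) has_real_derivative f t * deriv g t + deriv f t * g t) (at t)" for t
    using Suc.prems by (intro DERIV_mult') (auto simp: DERIV_deriv_iff_real_differentiable)
  have eq: "deriv (\<lambda>t. f t * g t) = (\<lambda>t. f t * deriv g t + deriv f t * g t)"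
    using D by (auto intro: DERIV_imp_deriv)
  have "differentiable_upto n (\<lambda>t. f t * deriv g t + deriv f t * g t)"
    using Suc.prems differentiable_upto_pred[OF Suc.prems(1)] differentiable_upto_pred[OF Suc.prems(2)]
    by (intro differentiable_upto_add Suc.IH) auto
  with D eq show ?case by (auto simp: real_differentiable_def)
qed auto

lemma smooth_add: "smooth f \<Longrightarrow> smooth g \<Longrightarrow> smooth (\<lambda>t. f t + g t)"
  unfolding smooth_iff_differentiable_upto by (simp add: differentiable_upto_add)

lemma smooth_mult: "smooth f \<Longrightarrow> smooth g \<Longrightarrow> smooth (\<lambda>t. f t * g t)"
  unfolding smooth_iff_differentiable_upto by (simp add: differentiable_upto_mult)

lemma smooth_const: "smooth (\<lambda>t. c)"
  by (rule smooth_coinduct[of _ "range (\<lambda>c t. c)"]) (auto intro!: exI[of _ 0] derivative_eq_intros)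

lemma smooth_diff: "smooth f \<Longrightarrow> smooth g \<Longrightarrow> smooth (\<lambda>t. f t - g t)"
  using smooth_add[of f "\<lambda>t. (- 1) * g t"] smooth_mult[OF smooth_const, of g "- 1"] by simp

lemma smooth_affine:
  assumes "smooth f"
  shows "smooth (\<lambda>t. f (a * (t - b)))"
proof (rule smooth_coinduct[of _ "{\<lambda>t. c * g (a * (t - b)) | c g. smooth g}"], goal_cases)
  case 1
  show ?case using assms by (auto intro!: exI[of _ 1])
next
  case (2 f)
  then obtain c g where g: "f = (\<lambda>t. c * g (a * (t - b)))" "smooth g" by auto
  have inner: "((\<lambda>t. a * (t - b)) has_real_derivative a) (at t)" for t
    by (auto intro!: derivative_eq_intros)
  have "(f has_real_derivative (c * a) * deriv g (a * (t - b))) (at t)" for t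
    unfolding g(1) using DERIV_cmult[OF DERIV_chain2[OF smooth_DERIV[OF g(2)] inner], of c t]
    by (simp add: mult_ac)
  then show ?case using smooth_deriv[OF g(2)]
    by (intro bexI[of _ "\<lambda>t. (c * a) * deriv g (a * (t - b))"]) auto
qed

text \<open>
  The functions \<open>p (1 / x) * exp (- 1 / x)\<close>, continued by \<open>0\<close>, are closed under differentiation and contain
  the standard smooth function that is flat at the origin.
\<close>

definition flat_exp :: "real poly \<Rightarrow> real \<Rightarrow> real" where
  "flat_exp p x = (if x > 0 then poly p (1 / x) * exp (- (1 / x)) else 0)"

lemma poly_mult_exp_tendsto_0: "((\<lambda>y. poly p y * exp (- y)) \<longlongrightarrow> (0::real)) at_top"
proof -
  have "((\<lambda>y. \<Sum>i\<le>degree p. coeff p i * (y ^ i / exp y)) \<longlongrightarrow> (\<Sum>i\<le>degree p. coeff p i * 0)) at_top"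
    by (intro tendsto_intros tendsto_power_div_exp_0)
  then show ?thesis
    by (simp add: poly_altdef sum_distrib_right exp_minus divide_inverse mult.assoc)
qed

lemma flat_exp_DERIV:
  "(flat_exp p has_real_derivative flat_exp ([:0, 0, 1:] * (p - pderiv p)) x) (at x)"
proof (cases x "0::real" rule: linorder_cases)
  case greater
  have inv: "((\<lambda>x. 1 / x) has_real_derivative - (1 / x ^ 2)) (at x)"
    using greater by (auto intro!: derivative_eq_intros simp: power2_eq_square)
  have "((\<lambda>x. exp (- (1 / x))) has_real_derivative exp (- (1 / x)) * - (- (1 / x ^ 2))) (at x)"
    by (rule DERIV_chain2[OF DERIV_exp DERIV_minus[OF inv]])
  from DERIV_mult'[OF DERIV_chain2[OF poly_DERIV inv] this, of p]
  have "((\<lambda>x. poly p (1 / x) * exp (- (1 / x))) has_real_derivative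
      flat_exp ([:0, 0, 1:] * (p - pderiv p)) x) (at x)"
    using greater by (simp add: flat_exp_def field_simps power2_eq_square)
  then show ?thesis
    by (rule has_field_derivative_transform_within_open[of _ _ _ "{0<..}"])
      (use greater in \<open>auto simp: flat_exp_def\<close>)
next
  case less
  have "((\<lambda>x. 0) has_real_derivative flat_exp ([:0, 0, 1:] * (p - pderiv p)) x) (at x)"
    using less by (simp add: flat_exp_def)
  then show ?thesis
    by (rule has_field_derivative_transform_within_open[of _ _ _ "{..<0}"])
      (use less in \<open>auto simp: flat_exp_def\<close>)
next
  case equal
  have "((\<lambda>h. flat_exp p h / h) \<longlongrightarrow> 0) (at_right 0)"
  proof -
    have "((\<lambda>h. poly ([:0, 1:] * p) (inverse h) * exp (- inverse h)) \<longlongrightarrow> 0) (at_right (0::real))"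
      by (rule filterlim_compose[OF poly_mult_exp_tendsto_0 filterlim_inverse_at_top_right])
    moreover have "\<forall>\<^sub>F h in at_right 0. poly ([:0, 1:] * p) (inverse h) * exp (- inverse h) = flat_exp p h / h"
      using eventually_at_right_less[of 0]
      by eventually_elim (simp add: flat_exp_def field_simps)
    ultimately show ?thesis by (rule Lim_transform_eventually)
  qed
  moreover have "((\<lambda>h. flat_exp p h / h) \<longlongrightarrow> 0) (at_left 0)"
    by (rule tendsto_eventually)
      (auto simp: flat_exp_def eventually_at_filter)
  ultimately have "((\<lambda>h. flat_exp p h / h) \<longlongrightarrow> 0) (at 0)"
    by (simp add: filterlim_split_at)
  then show ?thesis by (simp add: equal DERIV_def flat_exp_def)
qed

lemma smooth_flat_exp: "smooth (flat_exp p)"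
  by (rule smooth_coinduct[of _ "range flat_exp"]) (use flat_exp_DERIV in blast)+

lemma antiderivative_exists:
  assumes "continuous_on UNIV f"
  obtains G where "\<And>t. (G has_real_derivative f t) (at t)"
  using einterval_antiderivative[of "-\<infinity>" "\<infinity>" f] assms
  by (auto simp: continuous_on_eq_continuous_at has_real_derivative_iff_has_vector_derivative)

text \<open>
  A normalized primitive of the bump \<open>exp (- 1 / t) * exp (- 1 / (1 - t))\<close> on \<open>(0, 1)\<close>.
\<close>

lemma smooth_step:
  obtains \<eta> where "smooth \<eta>" "\<And>t. t \<le> 0 \<Longrightarrow> \<eta> t = 0" "\<And>t. t \<ge> 1 \<Longrightarrow> \<eta> t = 1"
    "\<And>t. 0 \<le> deriv \<eta> t" "\<And>t. t \<notin> {0..1} \<Longrightarrow> deriv \<eta> t = 0" "\<And>t. 0 \<le> \<eta> t \<and> \<eta> t \<le> 1"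
proof -
  define \<beta> where "\<beta> t = flat_exp 1 t * flat_exp 1 (- 1 * (t - 1))" for t
  have s\<beta>: "smooth \<beta>" unfolding \<beta>_def by (intro smooth_mult smooth_flat_exp smooth_affine)
  have \<beta>0: "\<beta> t \<ge> 0" for t by (simp add: \<beta>_def flat_exp_def)
  have \<beta>out: "\<beta> t = 0" if "t \<le> 0 \<or> t \<ge> 1" for t using that by (auto simp: \<beta>_def flat_exp_def)
  have \<beta>pos: "\<beta> t > 0" if "0 < t" "t < 1" for t using that by (simp add: \<beta>_def flat_exp_def)
  obtain G where G: "\<And>t. (G has_real_derivative \<beta> t) (at t)"
    using antiderivative_exists[OF smooth_continuous_on[OF s\<beta>]] by blast
  have Gmono: "G x \<le> G y" if "x \<le> y" for x y
    by (rule DERIV_nonneg_imp_nondecreasing[OF that]) (use G \<beta>0 in blast)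
  have "G 0 < G 1"
    by (rule DERIV_pos_imp_increasing_open[of 0 1 G])
      (use G \<beta>pos in \<open>auto intro!: continuous_at_imp_continuous_on DERIV_isCont\<close>)
  have G0: "G t = G 0" if "t \<le> 0" for t
  proof (cases "t = 0")
    case False
    show ?thesis using DERIV_isconst2[of t 0 G t] that False
      by (metis DERIV_isconst_end G \<beta>out continuous_at_imp_continuous_on DERIV_isCont order_le_less less_le_not_le)
  qed simp
  have G1: "G t = G 1" if "t \<ge> 1" for t
  proof (cases "t = 1")
    case False
    show ?thesis using that False
      by (metis DERIV_isconst_end G \<beta>out continuous_at_imp_continuous_on DERIV_isCont order_le_less less_le_not_le)
  qed simp
  define \<eta> where "\<eta> t = (G t - G 0) * (1 / (G 1 - G 0))" for t
  have D: "(\<eta> has_real_derivative \<beta> t * (1 / (G 1 - G 0))) (at t)" for t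
    unfolding \<eta>_def
    using DERIV_cmult_right[OF DERIV_diff[OF G[of t] DERIV_const[of "G 0"]], of "1 / (G 1 - G 0)"] by simp
  then have d: "deriv \<eta> t = \<beta> t * (1 / (G 1 - G 0))" for t by (rule DERIV_imp_deriv)
  show thesis
  proof
    show "smooth \<eta>" by (rule smoothI_DERIV[OF D]) (intro smooth_mult s\<beta> smooth_const)
    show "\<eta> t = 0" if "t \<le> 0" for t using G0[OF that] by (simp add: \<eta>_def)
    show "\<eta> t = 1" if "t \<ge> 1" for t using G1[OF that] \<open>G 0 < G 1\<close> by (simp add: \<eta>_def)
    show "0 \<le> deriv \<eta> t" for t using \<beta>0[of t] \<open>G 0 < G 1\<close> by (simp add: d)
    show "deriv \<eta> t = 0" if "t \<notin> {0..1}" for t using \<beta>out[of t] that by (auto simp: d)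
    show "0 \<le> \<eta> t \<and> \<eta> t \<le> 1" for t
    proof -
      have "G 0 \<le> G t" using Gmono[of 0 t] G0[of t] by (cases "t \<le> 0") auto
      moreover have "G t \<le> G 1" using Gmono[of t 1] G1[of t] by (cases "t \<le> 1") auto
      ultimately show ?thesis using \<open>G 0 < G 1\<close> by (simp add: \<eta>_def divide_simps)
    qed
  qed
qed

section \<open>Weak derivatives of continuous functions\<close>

lemma test_functionI:
  assumes "smooth \<phi>" "\<And>t. t \<notin> {a..b} \<Longrightarrow> \<phi> t = 0"
  shows "test_function \<phi>"
proof -
  have "{t. \<phi> t \<noteq> 0} \<subseteq> {a..b}" using assms(2) by blast
  then have "bounded {t. \<phi> t \<noteq> 0}" by (rule bounded_subset[rotated]) simp
  then show ?thesis using assms(1) by (simp add: test_function_def smooth_def)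
qed

lemma test_functionD:
  assumes "test_function \<phi>"
  shows "smooth \<phi>" "\<exists>a b. \<forall>t. t \<notin> {a..b} \<longrightarrow> \<phi> t = 0"
proof -
  show "smooth \<phi>" using assms by (simp add: test_function_def smooth_def)
  have "bounded {t. \<phi> t \<noteq> 0}"
    using assms compact_imp_bounded bounded_subset closure_subset unfolding test_function_def by blast
  then obtain B where "\<And>t. \<phi> t \<noteq> 0 \<Longrightarrow> \<bar>t\<bar> \<le> B" by (auto simp: bounded_iff)
  then show "\<exists>a b. \<forall>t. t \<notin> {a..b} \<longrightarrow> \<phi> t = 0"
    by (intro exI[of _ "- B"] exI[of _ B]) (force simp: abs_le_iff)
qed

lemma deriv_eq_0_outside:
  assumes "\<And>t. t \<notin> {a..b} \<Longrightarrow> \<phi> t = 0" "t \<notin> {a..b::real}"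
  shows "deriv \<phi> t = (0::real)"
proof -
  have "((\<lambda>t. 0) has_real_derivative 0) (at t)" by simp
  then have "(\<phi> has_real_derivative 0) (at t)"
    by (rule has_field_derivative_transform_within_open[of _ _ _ "- {a..b}"])
      (use assms in \<open>auto simp: open_Compl\<close>)
  then show ?thesis by (rule DERIV_imp_deriv)
qed

lemma integrable_continuous_vanishing:
  fixes g :: "real \<Rightarrow> real"
  assumes "continuous_on {a..b} g" "\<And>t. t \<notin> {a..b} \<Longrightarrow> g t = 0"
  shows "integrable lebesgue g" "(LINT t|lebesgue. g t) = integral {a..b} g"
proof -
  have eq: "(\<lambda>t. indicat_real {a..b} t *\<^sub>R g t) = g"
    using assms(2) by (auto simp: indicator_def fun_eq_iff)
  have s: "set_integrable lebesgue {a..b} g" using assms(1) by (rule absolutely_integrable_continuous_real)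
  then show "integrable lebesgue g" unfolding set_integrable_def eq .
  show "(LINT t|lebesgue. g t) = integral {a..b} g"
    using set_lebesgue_integral_eq_integral(2)[OF s] unfolding set_lebesgue_integral_def eq .
qed

lemma integral_derivative_vanishing:
  fixes \<Phi> :: "real \<Rightarrow> real"
  assumes "\<And>t. (\<Phi> has_real_derivative \<phi> t) (at t)" "continuous_on UNIV \<phi>" "\<And>t. t \<notin> {a..b} \<Longrightarrow> \<Phi> t = 0"
  shows "integrable lebesgue \<phi>" "(LINT t|lebesgue. \<phi> t) = 0"
proof -
  have \<phi>0: "\<phi> t = 0" if "t \<notin> {min a b - 1..b + 1}" for t
    using deriv_eq_0_outside[of a b \<Phi> t] DERIV_imp_deriv[OF assms(1), of t] assms(3) that by force
  have c: "continuous_on {min a b - 1..b + 1} \<phi>" using assms(2) by (rule continuous_on_subset) simp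
  show "integrable lebesgue \<phi>" by (rule integrable_continuous_vanishing[OF c \<phi>0])
  have "(\<phi> has_integral \<Phi> (b + 1) - \<Phi> (min a b - 1)) {min a b - 1..b + 1}"
    by (rule fundamental_theorem_of_calculus)
      (auto simp flip: has_real_derivative_iff_has_vector_derivative intro: has_field_derivative_at_within assms(1))
  moreover have "b + 1 \<notin> {a..b}" "min a b - 1 \<notin> {a..b}" using min.cobounded1[of a b] by auto
  then have "\<Phi> (b + 1) = 0" "\<Phi> (min a b - 1) = 0" by (blast intro: assms(3))+
  ultimately have "integral {min a b - 1..b + 1} \<phi> = 0" by (simp add: integral_unique)
  then show "(LINT t|lebesgue. \<phi> t) = 0" using integrable_continuous_vanishing(2)[OF c \<phi>0] by simp
qed

lemma integrable_L1_loc_mult: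
  fixes g \<phi> :: "real \<Rightarrow> real"
  assumes g: "set_integrable lebesgue {a..b} g" and \<phi>: "continuous_on UNIV \<phi>"
    and 0: "\<And>t. t \<notin> {a..b} \<Longrightarrow> \<phi> t = (0::real)"
  shows "integrable lebesgue (\<lambda>t. g t * \<phi> t)"
proof -
  have "compact (\<phi> ` {a..b})" using \<phi> 
    by (intro compact_continuous_image compact_Icc) (auto intro: continuous_on_subset)
  then obtain C where "C > 0" "\<forall>x\<in>\<phi> ` {a..b}. norm x \<le> C"
    using compact_imp_bounded[of "\<phi> ` {a..b}"] unfolding bounded_pos by blast
  then have C: "\<And>t. t \<in> {a..b} \<Longrightarrow> \<bar>\<phi> t\<bar> \<le> C" "C > 0" by auto
  define h where "h t = indicat_real {a..b} t * g t" for t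
  have h: "integrable lebesgue h" using g by (simp add: set_integrable_def h_def[abs_def])
  have [measurable]: "\<phi> \<in> borel_measurable lebesgue" using \<phi>
    by (intro measurable_completion) (simp add: borel_measurable_continuous_onI)
  have [measurable]: "h \<in> borel_measurable lebesgue" using h by simp
  have "integrable lebesgue (\<lambda>t. h t * \<phi> t)"
  proof (rule Bochner_Integration.integrable_bound)
    show "integrable lebesgue (\<lambda>t. C * norm (h t))" using h by simp
    show "AE t in lebesgue. norm (h t * \<phi> t) \<le> norm (C * norm (h t))"
      using C 0 by (intro AE_I2) (auto simp: abs_mult h_def indicator_def mult.commute intro: mult_right_mono)
  qed measurable
  moreover have "h t * \<phi> t = g t * \<phi> t" for t using 0[of t] by (auto simp: h_def indicator_def)
  ultimately show ?thesis by simp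
qed

text \<open>
  The difference of two steep smooth steps, at \<open>a\<close> and at \<open>b\<close>. Its derivative tends to a unit mass at \<open>a\<close>
  minus a unit mass at \<open>b\<close>, so that testing with it evaluates continuous functions at the endpoints.
\<close>

lemma indicator_approximation:
  fixes a b :: real
  assumes "a < b"
  obtains \<phi> :: "nat \<Rightarrow> real \<Rightarrow> real"
  where "\<And>n. smooth (\<phi> n)" "\<And>n t. t \<notin> {a..b + 1 / Suc n} \<Longrightarrow> \<phi> n t = 0" "\<And>n t. \<bar>\<phi> n t\<bar> \<le> 1"
    "\<And>t. (\<lambda>n. \<phi> n t) \<longlonglongrightarrow> indicator {a<..b} t"
    "\<And>f. continuous_on UNIV f \<Longrightarrow> (\<lambda>n. LINT t|lebesgue. f t * deriv (\<phi> n) t) \<longlonglongrightarrow> f a - f b"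
proof -
  obtain \<eta> where \<eta>: "smooth \<eta>" "\<And>t. t \<le> 0 \<Longrightarrow> \<eta> t = 0" "\<And>t. t \<ge> 1 \<Longrightarrow> \<eta> t = 1"
    "\<And>t. 0 \<le> deriv \<eta> t" "\<And>t. t \<notin> {0..1} \<Longrightarrow> deriv \<eta> t = 0" "\<And>t. 0 \<le> \<eta> t \<and> \<eta> t \<le> 1"
    using smooth_step by blast
  define s where "s c n t = \<eta> (real (Suc n) * (t - c))" for c n t
  define s' where "s' c n t = real (Suc n) * deriv \<eta> (real (Suc n) * (t - c))" for c n t
  have ss: "smooth (s c n)" for c n unfolding s_def by (rule smooth_affine[OF \<eta>(1)])
  have Ds: "(s c n has_real_derivative s' c n t) (at t)" for c n t
  proof -
    have "((\<lambda>t. real (Suc n) * (t - c)) has_real_derivative real (Suc n)) (at t)"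
      by (auto intro!: derivative_eq_intros)
    from DERIV_chain2[OF smooth_DERIV[OF \<eta>(1)] this] show ?thesis
      unfolding s_def s'_def by (simp add: mult.commute)
  qed
  have s's: "deriv (s c n) = s' c n" for c n by (rule ext, rule DERIV_imp_deriv, rule Ds)
  have cs': "continuous_on A (s' c n)" for c n A
    using smooth_continuous_on[OF smooth_deriv[OF ss]] by (simp add: s's)
  have s'0: "s' c n t = 0" if "t \<notin> {c..c + 1 / Suc n}" for c n t
  proof -
    have "real (Suc n) * (t - c) \<notin> {0..1}"
    proof
      assume "real (Suc n) * (t - c) \<in> {0..1}"
      then have "0 \<le> t - c" "(t - c) * Suc n \<le> 1"
        by (auto simp: zero_le_mult_iff mult.commute)
      then have "t - c \<le> 1 / Suc n" by (simp add: pos_le_divide_eq)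
      with \<open>0 \<le> t - c\<close> that show False by simp
    qed
    then show ?thesis by (simp add: s'_def \<eta>(5))
  qed
  have s'nonneg: "s' c n t \<ge> 0" for c n t by (simp add: s'_def \<eta>(4))
  have s'int: "integrable lebesgue (\<lambda>t. f t * s' c n t)"
    if "continuous_on UNIV f" for f c n
    by (rule integrable_continuous_vanishing(1)[of c "c + 1 / Suc n"])
      (use that cs' s'0 in \<open>auto intro!: continuous_intros intro: continuous_on_subset\<close>)
  have s'1: "(LINT t|lebesgue. s' c n t) = 1" for c n
  proof -
    have "(s' c n has_integral s c n (c + 1 / Suc n) - s c n c) {c..c + 1 / Suc n}"
      by (rule fundamental_theorem_of_calculus)
        (auto simp flip: has_real_derivative_iff_has_vector_derivative intro: has_field_derivative_at_within Ds)
    moreover have "s c n (c + 1 / Suc n) = 1" "s c n c = 0"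
      using \<eta>(2)[of 0] \<eta>(3)[of 1] by (simp_all add: s_def)
    ultimately show ?thesis
      using integrable_continuous_vanishing(2)[of c "c + 1 / Suc n" "s' c n"] cs' s'0
      by (simp add: integral_unique)
  qed
  have avg: "(\<lambda>n. LINT t|lebesgue. f t * s' c n t) \<longlonglongrightarrow> f c" if f: "continuous_on UNIV f" for f c
  proof (rule LIMSEQ_I)
    fix e :: real assume "e > 0"
    obtain d where d: "d > 0" "\<And>t. \<bar>t - c\<bar> < d \<Longrightarrow> \<bar>f t - f c\<bar> < e / 2"
    proof -
      have "isCont f c" using f by (simp add: continuous_on_eq_continuous_at)
      then have "\<exists>d>0. \<forall>t. dist t c < d \<longrightarrow> dist (f t) (f c) < e / 2"
        using \<open>e > 0\<close> unfolding continuous_at_eps_delta by (meson half_gt_zero)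
      then show ?thesis using that by (auto simp: dist_real_def)
    qed
    obtain N where N: "1 / real (Suc N) < d" using nat_approx_posE[OF d(1)] by (metis inverse_eq_divide)
    show "\<exists>N. \<forall>n\<ge>N. norm ((LINT t|lebesgue. f t * s' c n t) - f c) < e"
    proof (intro exI[of _ N] allI impI)
      fix n assume "n \<ge> N"
      then have n: "1 / real (Suc n) < d"
        using N by (smt (verit) frac_le of_nat_0_less_iff of_nat_le_iff zero_less_Suc Suc_le_mono)
      have i1: "integrable lebesgue (\<lambda>t. f t * s' c n t)" "integrable lebesgue (\<lambda>t. f c * s' c n t)"
        "integrable lebesgue (\<lambda>t. e / 2 * s' c n t)"
        by (intro s'int f continuous_intros)+
      have "(LINT t|lebesgue. f t * s' c n t) - f c = (LINT t|lebesgue. f t * s' c n t - f c * s' c n t)"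
        using i1 s'1 by (simp add: Bochner_Integration.integral_diff)
      also have "norm \<dots> \<le> (LINT t|lebesgue. norm (f t * s' c n t - f c * s' c n t))"
        by (rule integral_norm_bound)
      also have "\<dots> \<le> (LINT t|lebesgue. e / 2 * s' c n t)"
      proof (rule integral_mono)
        fix t
        show "norm (f t * s' c n t - f c * s' c n t) \<le> e / 2 * s' c n t"
        proof (cases "t \<in> {c..c + 1 / Suc n}")
          case True
          then have "\<bar>f t - f c\<bar> \<le> e / 2" using d(2)[of t] n by auto
          then have "\<bar>f t - f c\<bar> * s' c n t \<le> e / 2 * s' c n t"
            by (rule mult_right_mono) (rule s'nonneg)
          then show ?thesis using s'nonneg[of c n t] by (simp add: abs_mult flip: left_diff_distrib)
        qed (simp add: s'0)
      qed (use i1 in auto)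
      also have "\<dots> = e / 2" using s'1 by simp
      finally show "norm ((LINT t|lebesgue. f t * s' c n t) - f c) < e" using \<open>e > 0\<close> by simp
    qed
  qed
  have slim: "(\<lambda>n. s c n t) \<longlonglongrightarrow> (if c < t then 1 else 0)" for c t
  proof (cases "c < t")
    case True
    obtain N where N: "1 / real (Suc N) < t - c" using nat_approx_posE[of "t - c"] True by auto
    have "s c n t = 1" if "n \<ge> N" for n
    proof -
      have "1 / real (Suc n) < t - c"
        using N that by (smt (verit) frac_le of_nat_0_less_iff of_nat_le_iff zero_less_Suc Suc_le_mono)
      then have "1 \<le> real (Suc n) * (t - c)" by (simp add: divide_less_eq mult.commute)
      then show ?thesis by (simp add: s_def \<eta>(3))
    qed
    then have "\<forall>\<^sub>F n in sequentially. s c n t = 1" unfolding eventually_sequentially by blast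
    then show ?thesis using True by (simp add: tendsto_eventually)
  next
    case False
    then have "s c n t = 0" for n unfolding s_def by (intro \<eta>(2)) (simp add: mult_nonneg_nonpos)
    then show ?thesis using False by simp
  qed
  define \<phi> where "\<phi> n t = s a n t - s b n t" for n t
  show thesis
  proof
    show "smooth (\<phi> n)" for n unfolding \<phi>_def by (intro smooth_diff ss)
    show "\<phi> n t = 0" if "t \<notin> {a..b + 1 / Suc n}" for n t
    proof (cases "t < a")
      case True
      then have "s a n t = 0" "s b n t = 0"
        unfolding s_def using assms by (auto intro!: \<eta>(2) mult_nonneg_nonpos)
      then show ?thesis by (simp add: \<phi>_def)
    next
      case False
      then have *: "1 / Suc n \<le> t - b" using that by auto
      then have "1 / Suc n \<le> t - a" using assms by linarith
      then have "1 \<le> real (Suc n) * (t - a)" "1 \<le> real (Suc n) * (t - b)"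
        using * by (simp_all add: divide_le_eq mult.commute)
      then have "s a n t = 1" "s b n t = 1" by (simp_all add: s_def \<eta>(3))
      then show ?thesis by (simp add: \<phi>_def)
    qed
    show "\<bar>\<phi> n t\<bar> \<le> 1" for n t
      using \<eta>(6)[of "real (Suc n) * (t - a)"] \<eta>(6)[of "real (Suc n) * (t - b)"]
      unfolding \<phi>_def s_def by linarith
    show "(\<lambda>n. \<phi> n t) \<longlonglongrightarrow> indicator {a<..b} t" for t
    proof -
      have "(\<lambda>n. \<phi> n t) \<longlonglongrightarrow> (if a < t then 1 else 0) - (if b < t then 1 else 0)"
        unfolding \<phi>_def by (intro tendsto_diff slim)
      moreover have "(if a < t then 1 else 0) - (if b < t then 1 else 0) = indicat_real {a<..b} t"
        using assms by (auto simp: indicator_def)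
      ultimately show ?thesis by simp
    qed
    show "(\<lambda>n. LINT t|lebesgue. f t * deriv (\<phi> n) t) \<longlonglongrightarrow> f a - f b"
      if f: "continuous_on UNIV f" for f
    proof -
      have "deriv (\<phi> n) t = s' a n t - s' b n t" for n t
        unfolding \<phi>_def by (intro DERIV_imp_deriv DERIV_diff Ds)
      then have "(LINT t|lebesgue. f t * deriv (\<phi> n) t)
          = (LINT t|lebesgue. f t * s' a n t) - (LINT t|lebesgue. f t * s' b n t)" for n
        using s'int[OF f] by (simp add: right_diff_distrib Bochner_Integration.integral_diff)
      then show ?thesis using tendsto_diff[OF avg[OF f] avg[OF f]] by simp
    qed
  qed
qed

text \<open>
  The limit of the weak formulation along \<open>indicator_approximation\<close>, by dominated convergence.
\<close>

lemma weak_derivative_FTC: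
  assumes "weak_derivative u v" "continuous_on UNIV u" "a \<le> b"
  shows "(v has_integral u b - u a) {a..b}"
proof (cases "a = b")
  case False
  then have "a < b" using assms(3) by simp
  obtain \<phi> :: "nat \<Rightarrow> real \<Rightarrow> real"
  where \<phi>: "\<And>n. smooth (\<phi> n)" "\<And>n t. t \<notin> {a..b + 1 / Suc n} \<Longrightarrow> \<phi> n t = 0" "\<And>n t. \<bar>\<phi> n t\<bar> \<le> 1"
    "\<And>t. (\<lambda>n. \<phi> n t) \<longlonglongrightarrow> indicator {a<..b} t"
    "\<And>f. continuous_on UNIV f \<Longrightarrow> (\<lambda>n. LINT t|lebesgue. f t * deriv (\<phi> n) t) \<longlonglongrightarrow> f a - f b"
    using indicator_approximation[OF \<open>a < b\<close>] by blast
  have \<phi>0: "\<phi> n t = 0" if "t \<notin> {a..b + 1}" for n t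
  proof -
    have "1 / real (Suc n) \<le> 1" by simp
    with that have "t \<notin> {a..b + 1 / Suc n}" by (simp only: atLeastAtMost_iff) linarith
    then show ?thesis by (rule \<phi>(2))
  qed
  have v: "set_integrable lebesgue {c..d} v" for c d
    using assms(1) by (simp add: weak_derivative_def L1_loc_def)
  define V where "V t = indicat_real {a..b + 1} t * v t" for t
  have V: "integrable lebesgue V" using v[of a "b + 1"] by (simp add: set_integrable_def V_def[abs_def])
  have eq: "(LINT t|lebesgue. u t * deriv (\<phi> n) t) = - (LINT t|lebesgue. V t * \<phi> n t)" for n
  proof -
    have "V t * \<phi> n t = v t * \<phi> n t" for t using \<phi>0[of t n] by (auto simp: V_def indicator_def)
    then have "(\<lambda>t. V t * \<phi> n t) = (\<lambda>t. v t * \<phi> n t)" by blast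
    moreover have "test_function (\<phi> n)" by (rule test_functionI[OF \<phi>(1,2)])
    ultimately show ?thesis using assms(1) by (simp add: weak_derivative_def)
  qed
  have meas\<phi>: "\<phi> n \<in> borel_measurable lebesgue" for n
    using smooth_continuous_on[OF \<phi>(1), of UNIV]
    by (intro measurable_completion) (simp add: borel_measurable_continuous_onI)
  have measV: "V \<in> borel_measurable lebesgue" using V by simp
  have measI: "indicat_real {a<..b} \<in> borel_measurable lebesgue"
    by (intro borel_measurable_indicator) simp
  have "(\<lambda>n. LINT t|lebesgue. V t * \<phi> n t) \<longlonglongrightarrow> (LINT t|lebesgue. V t * indicator {a<..b} t)"
  proof (rule integral_dominated_convergence)
    show "integrable lebesgue (\<lambda>t. norm (V t))" using V by simp
    show "AE t in lebesgue. (\<lambda>n. V t * \<phi> n t) \<longlonglongrightarrow> V t * indicator {a<..b} t"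
      by (intro AE_I2 tendsto_intros \<phi>)
    show "AE t in lebesgue. norm (V t * \<phi> n t) \<le> norm (V t)" for n
      using \<phi>(3)[of n] by (intro AE_I2) (simp add: abs_mult mult_left_le)
  qed (intro borel_measurable_times measV measI meas\<phi>)+
  then have "(\<lambda>n. - (LINT t|lebesgue. V t * \<phi> n t)) \<longlonglongrightarrow> - (LINT t|lebesgue. V t * indicator {a<..b} t)"
    by (rule tendsto_minus)
  then have "- (LINT t|lebesgue. V t * indicator {a<..b} t) = u a - u b"
    using \<phi>(5)[OF assms(2)] unfolding eq by (rule LIMSEQ_unique)
  moreover have "(LINT t|lebesgue. V t * indicator {a<..b} t) = (LINT t:{a..b}|lebesgue. v t)"
    unfolding set_lebesgue_integral_def
  proof (rule integral_cong_AE)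
    have "{a} \<in> null_sets lebesgue" by (simp add: negligible_iff_null_sets[symmetric])
    then have "AE t in lebesgue. t \<notin> {a}" by (rule AE_not_in)
    then show "AE t in lebesgue. V t * indicator {a<..b} t = indicat_real {a..b} t *\<^sub>R v t"
      by eventually_elim (auto simp: V_def indicator_def)
    show "(\<lambda>t. indicat_real {a..b} t *\<^sub>R v t) \<in> borel_measurable lebesgue"
      using v[of a b] by (simp add: set_integrable_def)
  qed (intro borel_measurable_times measV measI meas\<phi>)+
  ultimately have "integral {a..b} v = u b - u a"
    using set_lebesgue_integral_eq_integral(2)[OF v] by simp
  then show ?thesis
    using set_lebesgue_integral_eq_integral(1)[OF v, of a b] by (metis integrable_integral)
qed (use has_integral_refl(1) in auto)

text \<open>
  If \<open>g b < g a\<close>, some value \<open>c\<close> strictly between them is not taken on the countable set \<open>S\<close>. At the last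
  point where \<open>g\<close> is at least \<open>c\<close> the derivative exists and is positive, so \<open>g\<close> exceeds \<open>c\<close> later on.
\<close>

lemma nondecreasing_countable_exceptions:
  fixes g :: "real \<Rightarrow> real"
  assumes ab: "a \<le> b" and g: "continuous_on {a..b} g" and S: "countable S"
    and D: "\<And>t. t \<in> {a<..<b} - S \<Longrightarrow> \<exists>d>0. (g has_real_derivative d) (at t)"
  shows "g a \<le> g b"
proof (rule ccontr)
  assume "\<not> g a \<le> g b"
  then have less: "g b < g a" by simp
  have "countable (g ` S)" using S by simp
  moreover have "uncountable {g b<..<g a}" using less by (simp add: uncountable_open_interval)
  ultimately obtain c where c: "g b < c" "c < g a" "c \<notin> g ` S"
    by (metis countable_subset greaterThanLessThan_iff subsetI)
  define A where "A = {x \<in> {a..b}. c \<le> g x}"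
  have "closed A"
    unfolding A_def using continuous_closed_preimage[OF g closed_atLeastAtMost closed_atLeast[of c]]
    by (simp add: vimage_def Int_def)
  then have "compact A"
    unfolding compact_eq_bounded_closed by (auto simp: A_def intro: bounded_subset[of "{a..b}"])
  moreover have "a \<in> A" using c ab by (simp add: A_def)
  ultimately obtain t where t: "t \<in> A" "\<And>x. x \<in> A \<Longrightarrow> x \<le> t"
    using compact_attains_sup[of A] by auto
  have tab: "a \<le> t" "t \<le> b" using t by (auto simp: A_def)
  obtain x where x: "t \<le> x" "x \<le> b" "g x = c"
    using IVT2'[of g b c t] t c tab continuous_on_subset[OF g, of "{t..b}"] by (auto simp: A_def)
  then have "x \<in> A" using tab by (simp add: A_def)
  then have gt: "g t = c" using t(2) x by force
  then have "t \<in> {a<..<b} - S" using c tab by (force simp: less_le)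
  then obtain d where "d > 0" "(g has_real_derivative d) (at t)" using D by blast
  then obtain e where e: "e > 0" "\<And>h. 0 < h \<Longrightarrow> h < e \<Longrightarrow> g t < g (t + h)"
    using DERIV_pos_inc_right by blast
  define h where "h = min (e / 2) (b - t)"
  have h: "0 < h" "h < e" "t + h \<le> b"
    using e(1) \<open>t \<in> {a<..<b} - S\<close> by (auto simp: h_def min_def)
  then have "t + h \<in> A" using e(2)[of h] gt tab by (simp add: A_def)
  then show False using t(2)[of "t + h"] h by simp
qed

text \<open>
  The slope \<open>M\<close> is increased by a small amount to make the derivative of \<open>M * t - f t\<close> positive.
\<close>

lemma increment_le_countable_exceptions:
  fixes f :: "real \<Rightarrow> real"
  assumes ab: "a \<le> b" and f: "continuous_on {a..b} f" and S: "countable S"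
    and D: "\<And>t. t \<in> {a<..<b} - S \<Longrightarrow> (f has_real_derivative D t) (at t) \<and> D t \<le> M"
  shows "f b - f a \<le> M * (b - a)"
proof (cases "a = b")
  case False
  show ?thesis
  proof (rule field_le_epsilon)
    fix e :: real assume "e > 0"
    define d where "d = e / (b - a)"
    have d: "d > 0" using \<open>e > 0\<close> False ab by (simp add: d_def)
    have "(M + d) * a - f a \<le> (M + d) * b - f b"
    proof (rule nondecreasing_countable_exceptions[OF ab _ S])
      show "continuous_on {a..b} (\<lambda>t. (M + d) * t - f t)" by (intro continuous_intros f)
      show "\<exists>e>0. ((\<lambda>t. (M + d) * t - f t) has_real_derivative e) (at t)" if "t \<in> {a<..<b} - S" for t
      proof (intro exI conjI)
        show "((\<lambda>t. (M + d) * t - f t) has_real_derivative (M + d) - D t) (at t)"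
          using D[OF that] by (auto intro!: derivative_eq_intros)
        show "(M + d) - D t > 0" using D[OF that] d by simp
      qed
    qed
    then have "f b - f a \<le> M * (b - a) + d * (b - a)" by (simp add: algebra_simps)
    also have "d * (b - a) = e" using False by (simp add: d_def)
    finally show "f b - f a \<le> M * (b - a) + e" .
  qed
qed simp

lemma lipschitz_countable_exceptions:
  fixes f :: "real \<Rightarrow> real"
  assumes ab: "a \<le> b" and f: "continuous_on {a..b} f" and S: "countable S"
    and D: "\<And>t. t \<in> {a<..<b} - S \<Longrightarrow> (f has_real_derivative D t) (at t) \<and> \<bar>D t\<bar> \<le> M"
  shows "\<bar>f b - f a\<bar> \<le> M * (b - a)"
proof -
  have "f b - f a \<le> M * (b - a)"
    by (rule increment_le_countable_exceptions[OF ab f S]) (use D in force)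
  moreover have "- f b - (- f a) \<le> M * (b - a)"
    by (rule increment_le_countable_exceptions[OF ab _ S, of "\<lambda>t. - f t" "\<lambda>t. - D t"])
      (use D in \<open>force intro: continuous_intros f derivative_intros\<close>)+
  ultimately show ?thesis by (simp add: abs_le_iff)
qed

text \<open>
  Difference quotients are bounded because \<open>f\<close> is Lipschitz, and converge to \<open>D\<close> off a null set. Their
  integrals are difference quotients of a primitive of \<open>f\<close> and tend to \<open>f b - f a\<close>; dominated
  convergence does the rest, including the integrability of \<open>D\<close>.
\<close>

lemma FTC_countable_exceptions:
  fixes f :: "real \<Rightarrow> real"
  assumes f: "continuous_on UNIV f" and S: "countable S"
    and D: "\<And>t. t \<in> {c..d} - S \<Longrightarrow> (f has_real_derivative D t) (at t) \<and> \<bar>D t\<bar> \<le> M"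
    and ab: "c \<le> a" "a \<le> b" "b < d"
  shows "(D has_integral f b - f a) {a..b}"
proof -
  \<comment> \<open>steps that keep \<open>t + h k\<close> inside \<open>{c..d}\<close> for all \<open>t\<close> in \<open>{a..b}\<close>\<close>
  define h where "h k = (d - b) / Suc k" for k
  have h: "h k > 0" "h k \<le> d - b" for k using ab by (auto simp: h_def divide_le_eq)
  have hlim: "filterlim h (at 0) sequentially"
  proof -
    have "h \<longlonglongrightarrow> (d - b) * 0"
      unfolding h_def divide_inverse by (intro tendsto_mult tendsto_const LIMSEQ_inverse_real_of_nat)
    moreover have "\<forall>\<^sub>F k in sequentially. h k \<noteq> 0" using h(1) by (simp add: less_imp_neq[symmetric])
    ultimately show ?thesis by (simp add: filterlim_at)
  qed
  obtain G where G: "\<And>t. (G has_real_derivative f t) (at t)" using antiderivative_exists[OF f] by blast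
  define q where "q k t = (f (t + h k) - f t) / h k" for k t
  have quot: "(\<lambda>k. (F (t + h k) - F t) / h k) \<longlonglongrightarrow> F'" if "(F has_real_derivative F') (at t)" for F F' t
    using filterlim_compose[OF _ hlim] that unfolding DERIV_def by blast
  have qint: "(q k has_integral (G (b + h k) - G b) / h k - (G (a + h k) - G a) / h k) {a..b}" for k
  proof -
    have "((\<lambda>t. (G (t + h k) - G t) / h k) has_real_derivative q k t) (at t within {a..b})" for t
    proof -
      have "((\<lambda>t. G (t + h k)) has_real_derivative f (t + h k)) (at t)"
        using G[of "t + h k"] by (simp add: DERIV_shift)
      from DERIV_cdivide[OF DERIV_diff[OF this G]] show ?thesis
        unfolding q_def by (rule has_field_derivative_at_within)
    qed
    from fundamental_theorem_of_calculus[OF ab(2) this[unfolded has_real_derivative_iff_has_vector_derivative]]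
    show ?thesis by (simp add: diff_divide_distrib algebra_simps)
  qed
  have neg: "negligible S" 
    using S by (simp add: negligible_iff_null_sets null_sets_completionI countable_imp_null_set_lborel)
  define r where "r k t = (if t \<in> S then 0 else q k t)" for k t
  define E where "E t = (if t \<in> S then 0 else D t)" for t
  have rint: "(r k has_integral (G (b + h k) - G b) / h k - (G (a + h k) - G a) / h k) {a..b}" for k
    by (rule has_integral_spike[OF neg _ qint]) (simp add: r_def)
  have rinteg: "r k integrable_on {a..b}" for k using rint by blast
  have rM: "norm (r k t) \<le> \<bar>M\<bar>" if "t \<in> {a..b}" for k t
  proof -
    have "\<bar>f (t + h k) - f t\<bar> \<le> M * (t + h k - t)"
    proof (rule lipschitz_countable_exceptions[OF _ _ S])
      show "t \<le> t + h k" using h(1)[of k] by simp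
      show "continuous_on {t..t + h k} f" using f by (rule continuous_on_subset) simp
      show "(f has_real_derivative D x) (at x) \<and> \<bar>D x\<bar> \<le> M" if "x \<in> {t<..<t + h k} - S" for x
        using that \<open>t \<in> {a..b}\<close> ab h(2)[of k] by (intro D) auto
    qed
    then have "\<bar>q k t\<bar> \<le> M" using h(1)[of k] by (simp add: q_def divide_le_eq)
    then show ?thesis by (auto simp: r_def)
  qed
  have rlim: "(\<lambda>k. r k t) \<longlonglongrightarrow> E t" if "t \<in> {a..b}" for t
  proof (cases "t \<in> S")
    case False
    then have "(f has_real_derivative D t) (at t)" using D that ab by auto
    from quot[OF this] show ?thesis using False by (simp add: r_def E_def q_def)
  qed (simp add: r_def E_def)
  have conv: "E integrable_on {a..b}" "(\<lambda>k. integral {a..b} (r k)) \<longlonglongrightarrow> integral {a..b} E"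
    using dominated_convergence[of r "{a..b}" "\<lambda>_. \<bar>M\<bar>" E] rinteg rM rlim
      integrable_const_ivl[of "\<bar>M\<bar>" a b] by blast+
  have "(\<lambda>k. integral {a..b} (r k)) \<longlonglongrightarrow> f b - f a"
    unfolding integral_unique[OF rint] by (intro tendsto_diff quot G)
  then have "integral {a..b} E = f b - f a" using conv(2) LIMSEQ_unique by blast
  then have "(E has_integral f b - f a) {a..b}" using conv(1) by (metis integrable_integral)
  then show ?thesis by (rule has_integral_spike[OF neg, rotated]) (simp add: E_def)
qed

text \<open>
  Henstock's lemma bounds the sum of the deviations of \<open>h x\<close> times the length of a piece from the integral
  over the piece. Here these integrals vanish, so the Riemann sums of \<open>\<bar>h\<bar>\<close> tend to \<open>0\<close>.
\<close>

lemma AE_eq_0_if_integrals_0: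
  fixes h :: "real \<Rightarrow> real"
  assumes h: "\<And>a b. c \<le> a \<Longrightarrow> a \<le> b \<Longrightarrow> b \<le> d \<Longrightarrow> (h has_integral 0) {a..b}"
  shows "AE t in lebesgue. t \<in> {c..d} \<longrightarrow> h t = 0"
proof (cases "c \<le> d")
  case True
  have hint: "h integrable_on cbox c d" using h[of c d] True by auto
  have "((\<lambda>t. \<bar>h t\<bar>) has_integral 0) (cbox c d)"
    unfolding has_integral
  proof (intro allI impI)
    fix e :: real assume "e > 0"
    obtain \<gamma> where \<gamma>: "gauge \<gamma>" "\<And>p. p tagged_partial_division_of cbox c d \<Longrightarrow> \<gamma> fine p \<Longrightarrow>
        (\<Sum>(x, k)\<in>p. norm (measure lborel k *\<^sub>R h x - integral k h)) < e"
      using Henstock_lemma[OF hint \<open>e > 0\<close>] by blast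
    have "norm ((\<Sum>(x, k)\<in>p. measure lborel k *\<^sub>R \<bar>h x\<bar>) - 0) < e"
      if p: "p tagged_division_of cbox c d" "\<gamma> fine p" for p
    proof -
      have "(\<Sum>(x, k)\<in>p. measure lborel k *\<^sub>R \<bar>h x\<bar>) = (\<Sum>(x, k)\<in>p. norm (measure lborel k *\<^sub>R h x - integral k h))"
      proof (rule sum.cong[OF refl], clarify)
        fix x k assume xk: "(x, k) \<in> p"
        obtain a b where k: "k = cbox a b" using tagged_division_ofD(4)[OF p(1) xk] by blast
        have "x \<in> k" "k \<subseteq> cbox c d" using tagged_division_ofD(2,3)[OF p(1) xk] by auto
        then have "c \<le> a" "a \<le> b" "b \<le> d" using k by auto
        then have "integral k h = 0" using h[of a b] k by (simp add: integral_unique)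
        then show "measure lborel k *\<^sub>R \<bar>h x\<bar> = norm (measure lborel k *\<^sub>R h x - integral k h)"
          by (simp add: abs_mult)
      qed
      also have "\<dots> < e" using p by (intro \<gamma>) (auto simp: tagged_division_of_def)
      also have "(\<Sum>(x, k)\<in>p. measure lborel k *\<^sub>R \<bar>h x\<bar>) \<ge> 0" by (intro sum_nonneg) auto
      ultimately show ?thesis by simp
    qed
    then show "\<exists>\<gamma>. gauge \<gamma> \<and> (\<forall>p. p tagged_division_of cbox c d \<and> \<gamma> fine p \<longrightarrow>
        norm ((\<Sum>(x, k)\<in>p. measure lborel k *\<^sub>R \<bar>h x\<bar>) - 0) < e)" using \<gamma>(1) by blast
  qed
  then have "((\<lambda>t. if t \<in> {c..d} then \<bar>h t\<bar> else 0) has_integral 0) UNIV"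
    by (simp only: has_integral_restrict_UNIV cbox_interval)
  then have "(\<lambda>t. if t \<in> {c..d} then \<bar>h t\<bar> else 0) \<in> borel_measurable lebesgue"
    "(\<integral>\<^sup>+t. ennreal (if t \<in> {c..d} then \<bar>h t\<bar> else 0) \<partial>lebesgue) = 0"
    by (subst (asm) has_integral_iff_nn_integral_lebesgue; auto)+
  then have "AE t in lebesgue. ennreal (if t \<in> {c..d} then \<bar>h t\<bar> else 0) = 0"
    by (subst (asm) nn_integral_0_iff_AE) auto
  then show ?thesis by eventually_elim (auto split: if_splits)
qed (auto intro: AE_I2)

text \<open>
  Both sides have the same integral over every interval. The point \<open>e < d\<close> leaves room for the
  forward difference quotients.
\<close>

lemma weak_derivative_AE_eq:
  assumes uv: "weak_derivative u v" "continuous_on UNIV u" and S: "countable S"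
    and D: "\<And>t. t \<in> {c..d} - S \<Longrightarrow> (u has_real_derivative D t) (at t) \<and> \<bar>D t\<bar> \<le> M"
    and e: "e < d"
  shows "AE t in lebesgue. t \<in> {c..e} \<longrightarrow> v t = D t"
proof -
  have "((\<lambda>t. v t - D t) has_integral 0) {a..b}" if "c \<le> a" "a \<le> b" "b \<le> e" for a b
  proof -
    have "(D has_integral u b - u a) {a..b}"
      by (rule FTC_countable_exceptions[OF uv(2) S D]) (use that e in auto)
    from has_integral_diff[OF weak_derivative_FTC[OF uv that(2)] this] show ?thesis by simp
  qed
  then have "AE t in lebesgue. t \<in> {c..e} \<longrightarrow> v t - D t = 0" by (rule AE_eq_0_if_integrals_0)
  then show ?thesis by eventually_elim simp
qed

text \<open>
  Test functions of integral \<open>0\<close> are the derivatives of test functions.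
\<close>

lemma antiderivative_vanishing:
  assumes \<psi>: "smooth \<psi>" "\<And>t. t \<notin> {c..d} \<Longrightarrow> \<psi> t = 0" and I: "(LINT t|lebesgue. \<psi> t) = 0" and cd: "c \<le> d"
  obtains \<Phi> where "smooth \<Phi>" "deriv \<Phi> = \<psi>" "\<And>t. t \<notin> {c..d} \<Longrightarrow> \<Phi> t = 0"
proof -
  obtain G where G: "\<And>t. (G has_real_derivative \<psi> t) (at t)"
    using antiderivative_exists[OF smooth_continuous_on[OF \<psi>(1)]] by blast
  have Gc: "continuous_on A G" for A
    using G by (meson DERIV_isCont continuous_at_imp_continuous_on)
  define \<Phi> where "\<Phi> t = G t - G c" for t
  have D: "(\<Phi> has_real_derivative \<psi> t) (at t)" for t
    unfolding \<Phi>_def using DERIV_diff[OF G[of t] DERIV_const[of "G c"]] by simp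
  have "(\<psi> has_integral G d - G c) {c..d}"
    by (rule fundamental_theorem_of_calculus[OF cd])
      (auto simp flip: has_real_derivative_iff_has_vector_derivative intro: has_field_derivative_at_within G)
  then have "G d = G c"
    using I integrable_continuous_vanishing(2)[of c d, OF smooth_continuous_on[OF \<psi>(1)] \<psi>(2)]
    by (simp add: integral_unique)
  have "\<Phi> t = 0" if "t \<notin> {c..d}" for t
  proof (cases "t < c")
    case True
    have "G c = G t"
    proof (rule DERIV_isconst_end[OF True Gc])
      show "(G has_real_derivative 0) (at x)" if "t < x" "x < c" for x
        using G[of x] \<psi>(2)[of x] that by simp
    qed
    then show ?thesis by (simp add: \<Phi>_def)
  next
    case False
    then have "d < t" using that by auto
    have "G t = G d"
    proof (rule DERIV_isconst_end[OF \<open>d < t\<close> Gc])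
      show "(G has_real_derivative 0) (at x)" if "d < x" "x < t" for x
        using G[of x] \<psi>(2)[of x] that by simp
    qed
    then show ?thesis using \<open>G d = G c\<close> by (simp add: \<Phi>_def)
  qed
  moreover have "deriv \<Phi> = \<psi>" by (rule ext, rule DERIV_imp_deriv, rule D)
  ultimately show thesis using that smoothI_DERIV[OF D \<psi>(1)] by blast
qed

lemma normalized_bump:
  fixes c d :: real
  assumes "c < d"
  obtains \<theta> where "smooth \<theta>" "\<And>t. t \<notin> {c..d} \<Longrightarrow> \<theta> t = 0" "(LINT t|lebesgue. \<theta> t) = 1"
proof -
  obtain \<eta> where \<eta>: "smooth \<eta>" "\<And>t. t \<le> 0 \<Longrightarrow> \<eta> t = 0" "\<And>t. t \<ge> 1 \<Longrightarrow> \<eta> t = 1"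
    "\<And>t. t \<notin> {0..1} \<Longrightarrow> deriv \<eta> t = 0"
    using smooth_step by metis
  define s where "s t = \<eta> (1 / (d - c) * (t - c))" for t
  have s: "smooth s" unfolding s_def by (rule smooth_affine[OF \<eta>(1)])
  have out: "deriv s t = 0" if "t \<notin> {c..d}" for t
  proof -
    have "((\<lambda>t. 1 / (d - c) * (t - c)) has_real_derivative 1 / (d - c)) (at t)"
      using assms by (auto intro!: derivative_eq_intros)
    from DERIV_chain2[OF smooth_DERIV[OF \<eta>(1)] this]
    have "deriv s t = deriv \<eta> (1 / (d - c) * (t - c)) * (1 / (d - c))"
      unfolding s_def by (rule DERIV_imp_deriv)
    moreover have "1 / (d - c) * (t - c) \<notin> {0..1}"
      using that assms by (auto simp: divide_simps)
    ultimately show ?thesis by (simp add: \<eta>(4))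
  qed
  have "(deriv s has_integral s d - s c) {c..d}"
    using assms by (intro fundamental_theorem_of_calculus)
      (auto simp flip: has_real_derivative_iff_has_vector_derivative
        intro: has_field_derivative_at_within smooth_DERIV[OF s])
  moreover have "s d = 1" "s c = 0" using assms by (simp_all add: s_def \<eta>)
  ultimately have "(LINT t|lebesgue. deriv s t) = 1"
    using integrable_continuous_vanishing(2)[of c d, OF smooth_continuous_on[OF smooth_deriv[OF s]] out]
    by (simp add: integral_unique)
  then show thesis using that smooth_deriv[OF s] out by blast
qed

lemma integrable_continuous_mult_vanishing:
  assumes "continuous_on UNIV f" "smooth \<phi>" "\<And>t. t \<notin> {c..d} \<Longrightarrow> \<phi> t = 0"
  shows "integrable lebesgue (\<lambda>t. f t * \<phi> t)"
  using assms smooth_continuous_on[OF assms(2)]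
  by (intro integrable_continuous_vanishing(1)[of c d])
    (auto intro!: continuous_intros intro: continuous_on_subset)

lemma integration_by_parts_vanishing:
  assumes G: "\<And>t. (G has_real_derivative g t) (at t)" "continuous_on UNIV g"
    and \<phi>: "smooth \<phi>" "\<And>t. t \<notin> {c..d} \<Longrightarrow> \<phi> t = 0"
  shows "(LINT t|lebesgue. G t * deriv \<phi> t) = - (LINT t|lebesgue. g t * \<phi> t)"
proof -
  have Gc: "continuous_on UNIV G" using G(1) by (meson DERIV_isCont continuous_at_imp_continuous_on)
  have d0: "deriv \<phi> t = 0" if "t \<notin> {c..d}" for t using deriv_eq_0_outside[OF \<phi>(2) that] .
  have "(LINT t|lebesgue. G t * deriv \<phi> t + g t * \<phi> t) = 0"
  proof (rule integral_derivative_vanishing)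
    show "((\<lambda>t. G t * \<phi> t) has_real_derivative G t * deriv \<phi> t + g t * \<phi> t) (at t)" for t
      by (rule DERIV_mult'[OF G(1) smooth_DERIV[OF \<phi>(1)]])
    show "continuous_on UNIV (\<lambda>t. G t * deriv \<phi> t + g t * \<phi> t)"
      by (intro continuous_intros Gc G(2) smooth_continuous_on smooth_deriv \<phi>)
    show "G t * \<phi> t = 0" if "t \<notin> {c..d}" for t using \<phi>(2)[OF that] by simp
  qed
  moreover have "integrable lebesgue (\<lambda>t. G t * deriv \<phi> t)"
    by (rule integrable_continuous_mult_vanishing[OF Gc smooth_deriv[OF \<phi>(1)] d0])
  moreover have "integrable lebesgue (\<lambda>t. g t * \<phi> t)"
    by (rule integrable_continuous_mult_vanishing[OF G(2) \<phi>])
  ultimately show ?thesis by (simp add: Bochner_Integration.integral_add)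
qed

text \<open>
  The lemma of du Bois-Reymond. Subtracting a multiple of a fixed bump turns an arbitrary test function
  into a derivative, which shows that \<open>w\<close> and a primitive of \<open>K\<close> differ by a constant \<open>C\<close> when tested on
  \<open>{c..d}\<close>. So \<open>f\<close> and a primitive \<open>H\<close> of that function have the same weak derivative; testing with
  \<open>indicator_approximation\<close> shows that \<open>f - H\<close> is constant.
\<close>

lemma weak_second_derivative:
  fixes f w K :: "real \<Rightarrow> real"
  assumes f: "continuous_on UNIV f" "weak_derivative f w" and cd: "c < d"
    and K: "continuous_on UNIV K"
    and eq: "\<And>\<phi>. smooth \<phi> \<Longrightarrow> (\<And>t. t \<notin> {c..d} \<Longrightarrow> \<phi> t = 0) \<Longrightarrow>
        (LINT t|lebesgue. w t * deriv \<phi> t) = - (LINT t|lebesgue. K t * \<phi> t)"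
  obtains g where "\<And>t. t \<in> {c<..<d} \<Longrightarrow> (f has_real_derivative g t) (at t)"
    "\<And>t. (g has_real_derivative K t) (at t)"
proof -
  obtain G where G: "\<And>t. (G has_real_derivative K t) (at t)" using antiderivative_exists[OF K] by blast
  have Gc: "continuous_on UNIV G" using G by (meson DERIV_isCont continuous_at_imp_continuous_on)
  obtain \<theta> where \<theta>: "smooth \<theta>" "\<And>t. t \<notin> {c..d} \<Longrightarrow> \<theta> t = 0" "(LINT t|lebesgue. \<theta> t) = 1"
    using normalized_bump[OF cd] by blast
  have wint: "integrable lebesgue (\<lambda>t. w t * \<psi> t)"
    if "smooth \<psi>" "\<And>t. t \<notin> {c..d} \<Longrightarrow> \<psi> t = 0" for \<psi>
    by (rule integrable_L1_loc_mult[of c d, OF _ smooth_continuous_on that(2)])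
      (use f(2) that(1) in \<open>auto simp: weak_derivative_def L1_loc_def\<close>)
  \<comment> \<open>the constant by which \<open>w\<close> and \<open>G\<close> differ, measured with \<open>\<theta>\<close>\<close>
  define C where "C = (LINT t|lebesgue. w t * \<theta> t) - (LINT t|lebesgue. G t * \<theta> t)"
  define g where "g t = G t + C" for t
  have g: "(g has_real_derivative K t) (at t)" for t
    unfolding g_def using DERIV_add[OF G[of t] DERIV_const[of C]] by simp
  have gc: "continuous_on UNIV g" unfolding g_def by (intro continuous_intros Gc)
  obtain H where H: "\<And>t. (H has_real_derivative g t) (at t)" using antiderivative_exists[OF gc] by blast
  have Hc: "continuous_on UNIV H" using H by (meson DERIV_isCont continuous_at_imp_continuous_on)
  have key: "(LINT t|lebesgue. (f t - H t) * deriv \<psi> t) = 0"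
    if \<psi>: "smooth \<psi>" "\<And>t. t \<notin> {c..d} \<Longrightarrow> \<psi> t = 0" for \<psi>
  proof -
    define I where "I = (LINT t|lebesgue. \<psi> t)"
    define \<psi>\<^sub>0 where "\<psi>\<^sub>0 t = \<psi> t - I * \<theta> t" for t
    have int: "integrable lebesgue \<psi>" "integrable lebesgue \<theta>"
      by (rule integrable_continuous_vanishing(1)[OF smooth_continuous_on]; fact \<psi> \<theta>)+
    have \<psi>\<^sub>0: "\<psi>\<^sub>0 t = 0" if "t \<notin> {c..d}" for t
      unfolding \<psi>\<^sub>0_def using \<psi>(2)[OF that] \<theta>(2)[OF that] by simp
    have "smooth \<psi>\<^sub>0" unfolding \<psi>\<^sub>0_def by (intro smooth_diff smooth_mult smooth_const \<psi> \<theta>)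
    moreover have "(LINT t|lebesgue. \<psi>\<^sub>0 t) = 0"
      unfolding \<psi>\<^sub>0_def using int \<theta>(3) by (simp add: Bochner_Integration.integral_diff I_def)
    ultimately obtain \<Phi> where \<Phi>: "smooth \<Phi>" "deriv \<Phi> = \<psi>\<^sub>0" "\<And>t. t \<notin> {c..d} \<Longrightarrow> \<Phi> t = 0"
      using antiderivative_vanishing[of \<psi>\<^sub>0 c d] \<psi>\<^sub>0 cd by (metis less_imp_le)
    have "(LINT t|lebesgue. w t * \<psi>\<^sub>0 t) = (LINT t|lebesgue. G t * \<psi>\<^sub>0 t)"
      using eq[OF \<Phi>(1,3)] integration_by_parts_vanishing[OF G K \<Phi>(1,3)] by (simp add: \<Phi>(2))
    moreover have "(LINT t|lebesgue. w t * \<psi>\<^sub>0 t) = (LINT t|lebesgue. w t * \<psi> t) - I * (LINT t|lebesgue. w t * \<theta> t)"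
    proof -
      have "(LINT t|lebesgue. w t * \<psi>\<^sub>0 t) = (LINT t|lebesgue. w t * \<psi> t - I * (w t * \<theta> t))"
        by (simp add: \<psi>\<^sub>0_def algebra_simps)
      then show ?thesis using wint[OF \<psi>] wint[OF \<theta>(1,2)] by (simp add: Bochner_Integration.integral_diff)
    qed
    moreover have "(LINT t|lebesgue. G t * \<psi>\<^sub>0 t) = (LINT t|lebesgue. G t * \<psi> t) - I * (LINT t|lebesgue. G t * \<theta> t)"
    proof -
      have "(LINT t|lebesgue. G t * \<psi>\<^sub>0 t) = (LINT t|lebesgue. G t * \<psi> t - I * (G t * \<theta> t))"
        by (simp add: \<psi>\<^sub>0_def algebra_simps)
      then show ?thesis
        using integrable_continuous_mult_vanishing[OF Gc \<psi>] integrable_continuous_mult_vanishing[OF Gc \<theta>(1,2)]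
        by (simp add: Bochner_Integration.integral_diff)
    qed
    ultimately have "(LINT t|lebesgue. w t * \<psi> t) = (LINT t|lebesgue. G t * \<psi> t) + C * I"
      by (simp add: C_def algebra_simps)
    also have "\<dots> = (LINT t|lebesgue. G t * \<psi> t + C * \<psi> t)"
      using integrable_continuous_mult_vanishing[OF Gc \<psi>] int
      by (simp add: Bochner_Integration.integral_add I_def)
    also have "\<dots> = (LINT t|lebesgue. g t * \<psi> t)" by (simp add: g_def algebra_simps)
    also have "\<dots> = - (LINT t|lebesgue. H t * deriv \<psi> t)"
      using integration_by_parts_vanishing[OF H gc \<psi>] by simp
    finally have "(LINT t|lebesgue. f t * deriv \<psi> t) = (LINT t|lebesgue. H t * deriv \<psi> t)"
      using f(2) test_functionI[OF \<psi>] by (simp add: weak_derivative_def)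
    moreover have "integrable lebesgue (\<lambda>t. k t * deriv \<psi> t)" if "continuous_on UNIV k" for k
      by (rule integrable_continuous_mult_vanishing[OF that smooth_deriv[OF \<psi>(1)] deriv_eq_0_outside[OF \<psi>(2)]])
    ultimately show ?thesis using f(1) Hc
      by (simp add: left_diff_distrib Bochner_Integration.integral_diff)
  qed
  have const: "f a - H a = f b - H b" if ab: "c < a" "a < b" "b < d" for a b
  proof -
    obtain \<phi> :: "nat \<Rightarrow> real \<Rightarrow> real"
      where \<phi>: "\<And>n. smooth (\<phi> n)" "\<And>n t. t \<notin> {a..b + 1 / Suc n} \<Longrightarrow> \<phi> n t = 0"
        "\<And>n t. \<bar>\<phi> n t\<bar> \<le> 1" "\<And>t. (\<lambda>n. \<phi> n t) \<longlonglongrightarrow> indicator {a<..b} t"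
        "\<And>f. continuous_on UNIV f \<Longrightarrow> (\<lambda>n. LINT t|lebesgue. f t * deriv (\<phi> n) t) \<longlonglongrightarrow> f a - f b"
      using indicator_approximation[OF ab(2)] by blast
    obtain N where N: "1 / real (Suc N) < d - b" using nat_approx_posE[of "d - b"] ab by auto
    have "(LINT t|lebesgue. (f t - H t) * deriv (\<phi> n) t) = 0" if "n \<ge> N" for n
    proof (rule key[OF \<phi>(1)])
      fix t assume "t \<notin> {c..d}"
      have "1 / real (Suc n) \<le> 1 / real (Suc N)" using that by (intro divide_left_mono) auto
      then have "b + 1 / real (Suc n) \<le> d" using N by linarith
      with \<open>t \<notin> {c..d}\<close> ab have "t \<notin> {a..b + 1 / real (Suc n)}"
        by (simp only: atLeastAtMost_iff) linarith
      then show "\<phi> n t = 0" by (rule \<phi>(2))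
    qed
    then have "(\<lambda>n. LINT t|lebesgue. (f t - H t) * deriv (\<phi> n) t) \<longlonglongrightarrow> 0"
      by (intro tendsto_eventually) (auto simp: eventually_sequentially)
    moreover have "(\<lambda>n. LINT t|lebesgue. (f t - H t) * deriv (\<phi> n) t) \<longlonglongrightarrow> (f a - H a) - (f b - H b)"
      by (intro \<phi>(5) continuous_intros f Hc)
    ultimately have "0 = (f a - H a) - (f b - H b)" by (rule LIMSEQ_unique)
    then show ?thesis by simp
  qed
  have "(f has_real_derivative g t) (at t)" if t: "t \<in> {c<..<d}" for t
  proof -
    have eqH: "H x + (f t - H t) = f x" if "x \<in> {c<..<d}" for x
      using const[of x t] const[of t x] that t by (cases x t rule: linorder_cases) auto
    have "((\<lambda>x. H x + (f t - H t)) has_real_derivative g t) (at t)"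
      using DERIV_add[OF H[of t] DERIV_const[of "f t - H t"]] by simp
    then show ?thesis
      by (rule has_field_derivative_transform_within_open[OF _ open_greaterThanLessThan t eqH])
  qed
  then show thesis using that g by blast
qed

section \<open>Regularity of singular waves where they are positive\<close>

lemma L1_loc_measurable:
  assumes "L1_loc f"
  shows "f \<in> borel_measurable lebesgue"
proof (rule borel_measurable_LIMSEQ_real)
  show "(\<lambda>t. indicat_real {- real n..real n} t *\<^sub>R f t) \<in> borel_measurable lebesgue" for n
    using assms by (auto simp: L1_loc_def set_integrable_def intro: borel_measurable_integrable)
  show "(\<lambda>n. indicat_real {- real n..real n} t *\<^sub>R f t) \<longlonglongrightarrow> f t" for t
  proof (rule tendsto_eventually)
    obtain N where "\<bar>t\<bar> \<le> real N" using real_arch_simple by blast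
    then have "\<bar>t\<bar> \<le> real n" if "n \<ge> N" for n using that by (meson of_nat_mono order_trans)
    then show "\<forall>\<^sub>F n in sequentially. indicat_real {- real n..real n} t *\<^sub>R f t = f t"
      unfolding eventually_sequentially by (intro exI[of _ N]) (force simp: abs_le_iff indicator_def)
  qed
qed

lemma continuous_lebesgue_measurable:
  "continuous_on UNIV f \<Longrightarrow> (f :: real \<Rightarrow> real) \<in> borel_measurable lebesgue"
  by (intro measurable_completion) (simp add: borel_measurable_continuous_onI)

lemma AE_notin_countable:
  "countable S \<Longrightarrow> AE t in lebesgue. (t :: real) \<notin> S"
  by (intro AE_not_in null_sets_completionI countable_imp_null_set_lborel)

lemma real_analytic_continuous:
  assumes "\<And>x. real_analytic_at F x"
  shows "continuous_on A F" "continuous_on A (deriv F)"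
  using assms by (auto intro!: continuous_at_imp_continuous_on real_analytic_at_isCont
      real_analytic_at_derivative(2))

text \<open>
  The weak equation involves \<open>v\<^sup>2\<close>, the square of a weak derivative, which agrees almost everywhere
  with the square of the classical derivative. So it says that \<open>K\<close> is the second distributional
  derivative of \<open>u\<^sup>2\<close>.
\<close>

lemma TWS_local_weak_form:
  assumes F: "\<And>x. real_analytic_at F x" and u: "TWS F u" and S: "countable S" and ce: "e < d"
    and D: "\<And>x. x \<in> {c..d} - S \<Longrightarrow> (u has_real_derivative D x) (at x) \<and> \<bar>D x\<bar> \<le> M"
    and K: "continuous_on UNIV K" "\<And>x. x \<in> {c..e} - S \<Longrightarrow> K x = (D x)\<^sup>2 - 2 * deriv F (u x)"
  obtains w where "weak_derivative (\<lambda>t. (u t)\<^sup>2) w"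
    "\<And>\<phi>. smooth \<phi> \<Longrightarrow> (\<And>t. t \<notin> {c..e} \<Longrightarrow> \<phi> t = 0) \<Longrightarrow>
        (LINT t|lebesgue. w t * deriv \<phi> t) = - (LINT t|lebesgue. K t * \<phi> t)"
proof -
  have uc: "continuous_on UNIV u" using u by (simp add: TWS_def)
  obtain v w where v: "weak_derivative u v" and w: "weak_derivative (\<lambda>t. (u t)\<^sup>2) w"
    and eq: "\<And>\<phi>. test_function \<phi> \<Longrightarrow>
      (LINT t|lebesgue. w t * deriv \<phi> t + (v t)\<^sup>2 * \<phi> t - 2 * deriv F (u t) * \<phi> t) = 0"
    using u unfolding TWS_def by blast
  have vD: "AE t in lebesgue. t \<in> {c..e} \<longrightarrow> v t = D t"
    by (rule weak_derivative_AE_eq[OF v uc S D ce])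
  have "(LINT t|lebesgue. w t * deriv \<phi> t) = - (LINT t|lebesgue. K t * \<phi> t)"
    if \<phi>: "smooth \<phi>" "\<And>t. t \<notin> {c..e} \<Longrightarrow> \<phi> t = 0" for \<phi>
  proof -
    have d\<phi>: "deriv \<phi> t = 0" if "t \<notin> {c..e}" for t by (rule deriv_eq_0_outside[OF \<phi>(2) that])
    have F'u: "continuous_on UNIV (\<lambda>t. deriv F (u t))"
      by (rule continuous_on_compose2[OF real_analytic_continuous(2)[OF F, of UNIV] uc]) simp
    have meas: "v \<in> borel_measurable lebesgue" "w \<in> borel_measurable lebesgue"
      "\<phi> \<in> borel_measurable lebesgue" "deriv \<phi> \<in> borel_measurable lebesgue"
      "(\<lambda>t. deriv F (u t)) \<in> borel_measurable lebesgue" "K \<in> borel_measurable lebesgue"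
      using v w L1_loc_measurable F'u K(1) smooth_continuous_on[OF \<phi>(1)]
        smooth_continuous_on[OF smooth_deriv[OF \<phi>(1)]]
      by (auto simp: weak_derivative_def intro: continuous_lebesgue_measurable)
    have "(LINT t|lebesgue. w t * deriv \<phi> t + K t * \<phi> t) =
        (LINT t|lebesgue. w t * deriv \<phi> t + (v t)\<^sup>2 * \<phi> t - 2 * deriv F (u t) * \<phi> t)"
    proof (rule integral_cong_AE)
      show "AE t in lebesgue. w t * deriv \<phi> t + K t * \<phi> t =
          w t * deriv \<phi> t + (v t)\<^sup>2 * \<phi> t - 2 * deriv F (u t) * \<phi> t"
        using vD AE_notin_countable[OF S]
      proof eventually_elim
        case (elim t)
        show ?case
        proof (cases "t \<in> {c..e}")
          case True
          then have "v t = D t" and Kt: "K t = (D t)\<^sup>2 - 2 * deriv F (u t)" using elim K(2) by auto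
          then show ?thesis unfolding Kt by (simp add: algebra_simps)
        next
          case False
          then have "\<phi> t = 0" "deriv \<phi> t = 0" using \<phi>(2) d\<phi> by blast+
          then show ?thesis by simp
        qed
      qed
    qed (use meas in \<open>auto intro!: borel_measurable_add borel_measurable_diff borel_measurable_times
          borel_measurable_power borel_measurable_const\<close>)
    also have "\<dots> = 0" by (rule eq[OF test_functionI[OF \<phi>]])
    finally have "(LINT t|lebesgue. w t * deriv \<phi> t + K t * \<phi> t) = 0" .
    moreover have "integrable lebesgue (\<lambda>t. w t * deriv \<phi> t)"
      by (rule integrable_L1_loc_mult[of c e, OF _ smooth_continuous_on[OF smooth_deriv[OF \<phi>(1)]] d\<phi>])
        (use w in \<open>auto simp: weak_derivative_def L1_loc_def\<close>)
    moreover have "integrable lebesgue (\<lambda>t. K t * \<phi> t)"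
      by (rule integrable_continuous_mult_vanishing[OF K(1) \<phi>])
    ultimately show ?thesis by (simp add: Bochner_Integration.integral_add)
  qed
  with w show thesis by (rule that)
qed

text \<open>
  Where \<open>u\<close> vanishes on an interval, all that remains of the weak equation is the constant
  \<open>deriv F 0\<close>.
\<close>

lemma TWS_zero_interval:
  assumes F: "\<And>x. real_analytic_at F x" and u: "TWS F u" and ab: "a < b"
    and 0: "\<And>t. t \<in> {a..b} \<Longrightarrow> u t = 0"
  shows "deriv F 0 = 0"
proof -
  define c where "c = a + (b - a) / 4"
  define e where "e = a + (b - a) / 2"
  define d where "d = a + 3 * (b - a) / 4"
  have ord: "a < c" "c < e" "e < d" "d < b" using ab by (auto simp: c_def d_def e_def field_simps)
  have D: "(u has_real_derivative 0) (at t) \<and> \<bar>0 :: real\<bar> \<le> 0" if "t \<in> {c..d} - {}" for t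
  proof -
    have "((\<lambda>t. 0) has_real_derivative 0) (at t)" by simp
    then have "(u has_real_derivative 0) (at t)"
      by (rule has_field_derivative_transform_within_open[of _ _ _ "{a<..<b}"])
        (use 0 ord that in auto)
    then show ?thesis by simp
  qed
  obtain w where w: "weak_derivative (\<lambda>t. (u t)\<^sup>2) w"
    "\<And>\<phi>. smooth \<phi> \<Longrightarrow> (\<And>t. t \<notin> {c..e} \<Longrightarrow> \<phi> t = 0) \<Longrightarrow>
        (LINT t|lebesgue. w t * deriv \<phi> t) = - (LINT t|lebesgue. (- 2 * deriv F 0) * \<phi> t)"
    by (rule TWS_local_weak_form[where K = "\<lambda>_. - 2 * deriv F 0" and S = "{}" and D = "\<lambda>_. 0" and M = 0,
          OF F u _ ord(3) D])
      (use 0 ord in \<open>auto intro!: continuous_intros\<close>)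
  obtain \<theta> where \<theta>: "smooth \<theta>" "\<And>t. t \<notin> {c..e} \<Longrightarrow> \<theta> t = 0" "(LINT t|lebesgue. \<theta> t) = 1"
    using normalized_bump[OF ord(2)] by blast
  have out: "deriv \<theta> t = 0" if "t \<notin> {c..e}" for t by (rule deriv_eq_0_outside[OF \<theta>(2) that])
  have "(LINT t|lebesgue. w t * deriv \<theta> t) = - (LINT t|lebesgue. (u t)\<^sup>2 * deriv (deriv \<theta>) t)"
    using w(1) test_functionI[OF smooth_deriv[OF \<theta>(1)] out] by (simp add: weak_derivative_def)
  also have "(\<lambda>t. (u t)\<^sup>2 * deriv (deriv \<theta>) t) = (\<lambda>t. 0)"
  proof
    fix t
    show "(u t)\<^sup>2 * deriv (deriv \<theta>) t = 0"
    proof (cases "t \<in> {c..e}")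
      case True then show ?thesis using 0[of t] ord by simp
    next
      case False
      have "deriv (deriv \<theta>) t = 0" by (rule deriv_eq_0_outside[OF out False])
      then show ?thesis by simp
    qed
  qed
  finally have "(LINT t|lebesgue. (- 2 * deriv F 0) * \<theta> t) = 0" using w(2)[OF \<theta>(1,2)] by simp
  then show ?thesis using \<theta>(3) by simp
qed

text \<open>
  Conservation of energy alone allows kinks at points of \<open>S\<close>, where the derivative jumps from \<open>p\<close> to \<open>- p\<close>. But
  \<open>(deriv u)\<^sup>2\<close> does not notice them: off \<open>S\<close> it equals \<open>2 * (h - F u) / u\<close>, which is continuous. By
  \<open>TWS_local_weak_form\<close> the function \<open>u\<^sup>2\<close> is therefore \<open>C\<^sup>2\<close>, and so is \<open>u\<close> itself where it is
  positive. Its equation follows from that of \<open>u\<^sup>2\<close>, and the energy is constant because the complement of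
  \<open>S\<close> is dense.
\<close>

lemma singular_TWS_regular_where_positive:
  assumes F: "\<And>x. real_analytic_at F x" and u: "TWS F u" and S: "countable S"
    and E: "classical_energy_solution_on F h (- S) u" and pos: "u t > 0"
  shows "(u has_real_derivative deriv u t) (at t)"
    "(deriv u has_real_derivative - ((deriv u t)\<^sup>2 / 2 + deriv F (u t)) / u t) (at t)"
    "energy F u t = h"
proof -
  have uc: "continuous_on A u" for A using u by (auto simp: TWS_def intro: continuous_on_subset)
  obtain r where r: "r > 0" "\<And>x. \<bar>x - t\<bar> \<le> r \<Longrightarrow> u x > 0"
  proof -
    have "open {x. 0 < u x}" using uc[of UNIV] by (intro open_Collect_less continuous_on_const)
    then show ?thesis using that pos unfolding open_contains_cball
      by (fastforce simp: subset_eq dist_real_def abs_minus_commute)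
  qed
  define c where "c = t - r"
  define e where "e = t + r / 2"
  define d where "d = t + r"
  have ord: "c < t" "t < e" "e < d" using r by (auto simp: c_def e_def d_def)
  have upos: "u x > 0" if "x \<in> {c..d}" for x
    using r(2)[of x] that by (simp add: c_def d_def abs_le_iff)
  have F'u: "continuous_on A (\<lambda>t. deriv F (u t))" for A
    by (rule continuous_on_compose2[OF real_analytic_continuous(2)[OF F, of UNIV] uc]) simp
  have Fu: "continuous_on A (\<lambda>t. F (u t))" for A
    by (rule continuous_on_compose2[OF real_analytic_continuous(1)[OF F, of UNIV] uc]) simp
  define P where "P x = 2 * (h - F (u x)) / u x" for x
  have Pc: "continuous_on {c..d} P"
    unfolding P_def using upos by (intro continuous_intros Fu uc) force
  have du: "(u has_real_derivative deriv u x) (at x)" "energy F u x = h" if "x \<notin> S" for x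
  proof -
    obtain D where "(u has_vector_derivative D) (at x)"
      using E \<open>x \<notin> S\<close> unfolding classical_energy_solution_on_def C1_differentiable_on_def by blast
    then have "(u has_real_derivative D) (at x)" by (simp add: has_real_derivative_iff_has_vector_derivative)
    then show "(u has_real_derivative deriv u x) (at x)" using DERIV_imp_deriv by blast
    show "energy F u x = h" using E that by (simp add: classical_energy_solution_on_def)
  qed
  have sq: "(deriv u x)\<^sup>2 = P x" if "x \<in> {c..d} - S" for x
    using du(2)[of x] upos[of x] that by (simp add: energy_def P_def field_simps)
  have "compact (P ` {c..d})" by (intro compact_continuous_image Pc compact_Icc)
  then obtain B where B: "\<forall>y\<in>P ` {c..d}. norm y \<le> B"
    using compact_imp_bounded bounded_iff by blast
  have D: "(u has_real_derivative deriv u x) (at x) \<and> \<bar>deriv u x\<bar> \<le> sqrt B" if "x \<in> {c..d} - S" for x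
  proof -
    have "(deriv u x)\<^sup>2 \<le> B" using sq[OF that] B that by force
    then show ?thesis using du(1)[of x] that real_le_rsqrt[of "\<bar>deriv u x\<bar>" B] by simp
  qed
  \<comment> \<open>clamping to \<open>{c..e}\<close> extends the right-hand side continuously to the whole line\<close>
  define K where "K x = P (max c (min e x)) - 2 * deriv F (u (max c (min e x)))" for x
  have clamp: "max c (min e x) \<in> {c..d}" for x using ord by auto
  have Kc: "continuous_on UNIV K" unfolding K_def
    by (intro continuous_intros continuous_on_compose2[OF Pc] continuous_on_compose2[OF F'u[of UNIV]])
      (use clamp in auto)
  have Keq: "K x = P x - 2 * deriv F (u x)" if "x \<in> {c..e}" for x using that by (simp add: K_def)
  obtain w where w: "weak_derivative (\<lambda>t. (u t)\<^sup>2) w"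
    "\<And>\<phi>. smooth \<phi> \<Longrightarrow> (\<And>t. t \<notin> {c..e} \<Longrightarrow> \<phi> t = 0) \<Longrightarrow>
        (LINT t|lebesgue. w t * deriv \<phi> t) = - (LINT t|lebesgue. K t * \<phi> t)"
    by (rule TWS_local_weak_form[OF F u S ord(3) D Kc]) (use Keq sq ord in auto)
  have u2c: "continuous_on UNIV (\<lambda>t. (u t)\<^sup>2)" by (intro continuous_intros uc)
  have ce: "c < e" using ord by simp
  obtain g where g: "\<And>x. x \<in> {c<..<e} \<Longrightarrow> ((\<lambda>t. (u t)\<^sup>2) has_real_derivative g x) (at x)"
    "\<And>x. (g has_real_derivative K x) (at x)"
    using weak_second_derivative[OF u2c w(1) ce Kc w(2)] by blast
  define u1 where "u1 x = g x / (2 * u x)" for x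
  have Du: "(u has_real_derivative u1 x) (at x)" if x: "x \<in> {c<..<e}" for x
  proof -
    have ux: "u x > 0" using x ord by (intro upos) auto
    have "((\<lambda>t. sqrt ((u t)\<^sup>2)) has_real_derivative inverse (sqrt ((u x)\<^sup>2)) / 2 * g x) (at x)"
      by (rule DERIV_chain2[OF DERIV_real_sqrt g(1)[OF x]]) (use ux in simp)
    moreover have "sqrt ((u y)\<^sup>2) = u y" for y using u by (simp add: TWS_def)
    ultimately show ?thesis by (simp add: u1_def field_simps)
  qed
  have du1: "deriv u x = u1 x" if "x \<in> {c<..<e}" for x using Du[OF that] by (rule DERIV_imp_deriv)
  have gc: "continuous_on A g" for A using g(2) by (meson DERIV_isCont continuous_at_imp_continuous_on)
  have "2 * u x \<noteq> 0" if "x \<in> {c<..<e}" for x using upos[of x] that ord by simp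
  then have u1c: "continuous_on {c<..<e} u1" unfolding u1_def
    by (intro continuous_on_divide continuous_on_mult continuous_on_const gc uc ballI)
  have en: "energy F u x = h" if x: "x \<in> {c<..<e}" for x
  proof (rule ccontr)
    assume "energy F u x \<noteq> h"
    \<comment> \<open>a nonempty open set cannot be contained in the countable set \<open>S\<close>\<close>
    define N where "N = {x \<in> {c<..<e}. u x * (u1 x)\<^sup>2 / 2 + F (u x) \<noteq> h}"
    have "open N"
    proof -
      have "continuous_on {c<..<e} (\<lambda>x. u x * (u1 x)\<^sup>2 / 2 + F (u x))"
        by (intro continuous_intros uc u1c Fu) simp
      from continuous_open_preimage[OF this _ open_Compl[OF closed_singleton[of h]]]
      show ?thesis by (simp add: N_def vimage_def Int_def)
    qed
    moreover have "x \<in> N" using x \<open>energy F u x \<noteq> h\<close> by (simp add: N_def energy_def du1)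
    ultimately obtain s where "s > 0" "ball x s \<subseteq> N" using open_contains_ball by blast
    then have "{x - s<..<x + s} \<subseteq> N" by (auto simp: ball_eq_greaterThanLessThan)
    moreover have "N \<subseteq> S"
    proof
      fix y assume y: "y \<in> N"
      then have "energy F u y \<noteq> h" by (simp add: N_def energy_def du1)
      then show "y \<in> S" using du(2) by blast
    qed
    ultimately have "countable {x - s<..<x + s}" using S by (meson countable_subset subset_trans)
    then show False using \<open>s > 0\<close> uncountable_open_interval[of "x - s" "x + s"] by simp
  qed
  have t: "t \<in> {c<..<e}" using ord by simp
  show "(u has_real_derivative deriv u t) (at t)" using Du[OF t] du1[OF t] by simp
  show "energy F u t = h" by (rule en[OF t])
  have gt: "g t = 2 * u t * u1 t" using pos by (simp add: u1_def)
  have "u t * (u1 t)\<^sup>2 / 2 + F (u t) = h" using en[OF t] by (simp add: energy_def du1[OF t])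
  then have Pt: "P t = (u1 t)\<^sup>2" using pos by (simp add: P_def field_simps)
  have Kt: "K t = (u1 t)\<^sup>2 - 2 * deriv F (u t)" using Keq[of t] Pt ord by simp
  have "((\<lambda>x. g x / (2 * u x)) has_real_derivative
      (K t * (2 * u t) - g t * (2 * u1 t)) / (2 * u t * (2 * u t))) (at t)"
    by (rule DERIV_divide[OF g(2) DERIV_cmult[OF Du[OF t]]]) (use pos in simp)
  also have "(K t * (2 * u t) - g t * (2 * u1 t)) / (2 * u t * (2 * u t))
      = - ((deriv u t)\<^sup>2 / 2 + deriv F (u t)) / u t"
    unfolding Kt gt du1[OF t] using pos by (simp add: field_simps power2_eq_square)
  finally have "(u1 has_real_derivative - ((deriv u t)\<^sup>2 / 2 + deriv F (u t)) / u t) (at t)"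
    unfolding u1_def[abs_def] .
  then show "(deriv u has_real_derivative - ((deriv u t)\<^sup>2 / 2 + deriv F (u t)) / u t) (at t)"
    by (rule has_field_derivative_transform_within_open[OF _ open_greaterThanLessThan t]) (simp add: du1)
qed

section \<open>A wave on a half-line between a zero and its limit\<close>

text \<open>
  Gronwall's argument for \<open>(z - w)\<^sup>2 + (z' - w')\<^sup>2\<close>, whose logarithmic derivative is at most \<open>1 + L\<close>.
\<close>

lemma second_order_uniqueness:
  fixes q z z' w w' :: "real \<Rightarrow> real"
  assumes b: "0 \<le> b" and L: "L \<ge> 0"
    and z: "\<And>s. s \<in> {0..b} \<Longrightarrow> (z has_real_derivative z' s) (at s)"
      "\<And>s. s \<in> {0..b} \<Longrightarrow> (z' has_real_derivative q (z s)) (at s)"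
    and w: "\<And>s. s \<in> {0..b} \<Longrightarrow> (w has_real_derivative w' s) (at s)"
      "\<And>s. s \<in> {0..b} \<Longrightarrow> (w' has_real_derivative q (w s)) (at s)"
    and lip: "\<And>s. s \<in> {0..b} \<Longrightarrow> \<bar>q (z s) - q (w s)\<bar> \<le> L * \<bar>z s - w s\<bar>"
    and init: "z 0 = w 0" "z' 0 = w' 0"
  shows "z b = w b"
proof -
  define E where "E s = (z s - w s)\<^sup>2 + (z' s - w' s)\<^sup>2" for s
  define M where "M = 1 + L"
  have "E b * exp (- M * b) \<le> E 0 * exp (- M * 0)"
  proof (rule DERIV_nonpos_imp_nonincreasing[OF b])
    fix s assume "0 \<le> s" "s \<le> b"
    then have s: "s \<in> {0..b}" by simp
    let ?d = "z s - w s" and ?d' = "z' s - w' s" and ?q = "q (z s) - q (w s)"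
    have "(E has_real_derivative 2 * ?d * ?d' + 2 * ?d' * ?q) (at s)"
      unfolding E_def by (auto intro!: derivative_eq_intros z[OF s] w[OF s] simp: algebra_simps)
    moreover have "((\<lambda>s. exp (- M * s)) has_real_derivative exp (- M * s) * (- M)) (at s)"
      by (auto intro!: derivative_eq_intros)
    ultimately have "((\<lambda>s. E s * exp (- M * s)) has_real_derivative
        E s * (exp (- M * s) * (- M)) + (2 * ?d * ?d' + 2 * ?d' * ?q) * exp (- M * s)) (at s)"
      by (rule DERIV_mult')
    moreover have "E s * (exp (- M * s) * (- M)) + (2 * ?d * ?d' + 2 * ?d' * ?q) * exp (- M * s) \<le> 0"
    proof -
      have "?d' * ?q \<le> \<bar>?d'\<bar> * \<bar>?q\<bar>" by (metis abs_ge_self abs_mult)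
      also have "\<dots> \<le> \<bar>?d'\<bar> * (L * \<bar>?d\<bar>)" using lip[OF s] by (rule mult_left_mono) simp
      finally have "?d' * ?q \<le> \<bar>?d'\<bar> * (L * \<bar>?d\<bar>)" .
      moreover have "?d * ?d' \<le> \<bar>?d'\<bar> * \<bar>?d\<bar>" by (metis abs_ge_self abs_mult mult.commute)
      ultimately have "2 * ?d * ?d' + 2 * ?d' * ?q \<le> M * (2 * \<bar>?d'\<bar> * \<bar>?d\<bar>)"
        by (simp add: M_def algebra_simps)
      also have "2 * \<bar>?d'\<bar> * \<bar>?d\<bar> \<le> E s"
        unfolding E_def using sum_squares_bound[of "\<bar>?d'\<bar>" "\<bar>?d\<bar>"] by simp
      finally have "2 * ?d * ?d' + 2 * ?d' * ?q \<le> M * E s"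
        using L by (simp add: M_def mult_left_mono)
      then have "(2 * ?d * ?d' + 2 * ?d' * ?q - M * E s) * exp (- M * s) \<le> 0"
        by (simp add: mult_nonpos_nonneg)
      then show ?thesis by (simp add: algebra_simps)
    qed
    ultimately show "\<exists>y. ((\<lambda>s. E s * exp (- M * s)) has_real_derivative y) (at s) \<and> y \<le> 0" by blast
  qed
  then have "E b * exp (- M * b) \<le> 0" using init by (simp add: E_def)
  then have "E b \<le> 0" by (simp add: mult_le_0_iff)
  then have "(z b - w b)\<^sup>2 \<le> 0"
    unfolding E_def using zero_le_power2[of "z' b - w' b"] by linarith
  then show ?thesis by simp
qed

text \<open>
  By the mean value theorem, \<open>f (t + 1) - f t\<close> is a value of the derivative at a point that tends to infinity.
\<close>

lemma limit_of_derivative_eq_0: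
  fixes f f' :: "real \<Rightarrow> real"
  assumes D: "\<And>t. t > T \<Longrightarrow> (f has_real_derivative f' t) (at t)"
    and lim: "(f \<longlongrightarrow> L) at_top" "(f' \<longlongrightarrow> \<kappa>) at_top"
  shows "\<kappa> = 0"
proof -
  have "\<exists>x. t < x \<and> x < t + 1 \<and> f (t + 1) - f t = f' x" if "t > T" for t
    using MVT2[of t "t + 1" f f'] D that by auto
  then obtain \<xi> where \<xi>: "\<And>t. t > T \<Longrightarrow> t < \<xi> t \<and> f (t + 1) - f t = f' (\<xi> t)" by metis
  have ev: "\<forall>\<^sub>F t in at_top. t < \<xi> t \<and> f (t + 1) - f t = f' (\<xi> t)"
    using eventually_gt_at_top[of T] by eventually_elim (rule \<xi>)
  have "filterlim \<xi> at_top at_top"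
    by (rule filterlim_at_top_mono[OF filterlim_ident]) (use ev in \<open>auto elim: eventually_mono\<close>)
  from filterlim_compose[OF lim(2) this] have "((\<lambda>t. f' (\<xi> t)) \<longlongrightarrow> \<kappa>) at_top" .
  moreover have "filterlim (\<lambda>t::real. t + 1) at_top at_top"
    using filterlim_tendsto_add_at_top[OF tendsto_const[of 1] filterlim_ident] by (simp add: add.commute)
  then have "((\<lambda>t. f (t + 1) - f t) \<longlongrightarrow> L - L) at_top"
    by (intro tendsto_diff lim filterlim_compose[OF lim(1)])
  then have "((\<lambda>t. f' (\<xi> t)) \<longlongrightarrow> L - L) at_top"
    by (rule Lim_transform_eventually) (use ev in \<open>auto elim: eventually_mono\<close>)
  ultimately have "\<kappa> = L - L" by (rule tendsto_unique[OF trivial_limit_at_top_linorder])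
  then show ?thesis by simp
qed

text \<open>
  At a critical point \<open>t0\<close> the functions \<open>u (t0 + s)\<close> and \<open>u (t0 - s)\<close> solve the same initial value problem.
  They agree until the latter reaches the zero at \<open>T\<close>; but the former is positive there. The force \<open>q\<close>
  below comes from eliminating \<open>u'\<close> with the energy; it is Lipschitz away from \<open>u = 0\<close>.
\<close>

lemma half_wave_no_critical_point:
  assumes F: "\<And>x. real_analytic_at F x"
    and u: "continuous_on {T..} u" "u T = 0" "\<And>t. t > T \<Longrightarrow> u t > 0"
    and Du: "\<And>t. t > T \<Longrightarrow> (u has_real_derivative u' t) (at t)"
    and Du': "\<And>t. t > T \<Longrightarrow> (u' has_real_derivative - ((u' t)\<^sup>2 / 2 + deriv F (u t)) / u t) (at t)"
    and en: "\<And>t. t > T \<Longrightarrow> u t * (u' t)\<^sup>2 / 2 + F (u t) = F 0"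
    and t0: "t0 > T"
  shows "u' t0 \<noteq> 0"
proof
  assume crit: "u' t0 = 0"
  define N where "N x = - (F 0 - F x + x * deriv F x)" for x
  define q where "q x = N x / x\<^sup>2" for x
  \<comment> \<open>the quotient rule for \<open>q\<close>, simplified by \<open>N' x = - x * F'' x\<close>\<close>
  define dq where "dq x = ((- x * deriv (deriv F) x) * x\<^sup>2 - N x * (2 * x)) / (x\<^sup>2 * x\<^sup>2)" for x
  have DF: "(F has_real_derivative deriv F x) (at x)"
    "(deriv F has_real_derivative deriv (deriv F) x) (at x)" for x
    by (intro real_analytic_at_has_derivative real_analytic_at_derivative(2) F)+
  have Dq: "(q has_real_derivative dq x) (at x)" if "x > 0" for x
  proof -
    have "(N has_real_derivative - x * deriv (deriv F) x) (at x)"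
      unfolding N_def by (auto intro!: derivative_eq_intros DF)
    moreover have "((\<lambda>x. x\<^sup>2) has_real_derivative 2 * x) (at x)"
      by (auto intro!: derivative_eq_intros)
    ultimately show ?thesis unfolding q_def dq_def using that by (intro DERIV_divide) auto
  qed
  have Fc: "continuous_on A F" "continuous_on A (deriv F)" "continuous_on A (deriv (deriv F))" for A
    using real_analytic_continuous[OF F] real_analytic_continuous(2)[OF real_analytic_at_derivative(2)[OF F]]
    by auto
  have dqc: "continuous_on {\<alpha>..\<beta>} dq" if "\<alpha> > 0" for \<alpha> \<beta>
    unfolding dq_def N_def using that by (intro continuous_intros Fc) auto
  have acc: "(u' has_real_derivative q (u t)) (at t)" if "t > T" for t
  proof -
    have "F 0 - F (u t) = u t * ((u' t)\<^sup>2 / 2)" using en[OF that] by simp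
    then have sq: "(u' t)\<^sup>2 / 2 = (F 0 - F (u t)) / u t" using u(3)[OF that] by simp
    have "- ((u' t)\<^sup>2 / 2 + deriv F (u t)) / u t = q (u t)"
      unfolding sq using u(3)[OF that] by (simp add: q_def N_def field_simps power2_eq_square)
    then show ?thesis using Du'[OF that] by simp
  qed
  define b where "b = t0 - T"
  have b: "b > 0" using t0 by (simp add: b_def)
  have sym: "u (t0 + s) = u (t0 - s)" if s: "0 \<le> s" "s < b" for s
  proof -
    have uc: "continuous_on {t0 - s..t0 + s} u"
      using s by (intro continuous_on_subset[OF u(1)]) (auto simp: b_def)
    have ne: "{t0 - s..t0 + s} \<noteq> {}" using s by simp
    obtain x where x: "x \<in> {t0 - s..t0 + s}" "\<forall>t\<in>{t0 - s..t0 + s}. u x \<le> u t"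
      using continuous_attains_inf[OF compact_Icc ne uc] by blast
    obtain y where y: "\<forall>t\<in>{t0 - s..t0 + s}. u t \<le> u y"
      using continuous_attains_sup[OF compact_Icc ne uc] by blast
    define \<alpha> where "\<alpha> = u x"
    define \<beta> where "\<beta> = u y"
    have \<alpha>: "\<alpha> > 0" unfolding \<alpha>_def using x(1) s by (intro u(3)) (auto simp: b_def)
    have range: "u t \<in> {\<alpha>..\<beta>}" if "t \<in> {t0 - s..t0 + s}" for t using x(2) y that by (simp add: \<alpha>_def \<beta>_def)
    have "compact (dq ` {\<alpha>..\<beta>})" by (intro compact_continuous_image dqc \<alpha> compact_Icc)
    then obtain L where "\<forall>y\<in>dq ` {\<alpha>..\<beta>}. norm y \<le> L" using compact_imp_bounded bounded_iff by blast
    then have L: "norm (dq x) \<le> \<bar>L\<bar>" if "x \<in> {\<alpha>..\<beta>}" for x using that by force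
    show ?thesis
    proof (rule second_order_uniqueness[where q = q and L = "\<bar>L\<bar>" and
          z = "\<lambda>s. u (t0 + s)" and z' = "\<lambda>s. u' (t0 + s)" and w = "\<lambda>s. u (t0 - s)" and w' = "\<lambda>s. - u' (t0 - s)"])
      fix r assume r: "r \<in> {0..s}"
      then have T: "t0 + r > T" "t0 - r > T" using s by (auto simp: b_def)
      show "((\<lambda>s. u (t0 + s)) has_real_derivative u' (t0 + r)) (at r)"
        "((\<lambda>s. u' (t0 + s)) has_real_derivative q (u (t0 + r))) (at r)"
        using Du[OF T(1)] acc[OF T(1)] by (simp_all add: DERIV_shift add.commute)
      have inner: "((\<lambda>s. t0 - s) has_real_derivative - 1) (at r)" by (auto intro!: derivative_eq_intros)
      show "((\<lambda>s. u (t0 - s)) has_real_derivative - u' (t0 - r)) (at r)"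
        using DERIV_chain2[OF Du[OF T(2)] inner] by simp
      show "((\<lambda>s. - u' (t0 - s)) has_real_derivative q (u (t0 - r))) (at r)"
        using DERIV_minus[OF DERIV_chain2[OF acc[OF T(2)] inner]] by simp
      show "\<bar>q (u (t0 + r)) - q (u (t0 - r))\<bar> \<le> \<bar>L\<bar> * \<bar>u (t0 + r) - u (t0 - r)\<bar>"
      proof -
        have "norm (q (u (t0 + r)) - q (u (t0 - r))) \<le> \<bar>L\<bar> * norm (u (t0 + r) - u (t0 - r))"
        proof (rule field_differentiable_bound[of "{\<alpha>..\<beta>}" q dq])
          show "(q has_real_derivative dq x) (at x within {\<alpha>..\<beta>})" if "x \<in> {\<alpha>..\<beta>}" for x
            by (rule has_field_derivative_at_within[OF Dq]) (use that \<alpha> in auto)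
          show "u (t0 + r) \<in> {\<alpha>..\<beta>}" "u (t0 - r) \<in> {\<alpha>..\<beta>}" by (rule range; use r in simp)+
        qed (use L in auto)
        then show ?thesis by simp
      qed
    qed (use s crit in auto)
  qed
  have "continuous_on {0..b} (\<lambda>s. u (t0 + s) - u (t0 - s))"
    by (intro continuous_intros continuous_on_compose2[OF u(1)]) (auto simp: b_def)
  then have "u (t0 + b) - u (t0 - b) = 0"
    using sym b
    by (intro continuous_constant_on_closure[of "{0..<b}" "\<lambda>s. u (t0 + s) - u (t0 - s)" 0 b]) auto
  moreover have "u (t0 - b) = 0" using u(2) by (simp add: b_def)
  moreover have "u (t0 + b) > 0" using b t0 by (intro u(3)) simp
  ultimately show False by simp
qed

text \<open>
  Without critical points, \<open>u\<close> increases from \<open>0\<close> to \<open>l\<close>, so it takes every value in \<open>(0, l)\<close> with nonzero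
  speed; by the energy, \<open>F < F 0\<close> there. At infinity \<open>u'\<close> and \<open>u''\<close> have limits, which must be \<open>0\<close>; the
  first is a multiple of \<open>sqrt (F 0 - F l)\<close> and then the second one of \<open>deriv F l\<close>. Finally, if
  \<open>deriv (deriv F) 0\<close> were nonnegative, then \<open>F 0 - F x\<close> would be at most a multiple of \<open>x ^ 3\<close>, hence
  \<open>u' \<le> C * u\<close>, and \<open>u\<close> could not leave \<open>0\<close>.
\<close>

lemma half_wave:
  assumes F: "\<And>x. real_analytic_at F x"
    and u: "continuous_on {T..} u" "u T = 0" "\<And>t. t > T \<Longrightarrow> u t > 0"
    and Du: "\<And>t. t > T \<Longrightarrow> (u has_real_derivative u' t) (at t)"
    and Du': "\<And>t. t > T \<Longrightarrow> (u' has_real_derivative - ((u' t)\<^sup>2 / 2 + deriv F (u t)) / u t) (at t)"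
    and en: "\<And>t. t > T \<Longrightarrow> u t * (u' t)\<^sup>2 / 2 + F (u t) = F 0"
    and l: "l > 0" "(u \<longlongrightarrow> l) at_top"
    and edge: "deriv F 0 = 0 \<or> (u' \<longlongrightarrow> 0) (at_right T)"
  shows "\<And>t. t > T \<Longrightarrow> u' t > 0 \<and> u t < l"
    "deriv F 0 = 0" "deriv (deriv F) 0 < 0"
    "F l = F 0" "\<And>x. x \<in> {0<..<l} \<Longrightarrow> F x < F 0" "deriv F l = 0"
proof -
  have nz: "u' t \<noteq> 0" if "t > T" for t
    by (rule half_wave_no_critical_point[OF F u Du Du' en that])
  have uct: "continuous_on {T..t} u" for t using u(1) by (rule continuous_on_subset) auto
  have u'pos: "u' t > 0" if t: "t > T" for t
  proof (rule ccontr)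
    assume "\<not> u' t > 0"
    obtain l z where z: "T < z" "z < t" "(u has_real_derivative l) (at z)" "u t - u T = (t - T) * l"
      using MVT[OF t uct] Du real_differentiable_def by blast
    then have "l = u' z" using Du DERIV_unique by blast
    then have "0 < (t - T) * u' z" using z u(3)[OF t] u(2) by simp
    then have "u' z > 0" using t by (simp add: zero_less_mult_iff)
    moreover have "continuous_on {z..t} u'"
    proof (intro continuous_at_imp_continuous_on ballI)
      show "isCont u' x" if "x \<in> {z..t}" for x using z that by (intro DERIV_isCont[OF Du']) auto
    qed
    ultimately obtain x where "z \<le> x" "u' x = 0"
      using IVT2'[of u' t 0 z] \<open>\<not> u' t > 0\<close> z by auto
    then show False using nz[of x] z by simp
  qed
  have inc: "u s < u t" if "T \<le> s" "s < t" for s t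
    by (rule DERIV_pos_imp_increasing_open[OF that(2)])
      (use that Du u'pos in \<open>force intro: continuous_on_subset[OF u(1)]\<close>)+
  have ul: "u t < l" if "t > T" for t
  proof -
    have "u t < u (t + 1)" using inc that by simp
    also have "u (t + 1) \<le> l"
    proof (rule tendsto_lowerbound[OF l(2)])
      show "\<forall>\<^sub>F s in at_top. u (t + 1) \<le> u s"
        using eventually_gt_at_top[of "t + 1"] by eventually_elim (use inc that in \<open>simp add: less_imp_le\<close>)
    qed simp
    finally show ?thesis .
  qed
  show "u' t > 0 \<and> u t < l" if "t > T" for t using u'pos ul that by blast
  have below: "F x < F 0" if x: "x \<in> {0<..<l}" for x
  proof -
    have "\<forall>\<^sub>F t in at_top. x < u t \<and> t > T"
      using order_tendstoD(1)[OF l(2), of x] x by (intro eventually_conj eventually_gt_at_top) simp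
    then obtain t where t: "x < u t" "t > T"
      using eventually_happens[of _ at_top] trivial_limit_at_top_linorder by blast
    obtain s where s: "T \<le> s" "u s = x" using IVT'[of u T x t] uct t x u(2) by auto
    then have "s > T" using x u(2) by (cases "s = T") auto
    then have "0 < u s * (u' s)\<^sup>2 / 2"
      using u(3)[OF \<open>s > T\<close>] u'pos[OF \<open>s > T\<close>] by (intro divide_pos_pos mult_pos_pos zero_less_power) auto
    then show ?thesis using en[OF \<open>s > T\<close>] s by simp
  qed
  then show "\<And>x. x \<in> {0<..<l} \<Longrightarrow> F x < F 0" .
  have isC: "isCont F x" "isCont (deriv F) x" for x
    using F real_analytic_at_isCont real_analytic_at_derivative(2) by blast+
  have u'eq: "u' t = sqrt (2 * (F 0 - F (u t)) / u t)" if "t > T" for t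
  proof -
    have "(u' t)\<^sup>2 = 2 * (F 0 - F (u t)) / u t" using en[OF that] u(3)[OF that] by (simp add: field_simps)
    then show ?thesis using u'pos[OF that] by (metis less_imp_le real_sqrt_unique)
  qed
  have u'lim: "(u' \<longlongrightarrow> sqrt (2 * (F 0 - F l) / l)) at_top"
  proof -
    have "((\<lambda>t. sqrt (2 * (F 0 - F (u t)) / u t)) \<longlongrightarrow> sqrt (2 * (F 0 - F l) / l)) at_top"
      using l(1) by (intro tendsto_intros isCont_tendsto_compose[OF isC(1)] l) simp
    then show ?thesis
      by (rule Lim_transform_eventually)
        (rule eventually_mono[OF eventually_gt_at_top[of T]], rule u'eq[symmetric])
  qed
  have "sqrt (2 * (F 0 - F l) / l) = 0"
    using limit_of_derivative_eq_0[of T u u'] Du l(2) u'lim by blast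
  then show Fl: "F l = F 0" using l(1) by simp
  have u'0: "(u' \<longlongrightarrow> 0) at_top" using u'lim Fl by simp
  have "((\<lambda>t. - ((u' t)\<^sup>2 / 2 + deriv F (u t)) / u t) \<longlongrightarrow> - (0\<^sup>2 / 2 + deriv F l) / l) at_top"
    using l(1) by (intro tendsto_intros isCont_tendsto_compose[OF isC(2)] l u'0) simp_all
  then have "- (0\<^sup>2 / 2 + deriv F l) / l = 0"
    using limit_of_derivative_eq_0[of T u' "\<lambda>t. - ((u' t)\<^sup>2 / 2 + deriv F (u t)) / u t"] Du' u'0 by blast
  then show "deriv F l = 0" using l(1) by simp
  have u0: "filterlim u (at_right 0) (at_right T)"
  proof -
    have "(u \<longlongrightarrow> u T) (at T within {T..})" using u(1) by (simp add: continuous_on_def)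
    then have "(u \<longlongrightarrow> 0) (at T within {T..})" using u(2) by simp
    then have "(u \<longlongrightarrow> 0) (at_right T)" by (rule tendsto_within_subset) auto
    moreover have "\<forall>\<^sub>F t in at_right T. u t \<in> {0<..} \<and> u t \<noteq> 0"
      using eventually_at_right_less[of T] by eventually_elim (use u(3) in force)
    ultimately show ?thesis by (simp add: filterlim_at)
  qed
  show F'0: "deriv F 0 = 0"
  proof (rule disjE[OF edge])
    assume "(u' \<longlongrightarrow> 0) (at_right T)"
    then have "((\<lambda>t. (u' t)\<^sup>2 / 2) \<longlongrightarrow> 0\<^sup>2 / 2) (at_right T)" by (intro tendsto_intros) simp_all
    moreover have "\<forall>\<^sub>F t in at_right T. (u' t)\<^sup>2 / 2 = - ((F (u t) - F 0) / u t)"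
      using eventually_at_right_less[of T]
    proof eventually_elim
      case (elim t)
      then show ?case using en[OF elim] u(3)[OF elim] by (simp add: field_simps)
    qed
    ultimately have "((\<lambda>t. - ((F (u t) - F 0) / u t)) \<longlongrightarrow> 0\<^sup>2 / 2) (at_right T)"
      by (rule Lim_transform_eventually)
    moreover have "((\<lambda>x. (F (0 + x) - F 0) / x) \<longlongrightarrow> deriv F 0) (at_right 0)"
      using real_analytic_at_has_derivative[OF F, of 0] unfolding DERIV_def
      by (rule tendsto_within_subset) simp
    from tendsto_minus[OF filterlim_compose[OF this u0]]
    have "((\<lambda>t. - ((F (u t) - F 0) / u t)) \<longlongrightarrow> - deriv F 0) (at_right T)" by simp
    ultimately have "0\<^sup>2 / 2 = - deriv F 0" by (rule tendsto_unique[OF trivial_limit_at_right_real])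
    then show ?thesis by simp
  qed
  show "deriv (deriv F) 0 < 0"
  proof (rule ccontr)
    assume "\<not> deriv (deriv F) 0 < 0"
    obtain Q where Q: "\<And>x. real_analytic_at Q x" "\<And>x. F 0 - F x = x\<^sup>2 * Q x"
      "Q 0 = - deriv (deriv F) 0 / 2"
      using analytic_quadratic_factor[OF F F'0] by blast
    have Q0: "Q 0 \<le> 0" using Q(3) \<open>\<not> deriv (deriv F) 0 < 0\<close> by simp
    define G where "G x = Q x - Q 0" for x
    have Gan: "real_analytic_at G x" for x
      using real_analytic_at_compose[OF Q(1) real_analytic_at_affine[of 1 "- Q 0"]]
      by (simp add: G_def[abs_def])
    have "G 0 = 0" by (simp add: G_def)
    then obtain R where R: "\<And>x. real_analytic_at R x" "\<And>x. G x = x * R x"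
      using real_analytic_factor_zero[of G] Gan by metis
    have "continuous_on {0..l} R" using R(1) by (intro continuous_at_imp_continuous_on ballI real_analytic_at_isCont)
    then have "compact (R ` {0..l})" by (intro compact_continuous_image compact_Icc)
    then obtain B where B: "\<forall>y\<in>R ` {0..l}. norm y \<le> B" using compact_imp_bounded bounded_iff by blast
    define C where "C = sqrt (2 * \<bar>B\<bar>)"
    \<comment> \<open>from \<open>u * u'\<^sup>2 / 2 = u\<^sup>2 * Q u\<close> and \<open>Q u \<le> \<bar>B\<bar> * u\<close>\<close>
    have grow: "u' t \<le> C * u t" if t: "t > T" for t
    proof -
      have ut: "0 < u t" "u t < l" using u(3) ul t by auto
      then have "norm (R (u t)) \<le> B" using B by force
      then have "u t * R (u t) \<le> u t * \<bar>B\<bar>" using ut by (intro mult_left_mono) auto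
      then have "Q (u t) \<le> u t * \<bar>B\<bar>" using R(2)[of "u t"] Q0 by (simp add: G_def)
      then have "(u t)\<^sup>2 * Q (u t) \<le> (u t)\<^sup>2 * (u t * \<bar>B\<bar>)" by (rule mult_left_mono) simp
      moreover have "u t * (u' t)\<^sup>2 / 2 = (u t)\<^sup>2 * Q (u t)" using en[OF t] Q(2)[of "u t"] by simp
      ultimately have "u t * (u' t)\<^sup>2 \<le> 2 * ((u t)\<^sup>2 * (u t * \<bar>B\<bar>))" by linarith
      also have "\<dots> = u t * (2 * \<bar>B\<bar> * (u t)\<^sup>2)" by (simp add: algebra_simps)
      finally have "u t * (u' t)\<^sup>2 \<le> u t * (2 * \<bar>B\<bar> * (u t)\<^sup>2)" .
      then have "(u' t)\<^sup>2 \<le> 2 * \<bar>B\<bar> * (u t)\<^sup>2" using ut by (simp add: mult_le_cancel_left)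
      also have "\<dots> = (C * u t)\<^sup>2" by (simp add: C_def power_mult_distrib)
      finally show ?thesis using ut by (intro power2_le_imp_le[of "u' t" "C * u t"]) (auto simp: C_def)
    qed
    have "u (T + 1) * exp (- C * (T + 1)) - u T * exp (- C * T) \<le> 0 * (T + 1 - T)"
    proof (rule increment_le_countable_exceptions[where S = "{}" and
          f = "\<lambda>t. u t * exp (- C * t)" and D = "\<lambda>t. (u' t - C * u t) * exp (- C * t)"])
      show "continuous_on {T..T + 1} (\<lambda>t. u t * exp (- C * t))" by (intro continuous_intros uct)
      fix t assume "t \<in> {T<..<T + 1} - {}"
      then have t: "t > T" by simp
      have "((\<lambda>t. u t * exp (- C * t)) has_real_derivative (u' t - C * u t) * exp (- C * t)) (at t)"
        by (auto intro!: derivative_eq_intros Du t simp: algebra_simps)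
      moreover have "(u' t - C * u t) * exp (- C * t) \<le> 0" using grow[OF t] by (simp add: mult_nonpos_nonneg)
      ultimately show "((\<lambda>t. u t * exp (- C * t)) has_real_derivative (u' t - C * u t) * exp (- C * t)) (at t) \<and>
          (u' t - C * u t) * exp (- C * t) \<le> 0" by blast
    qed auto
    then have "u (T + 1) \<le> 0" using u(2) by (simp add: mult_le_0_iff)
    then show False using u(3)[of "T + 1"] by simp
  qed
qed

section \<open>Waves obtained from the profile by inserting a pause\<close>

definition wave_conditions :: "(real \<Rightarrow> real) \<Rightarrow> real \<Rightarrow> bool" where
  "wave_conditions F m \<longleftrightarrow> m > 0 \<and> deriv F 0 = 0 \<and> deriv (deriv F) 0 < 0 \<and>
     F m = F 0 \<and> (\<forall>x\<in>{0<..<m}. F x < F 0) \<and> deriv F m = 0"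

text \<open>
  \<open>V\<close> is the solitary wave whose zero is at the origin. The other waves are the functions
  \<open>\<lambda>t. V (g t)\<close> with \<open>g\<close> a ramp.
\<close>

locale wave_profile =
  fixes F V :: "real \<Rightarrow> real" and m :: real
  assumes analytic_F: "\<And>x. real_analytic_at F x"
    and conditions: "wave_conditions F m"
    and analytic: "\<And>t. real_analytic_at V t"
    and zero [simp]: "V 0 = 0"
    and even: "\<And>t. V (- t) = V t"
    and pos: "\<And>t. t \<noteq> 0 \<Longrightarrow> 0 < V t"
    and less_limit: "\<And>t. V t < m"
    and limit: "(V \<longlongrightarrow> m) at_top"
    and deriv_0 [simp]: "deriv V 0 = 0"
    and second_deriv_0: "deriv (deriv V) 0 > 0"
    and energy: "\<And>t. V t * (deriv V t)\<^sup>2 / 2 + F (V t) = F 0"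
    and equation: "\<And>t. deriv (deriv V) t * V t + (deriv V t)\<^sup>2 / 2 + deriv F (V t) = 0"
    and unique: "\<And>u u' a t. a \<le> t \<Longrightarrow> continuous_on {a..t} u \<Longrightarrow> u a = 0 \<Longrightarrow>
        \<forall>s\<in>{a<..t}. 0 < u s \<and> u s < m \<and> 0 < u' s \<and> (u has_real_derivative u' s) (at s) \<and>
            u s * (u' s)\<^sup>2 / 2 + F (u s) = F 0 \<Longrightarrow>
        u t = V (t - a)"

lemma wave_profile_exists:
  assumes F: "\<And>x. real_analytic_at F x" and "wave_conditions F m"
  obtains V where "wave_profile F V m"
proof -
  have c: "deriv F 0 = 0" "deriv (deriv F) 0 < 0" "m > 0" "F m = F 0" "\<And>x. x \<in> {0<..<m} \<Longrightarrow> F x < F 0" "deriv F m = 0"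
    using assms(2) by (auto simp: wave_conditions_def)
  show thesis
    apply (rule wave_profile_construction[OF F c], assumption)
    subgoal premises p for V
      by (rule that, unfold_locales) (fact F assms(2) p)+
    done
qed

text \<open>
  A reparametrization of time that runs at speed \<open>1\<close> away from its zeros and may pause at \<open>0\<close>. At a zero only
  the Lipschitz bound matters, which covers the interior and the two ends of a pause alike.
\<close>

definition ramp :: "(real \<Rightarrow> real) \<Rightarrow> bool" where
  "ramp g \<longleftrightarrow> (\<forall>t. g t = 0 \<and> (\<forall>s. \<bar>g s\<bar> \<le> \<bar>s - t\<bar>) \<or> (\<exists>c. \<forall>\<^sub>F s in nhds t. g s = s - c))"

lemma ramp_isCont:
  assumes "ramp g"
  shows "isCont g t"
proof -
  consider "g t = 0" "\<And>s. \<bar>g s\<bar> \<le> \<bar>s - t\<bar>" | c where "\<forall>\<^sub>F s in nhds t. g s = s - c"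
    using assms unfolding ramp_def by blast
  then show ?thesis
  proof cases
    case 1
    have "((\<lambda>s. \<bar>s - t\<bar>) \<longlongrightarrow> 0) (at t)"
      by (rule tendsto_rabs_zero[OF LIM_zero[OF tendsto_ident_at]])
    then have "(g \<longlongrightarrow> 0) (at t)"
      by (rule Lim_null_comparison[rotated]) (use 1(2) in simp)
    then show ?thesis using 1(1) by (simp add: isCont_def)
  next
    case (2 c)
    have "isCont (\<lambda>s. s - c) t" by (intro continuous_intros)
    then show ?thesis using isCont_cong[OF 2] by simp
  qed
qed

text \<open>
  At a zero of \<open>g\<close> the increment of \<open>R\<close> is of smaller order than \<open>\<bar>g s\<bar>\<close>, hence than \<open>\<bar>s - t\<bar>\<close>:
  the corners of \<open>g\<close> disappear in the composition.
\<close>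

lemma ramp_chain_rule:
  assumes g: "ramp g" and R: "\<And>x. (R has_real_derivative R' x) (at x)" and 0: "R' 0 = 0"
  shows "((\<lambda>t. R (g t)) has_real_derivative R' (g t)) (at t)"
proof -
  consider "g t = 0" "\<And>s. \<bar>g s\<bar> \<le> \<bar>s - t\<bar>" | c where "\<forall>\<^sub>F s in nhds t. g s = s - c"
    using g unfolding ramp_def by blast
  then show ?thesis
  proof cases
    case 1
    have "(R has_derivative (\<lambda>h. 0)) (at 0)"
      using R[of 0] 0 by (simp add: has_field_derivative_def lambda_zero)
    then have small: "\<exists>d>0. \<forall>y. norm (y - 0) < d \<longrightarrow> norm (R y - R 0 - 0) \<le> e * norm (y - 0)"
      if "e > 0" for e
      using that unfolding has_derivative_at_alt by blast
    have "((\<lambda>t. R (g t)) has_derivative (\<lambda>h. 0)) (at t)"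
      unfolding has_derivative_at_alt
    proof (intro conjI allI impI)
      fix e :: real assume "e > 0"
      obtain d where d: "d > 0" "\<And>y. \<bar>y\<bar> < d \<Longrightarrow> \<bar>R y - R 0\<bar> \<le> e * \<bar>y\<bar>"
        using small[OF \<open>e > 0\<close>] by auto
      have "norm (R (g s) - R (g t) - 0) \<le> e * norm (s - t)" if "norm (s - t) < d" for s
      proof -
        have "\<bar>R (g s) - R 0\<bar> \<le> e * \<bar>g s\<bar>" using 1(2)[of s] that by (intro d) simp
        also have "\<dots> \<le> e * \<bar>s - t\<bar>" using 1(2)[of s] \<open>e > 0\<close> by (intro mult_left_mono) auto
        finally show ?thesis using 1(1) by simp
      qed
      then show "\<exists>d>0. \<forall>s. norm (s - t) < d \<longrightarrow> norm (R (g s) - R (g t) - 0) \<le> e * norm (s - t)"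
        using d(1) by blast
    qed simp
    then show ?thesis using 1(1) 0 by (simp add: has_field_derivative_def lambda_zero)
  next
    case (2 c)
    have gt: "g t = t - c" using 2 by (rule eventually_nhds_x_imp_x)
    have inner: "((\<lambda>s. s - c) has_real_derivative 1) (at t)" by (auto intro!: derivative_eq_intros)
    have "((\<lambda>s. R (s - c)) has_vector_derivative R' (t - c)) (at t)"
      using DERIV_chain2[OF R inner] by (simp add: has_real_derivative_iff_has_vector_derivative)
    then have "((\<lambda>s. R (g s)) has_vector_derivative R' (t - c)) (at t)"
      by (rule has_vector_derivative_eventually_eq) (use 2 in \<open>auto elim: eventually_mono\<close>)
    then show ?thesis by (simp add: gt has_real_derivative_iff_has_vector_derivative)
  qed
qed

lemma ramp_two_sided: "a \<le> b \<Longrightarrow> ramp (\<lambda>t. max (t - b) 0 + min (t - a) 0)"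
  unfolding ramp_def
proof
  fix t assume ab: "a \<le> b"
  let ?g = "\<lambda>t. max (t - b) 0 + min (t - a) 0"
  consider "t < a" | "a \<le> t" "t \<le> b" | "b < t" by linarith
  then show "?g t = 0 \<and> (\<forall>s. \<bar>?g s\<bar> \<le> \<bar>s - t\<bar>) \<or> (\<exists>c. \<forall>\<^sub>F s in nhds t. ?g s = s - c)"
  proof cases
    case 1
    have "\<forall>\<^sub>F s in nhds t. ?g s = s - a"
      using eventually_nhds_in_open[OF open_lessThan, of t a] 1
      by (auto elim!: eventually_mono simp: max_def min_def) (use ab in auto)
    then show ?thesis by blast
  next
    case 2
    then show ?thesis by (auto simp: max_def min_def)
  next
    case 3
    have "\<forall>\<^sub>F s in nhds t. ?g s = s - b"
      using eventually_nhds_in_open[OF open_greaterThan, of t b] 3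
      by (auto elim!: eventually_mono simp: max_def min_def) (use ab in auto)
    then show ?thesis by blast
  qed
qed

lemma ramp_right: "ramp (\<lambda>t. max (t - T) 0)"
  unfolding ramp_def
proof
  fix t
  show "max (t - T) 0 = 0 \<and> (\<forall>s. \<bar>max (s - T) 0\<bar> \<le> \<bar>s - t\<bar>) \<or> (\<exists>c. \<forall>\<^sub>F s in nhds t. max (s - T) 0 = s - c)"
  proof (cases "t \<le> T")
    case False
    then have "\<forall>\<^sub>F s in nhds t. max (s - T) 0 = s - T"
      using eventually_nhds_in_open[OF open_greaterThan, of t T] by (auto elim!: eventually_mono)
    then show ?thesis by blast
  qed auto
qed

lemma ramp_left: "ramp (\<lambda>t. min (t - T) 0)"
  unfolding ramp_def
proof
  fix t
  show "min (t - T) 0 = 0 \<and> (\<forall>s. \<bar>min (s - T) 0\<bar> \<le> \<bar>s - t\<bar>) \<or> (\<exists>c. \<forall>\<^sub>F s in nhds t. min (s - T) 0 = s - c)"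
  proof (cases "T \<le> t")
    case False
    then have "\<forall>\<^sub>F s in nhds t. min (s - T) 0 = s - T"
      using eventually_nhds_in_open[OF open_lessThan, of t T] by (auto elim!: eventually_mono)
    then show ?thesis by blast
  qed auto
qed

lemma C1_differentiable_on_UNIV_I:
  "(\<And>t. (f has_real_derivative D t) (at t)) \<Longrightarrow> continuous_on UNIV D \<Longrightarrow> f C1_differentiable_on UNIV"
  unfolding C1_differentiable_on_def has_real_derivative_iff_has_vector_derivative by blast

lemma weak_derivative_classical:
  assumes "\<And>t. (f has_real_derivative f' t) (at t)" "continuous_on UNIV f'"
  shows "weak_derivative f f'"
proof -
  have fc: "continuous_on UNIV f" using assms(1) by (meson DERIV_isCont continuous_at_imp_continuous_on)
  have "(LINT t|lebesgue. f t * deriv \<phi> t) = - (LINT t|lebesgue. f' t * \<phi> t)" if \<phi>: "test_function \<phi>" for \<phi>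
  proof -
    obtain a b where "\<And>t. t \<notin> {a..b} \<Longrightarrow> \<phi> t = 0" using test_functionD(2)[OF \<phi>] by blast
    then show ?thesis by (rule integration_by_parts_vanishing[OF assms test_functionD(1)[OF \<phi>]])
  qed
  moreover have "set_integrable lebesgue {a..b} f" "set_integrable lebesgue {a..b} f'" for a b
    by (rule absolutely_integrable_continuous_real, rule continuous_on_subset[OF _ subset_UNIV], fact)+
  ultimately show ?thesis by (simp add: weak_derivative_def L1_loc_def)
qed

lemma L2_loc_continuous: "continuous_on UNIV f \<Longrightarrow> L2_loc f"
  unfolding L2_loc_def
  by (auto intro!: continuous_lebesgue_measurable absolutely_integrable_continuous_real continuous_intros
      intro: continuous_on_subset)

text \<open>
  The weak equation needs only the differentiability of the flux \<open>2 * u * u'\<close>, not that of \<open>u'\<close>; it is then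
  an integration by parts.
\<close>

lemma TWS_classicalI:
  assumes F: "continuous_on UNIV (deriv F)"
    and u: "\<And>t. 0 \<le> u t" "bounded (range u)"
    and Du: "\<And>t. (u has_real_derivative u' t) (at t)" "continuous_on UNIV u'"
    and flux: "\<And>t. ((\<lambda>t. 2 * u t * u' t) has_real_derivative (u' t)\<^sup>2 - 2 * deriv F (u t)) (at t)"
  shows "TWS F u"
proof -
  have uc: "continuous_on UNIV u" using Du(1) by (meson DERIV_isCont continuous_at_imp_continuous_on)
  have F'u: "continuous_on UNIV (\<lambda>t. deriv F (u t))" by (rule continuous_on_compose2[OF F uc]) simp
  have wu: "weak_derivative u u'" by (rule weak_derivative_classical[OF Du])
  have "((\<lambda>t. (u t)\<^sup>2) has_real_derivative 2 * u t * u' t) (at t)" for t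
    by (auto intro!: derivative_eq_intros Du(1))
  then have wu2: "weak_derivative (\<lambda>t. (u t)\<^sup>2) (\<lambda>t. 2 * u t * u' t)"
    by (rule weak_derivative_classical) (intro continuous_intros uc Du(2))
  have "(LINT t|lebesgue. 2 * u t * u' t * deriv \<phi> t + (u' t)\<^sup>2 * \<phi> t - 2 * deriv F (u t) * \<phi> t) = 0"
    if \<phi>: "test_function \<phi>" for \<phi>
  proof -
    obtain a b where out: "\<And>t. t \<notin> {a..b} \<Longrightarrow> \<phi> t = 0" using test_functionD(2)[OF \<phi>] by blast
    have s: "smooth \<phi>" by (rule test_functionD(1)[OF \<phi>])
    show ?thesis
    proof (rule integral_derivative_vanishing(2)[where \<Phi> = "\<lambda>t. 2 * u t * u' t * \<phi> t" and a = a and b = b])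
      show "((\<lambda>t. 2 * u t * u' t * \<phi> t) has_real_derivative
          2 * u t * u' t * deriv \<phi> t + (u' t)\<^sup>2 * \<phi> t - 2 * deriv F (u t) * \<phi> t) (at t)" for t
        using DERIV_mult'[OF flux smooth_DERIV[OF s], of t] by (simp add: algebra_simps)
      show "continuous_on UNIV (\<lambda>t. 2 * u t * u' t * deriv \<phi> t + (u' t)\<^sup>2 * \<phi> t - 2 * deriv F (u t) * \<phi> t)"
        by (intro continuous_intros uc Du(2) F'u smooth_continuous_on smooth_deriv s)
    qed (simp add: out)
  qed
  then show ?thesis unfolding TWS_def H1_loc_def
    using uc u wu wu2 L2_loc_continuous[OF uc] L2_loc_continuous[OF Du(2)] by blast
qed

context wave_profile
begin

lemma has_derivative: "(V has_real_derivative deriv V t) (at t)"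
  by (rule real_analytic_at_has_derivative[OF analytic])

lemma has_second_derivative: "(deriv V has_real_derivative deriv (deriv V) t) (at t)"
  by (rule real_analytic_at_has_derivative[OF real_analytic_at_derivative(2)[OF analytic]])

lemma nonneg: "0 \<le> V t"
  using pos[of t] by (cases "t = 0") auto

lemma eq_0_iff: "V t = 0 \<longleftrightarrow> t = 0"
  using pos[of t] by (cases "t = 0") auto

lemma limit_at_bot: "(V \<longlongrightarrow> m) at_bot"
  using filterlim_compose[OF limit filterlim_uminus_at_top_at_bot] by (simp add: even)

lemma deriv_F_0: "deriv F 0 = 0"
  using conditions by (simp add: wave_conditions_def)

lemma m_pos: "m > 0"
  using conditions by (simp add: wave_conditions_def)

lemma analytic_shift: "real_analytic_on (\<lambda>t. V (t - c)) UNIV"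
  using real_analytic_at_compose[OF real_analytic_at_affine[of 1 "- c"] analytic]
  by (simp add: real_analytic_on_UNIV_iff)

lemma ramp_DERIV:
  assumes "ramp g"
  shows "((\<lambda>t. V (g t)) has_real_derivative deriv V (g t)) (at t)"
  by (rule ramp_chain_rule[OF assms has_derivative deriv_0])

lemma ramp_deriv: "ramp g \<Longrightarrow> deriv (\<lambda>t. V (g t)) t = deriv V (g t)"
  by (rule DERIV_imp_deriv[OF ramp_DERIV])

lemma ramp_deriv_continuous:
  assumes "ramp g"
  shows "continuous_on UNIV (\<lambda>t. deriv V (g t))"
proof (intro continuous_at_imp_continuous_on ballI)
  show "isCont (\<lambda>t. deriv V (g t)) t" for t
    by (rule isCont_o2[OF ramp_isCont[OF assms] DERIV_isCont[OF has_second_derivative]])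
qed

lemma ramp_C1: "ramp g \<Longrightarrow> (\<lambda>t. V (g t)) C1_differentiable_on UNIV"
  by (rule C1_differentiable_on_UNIV_I[OF ramp_DERIV ramp_deriv_continuous])

text \<open>
  Both \<open>V\<close> and its flux have vanishing derivative at \<open>0\<close>, so \<open>ramp_chain_rule\<close> applies to
  each of them. The latter uses \<open>deriv F 0 = 0\<close>.
\<close>

lemma ramp_strong_singular:
  assumes g: "ramp g" and nc: "g t0 = 0" "g t1 \<noteq> 0"
  shows "strong_singular_TWS F (\<lambda>t. V (g t))"
proof -
  have "TWS F (\<lambda>t. V (g t))"
  proof (rule TWS_classicalI[where u' = "\<lambda>t. deriv V (g t)"])
    show "continuous_on UNIV (deriv F)" by (rule real_analytic_continuous(2)[OF analytic_F])
    show "bounded (range (\<lambda>t. V (g t)))"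
    proof (rule bounded_subset)
      show "bounded {0..m}" by simp
      show "range (\<lambda>t. V (g t)) \<subseteq> {0..m}" using less_limit nonneg by (force intro: less_imp_le)
    qed
    have "((\<lambda>x. 2 * V x * deriv V x) has_real_derivative (deriv V x)\<^sup>2 - 2 * deriv F (V x)) (at x)" for x
    proof -
      have "((\<lambda>x. 2 * V x * deriv V x) has_real_derivative
          2 * V x * deriv (deriv V) x + 2 * deriv V x * deriv V x) (at x)"
        by (rule DERIV_mult'[OF DERIV_cmult[OF has_derivative] has_second_derivative])
      also have "2 * V x * deriv (deriv V) x + 2 * deriv V x * deriv V x = (deriv V x)\<^sup>2 - 2 * deriv F (V x)"
        using equation[of x] by (simp add: power2_eq_square algebra_simps)
      finally show ?thesis .
    qed
    then show "((\<lambda>t. 2 * V (g t) * deriv V (g t)) has_real_derivative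
        (deriv V (g t))\<^sup>2 - 2 * deriv F (V (g t))) (at t)" for t
      by (rule ramp_chain_rule[OF g]) (simp add: deriv_F_0)
  qed (use nonneg ramp_DERIV[OF g] ramp_deriv_continuous[OF g] in auto)
  moreover have "\<not> (\<lambda>t. V (g t)) constant_on UNIV"
    using nc eq_0_iff unfolding constant_on_def by (metis UNIV_I)
  moreover have "classical_energy_solution_on F (F 0) UNIV (\<lambda>t. V (g t))"
    unfolding classical_energy_solution_on_def
    using ramp_C1[OF g] energy by (simp add: energy_def ramp_deriv[OF g])
  ultimately show ?thesis unfolding strong_singular_TWS_def by blast
qed

text \<open>
  The one-sided second derivatives at the end of a pause are \<open>0\<close> and \<open>deriv (deriv V) 0\<close>.
\<close>

lemma kink_not_class_C2:
  assumes g: "ramp g" and gT: "g T = 0"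
    and A: "at T within A \<noteq> bot" "\<forall>\<^sub>F t in at T within A. g t = 0"
    and B: "at T within B \<noteq> bot" "\<forall>\<^sub>F t in at T within B. g t = t - T"
  shows "\<not> class_C2 (\<lambda>t. V (g t))"
proof
  assume "class_C2 (\<lambda>t. V (g t))"
  then have "deriv (\<lambda>t. V (g t)) C1_differentiable_on UNIV" by (simp add: class_C2_def)
  then obtain d where "(deriv (\<lambda>t. V (g t)) has_vector_derivative d) (at T)"
    unfolding C1_differentiable_on_def by blast
  moreover have "deriv (\<lambda>t. V (g t)) = (\<lambda>t. deriv V (g t))" by (rule ext, rule ramp_deriv[OF g])
  ultimately have "((\<lambda>t. deriv V (g t)) has_real_derivative d) (at T)"
    by (simp add: has_real_derivative_iff_has_vector_derivative)
  then have d: "((\<lambda>t. deriv V (g t) / (t - T)) \<longlongrightarrow> d) (at T within S)" for S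
    unfolding has_field_derivative_iff using gT tendsto_within_subset by fastforce
  have "((\<lambda>t. 0) \<longlongrightarrow> d) (at T within A)"
    by (rule Lim_transform_eventually[OF d]) (use A(2) in \<open>auto elim: eventually_mono\<close>)
  then have "d = 0" using A(1) tendsto_unique tendsto_const by metis
  have "((\<lambda>t. deriv V t / t) \<longlongrightarrow> deriv (deriv V) 0) (at 0)"
    using has_second_derivative[of 0] by (simp add: has_field_derivative_iff)
  then have "((\<lambda>t. deriv V (t - T) / (t - T)) \<longlongrightarrow> deriv (deriv V) 0) (at T)"
    using LIM_offset[of "\<lambda>t. deriv V t / t" _ 0 "- T"] by simp
  then have "((\<lambda>t. deriv V (t - T) / (t - T)) \<longlongrightarrow> deriv (deriv V) 0) (at T within B)"
    by (rule tendsto_within_subset) simp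
  then have "((\<lambda>t. deriv V (g t) / (t - T)) \<longlongrightarrow> deriv (deriv V) 0) (at T within B)"
    by (rule Lim_transform_eventually) (use B(2) in \<open>auto elim: eventually_mono\<close>)
  then have "d = deriv (deriv V) 0" using d[of B] B(1) tendsto_unique by blast
  then show False using \<open>d = 0\<close> second_deriv_0 by simp
qed

lemma shift_class_C2: "class_C2 (\<lambda>t. V (t - c))"
  and shift_classical_solution: "classical_solution F (\<lambda>t. V (t - c))"
proof -
  have inner: "((\<lambda>t. t - c) has_real_derivative 1) (at t)" for t by (auto intro!: derivative_eq_intros)
  have D: "((\<lambda>t. V (t - c)) has_real_derivative deriv V (t - c)) (at t)"
    "((\<lambda>t. deriv V (t - c)) has_real_derivative deriv (deriv V) (t - c)) (at t)" for t
    using DERIV_chain2[OF has_derivative inner] DERIV_chain2[OF has_second_derivative inner] by simp_all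
  have d: "deriv (\<lambda>t. V (t - c)) = (\<lambda>t. deriv V (t - c))"
    "deriv (\<lambda>t. deriv V (t - c)) = (\<lambda>t. deriv (deriv V) (t - c))"
    by (rule ext, rule DERIV_imp_deriv, rule D)+
  have cont: "continuous_on UNIV (\<lambda>t. deriv V (t - c))" "continuous_on UNIV (\<lambda>t. deriv (deriv V) (t - c))"
    by (rule continuous_on_compose2[OF real_analytic_continuous(2)], auto intro!: continuous_intros
        analytic real_analytic_at_derivative(2))+
  show C2: "class_C2 (\<lambda>t. V (t - c))"
    unfolding class_C2_def d(1)
    using C1_differentiable_on_UNIV_I[OF D(1) cont(1)] C1_differentiable_on_UNIV_I[OF D(2) cont(2)] by blast
  then show "classical_solution F (\<lambda>t. V (t - c))"
    using equation by (simp add: classical_solution_def d)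
qed

end

section \<open>Classification of fronts, plateaus and solitary waves\<close>

text \<open>
  A strong wave is a weak one without exceptional points, so the two kinds need not be distinguished.
\<close>

lemma singular_TWS_energy:
  assumes "singular_TWS F u"
  obtains h S where "TWS F u" "countable S" "classical_energy_solution_on F h (- S) u"
proof (cases "strong_singular_TWS F u")
  case True
  then show ?thesis using that[of "{}"] by (auto simp: strong_singular_TWS_def)
next
  case False
  then show ?thesis using assms that by (auto simp: singular_TWS_def weak_singular_TWS_def)
qed

text \<open>
  A countable set cannot contain an interval, so the energy may be evaluated at some zero of \<open>u\<close>.
\<close>

lemma energy_level_of_zero_interval:
  assumes "countable S" "classical_energy_solution_on F h (- S) u"
    and ab: "a < b" and 0: "\<And>t. t \<in> {a<..<b} \<Longrightarrow> u t = 0"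
  shows "h = F 0"
proof -
  have "\<not> {a<..<b} \<subseteq> S"
    using assms(1) ab countable_subset uncountable_open_interval by blast
  then obtain t where t: "t \<in> {a<..<b}" "t \<notin> S" by blast
  have "energy F u t = h" using assms(2) t by (simp add: classical_energy_solution_on_def)
  then show ?thesis using 0[OF t(1)] by (simp add: energy_def)
qed

lemma singular_half_wave_right:
  assumes F: "\<And>x. real_analytic_at F x" and u: "TWS F u" and S: "countable S"
    and E: "classical_energy_solution_on F (F 0) (- S) u"
    and T: "u T = 0" "\<And>t. t > T \<Longrightarrow> u t > 0" and l: "l > 0" "(u \<longlongrightarrow> l) at_top"
    and edge: "deriv F 0 = 0 \<or> (deriv u \<longlongrightarrow> 0) (at_right T)"
  shows "wave_conditions F l" "wave_profile F V l \<Longrightarrow> T \<le> t \<Longrightarrow> u t = V (t - T)"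
proof -
  note reg = singular_TWS_regular_where_positive[OF F u S E T(2)]
  have uc: "continuous_on A u" for A using u by (auto simp: TWS_def intro: continuous_on_subset)
  have en: "u t * (deriv u t)\<^sup>2 / 2 + F (u t) = F 0" if "t > T" for t
    using reg(3)[OF that] by (simp add: energy_def)
  note hw = half_wave[OF F uc T reg(1,2) en l edge]
  show "wave_conditions F l" unfolding wave_conditions_def using l hw by blast
  show "u t = V (t - T)" if "wave_profile F V l" "T \<le> t"
  proof -
    interpret wave_profile F V l by fact
    show ?thesis
      by (rule unique[OF that(2) uc T(1), of "deriv u"]) (use hw(1) reg(1) en T(2) in auto)
  qed
qed

text \<open>
  Time reversal: \<open>\<lambda>t. u (- t)\<close> satisfies the same equation and energy identity, and \<open>V\<close> is even.
\<close>

lemma singular_half_wave_left: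
  assumes F: "\<And>x. real_analytic_at F x" and u: "TWS F u" and S: "countable S"
    and E: "classical_energy_solution_on F (F 0) (- S) u"
    and T: "u T = 0" "\<And>t. t < T \<Longrightarrow> u t > 0" and l: "l > 0" "(u \<longlongrightarrow> l) at_bot"
    and edge: "deriv F 0 = 0 \<or> (deriv u \<longlongrightarrow> 0) (at_left T)"
  shows "wave_conditions F l" "wave_profile F V l \<Longrightarrow> t \<le> T \<Longrightarrow> u t = V (t - T)"
proof -
  note reg = singular_TWS_regular_where_positive[OF F u S E T(2)]
  define w where "w t = u (- t)" for t
  define w' where "w' t = - deriv u (- t)" for t
  have uc: "continuous_on UNIV u" using u by (simp add: TWS_def)
  have wc: "continuous_on A w" for A
    unfolding w_def by (rule continuous_on_compose2[OF uc]) (auto intro!: continuous_intros)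
  have wT: "w (- T) = 0" "\<And>t. t > - T \<Longrightarrow> w t > 0" using T by (simp_all add: w_def)
  have neg: "((\<lambda>t. - t) has_real_derivative - 1) (at t)" for t :: real
    by (auto intro!: derivative_eq_intros)
  have Dw: "(w has_real_derivative w' t) (at t)"
    "(w' has_real_derivative - ((w' t)\<^sup>2 / 2 + deriv F (w t)) / w t) (at t)"
    "w t * (w' t)\<^sup>2 / 2 + F (w t) = F 0" if "t > - T" for t
  proof -
    have "- t < T" using that by simp
    note r = reg[OF this]
    show "(w has_real_derivative w' t) (at t)"
      unfolding w_def w'_def using DERIV_chain2[OF r(1) neg] by simp
    show "(w' has_real_derivative - ((w' t)\<^sup>2 / 2 + deriv F (w t)) / w t) (at t)"
      unfolding w_def w'_def using DERIV_minus[OF DERIV_chain2[OF r(2) neg]] by simp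
    show "w t * (w' t)\<^sup>2 / 2 + F (w t) = F 0"
      using r(3) by (simp add: w_def w'_def energy_def)
  qed
  have wl: "(w \<longlongrightarrow> l) at_top"
    unfolding w_def by (rule filterlim_compose[OF l(2) filterlim_uminus_at_bot_at_top])
  have wedge: "deriv F 0 = 0 \<or> (w' \<longlongrightarrow> 0) (at_right (- T))"
  proof (rule disjE[OF edge])
    assume "(deriv u \<longlongrightarrow> 0) (at_left T)"
    then have "((\<lambda>t. - deriv u (- t)) \<longlongrightarrow> - 0) (at_right (- T))"
      by (intro tendsto_minus) (simp add: filterlim_at_left_to_right)
    then show ?thesis by (simp add: w'_def[abs_def])
  qed simp
  note hw = half_wave[OF F wc wT Dw l(1) wl wedge]
  show "wave_conditions F l" unfolding wave_conditions_def using l hw by blast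
  show "u t = V (t - T)" if "wave_profile F V l" "t \<le> T"
  proof -
    interpret wave_profile F V l by fact
    have "w (- t) = V (- t - (- T))"
      by (rule unique[OF _ wc wT(1), of _ w']) (use hw(1) Dw wT(2) that(2) in auto)
    also have "\<dots> = V (t - T)" using even[of "t - T"] by simp
    finally show ?thesis by (simp add: w_def)
  qed
qed

text \<open>
  The half-line of zeros yields both the energy level and \<open>deriv F 0 = 0\<close>.
\<close>

lemma front_classification:
  assumes F: "\<And>x. real_analytic_at F x" and u: "front F u"
  obtains l T g where "wave_conditions F l" "\<And>V. wave_profile F V l \<Longrightarrow> u = (\<lambda>t. V (g t))"
    "g = (\<lambda>t. max (t - T) 0) \<or> g = (\<lambda>t. min (t - T) 0)"
proof -
  have "singular_TWS F u" using u by (simp add: front_def)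
  then obtain h S where S: "TWS F u" "countable S" "classical_energy_solution_on F h (- S) u"
    by (rule singular_TWS_energy)
  obtain T l where l: "l > 0" and cases:
    "(\<forall>t\<le>T. u t = 0) \<and> (\<forall>t>T. u t > 0) \<and> (u \<longlongrightarrow> l) at_top \<or>
     (\<forall>t\<ge>T. u t = 0) \<and> (\<forall>t<T. u t > 0) \<and> (u \<longlongrightarrow> l) at_bot"
    using u unfolding front_def by blast
  from cases show thesis
  proof (elim disjE conjE)
    assume *: "\<forall>t\<le>T. u t = 0" "\<forall>t>T. u t > 0" "(u \<longlongrightarrow> l) at_top"
    have h: "h = F 0" by (rule energy_level_of_zero_interval[OF S(2,3), of "T - 1" T]) (use * in auto)
    have F0: "deriv F 0 = 0" by (rule TWS_zero_interval[OF F S(1), of "T - 1" T]) (use * in auto)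
    note hw = singular_half_wave_right[OF F S(1,2) S(3)[unfolded h], of T l]
    show thesis
    proof (rule that[of l "\<lambda>t. max (t - T) 0" T])
      show "wave_conditions F l" by (rule hw(1)) (use * l F0 in auto)
      show "u = (\<lambda>t. V (max (t - T) 0))" if V: "wave_profile F V l" for V
      proof
        fix t
        show "u t = V (max (t - T) 0)"
        proof (cases "T \<le> t")
          case True
          have "u t = V (t - T)" by (rule hw(2)) (use * l F0 V True in auto)
          then show ?thesis using True by simp
        qed (use * wave_profile.zero[OF V] in simp)
      qed
    qed simp
  next
    assume *: "\<forall>t\<ge>T. u t = 0" "\<forall>t<T. u t > 0" "(u \<longlongrightarrow> l) at_bot"
    have h: "h = F 0" by (rule energy_level_of_zero_interval[OF S(2,3), of T "T + 1"]) (use * in auto)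
    have F0: "deriv F 0 = 0" by (rule TWS_zero_interval[OF F S(1), of T "T + 1"]) (use * in auto)
    note hw = singular_half_wave_left[OF F S(1,2) S(3)[unfolded h], of T l]
    show thesis
    proof (rule that[of l "\<lambda>t. min (t - T) 0" T])
      show "wave_conditions F l" by (rule hw(1)) (use * l F0 in auto)
      show "u = (\<lambda>t. V (min (t - T) 0))" if V: "wave_profile F V l" for V
      proof
        fix t
        show "u t = V (min (t - T) 0)"
        proof (cases "t \<le> T")
          case True
          have "u t = V (t - T)" by (rule hw(2)) (use * l F0 V True in auto)
          then show ?thesis using True by simp
        qed (use * wave_profile.zero[OF V] in simp)
      qed
    qed simp
  qed
qed

lemma plateau_wave_classification:
  assumes F: "\<And>x. real_analytic_at F x" and u: "plateau_wave F u"
  obtains l a b where "a < b" "wave_conditions F l"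
    "\<And>V. wave_profile F V l \<Longrightarrow> u = (\<lambda>t. V (max (t - b) 0 + min (t - a) 0))"
proof -
  have "singular_TWS F u" using u by (simp add: plateau_wave_def)
  then obtain h S where S: "TWS F u" "countable S" "classical_energy_solution_on F h (- S) u"
    by (rule singular_TWS_energy)
  obtain a b l where ab: "a < b" "{t. u t = 0} = {a..b}"
    and l: "l > 0" "(u \<longlongrightarrow> l) at_top" "(u \<longlongrightarrow> l) at_bot"
    using u unfolding plateau_wave_def by blast
  have z: "u t = 0 \<longleftrightarrow> t \<in> {a..b}" for t using ab(2) by blast
  have p: "u t > 0" if "t \<notin> {a..b}" for t
    using z[of t] that S(1) by (auto simp: TWS_def less_le)
  have h: "h = F 0" by (rule energy_level_of_zero_interval[OF S(2,3) ab(1)]) (use z in auto)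
  have F0: "deriv F 0 = 0" by (rule TWS_zero_interval[OF F S(1) ab(1)]) (use z in auto)
  note right = singular_half_wave_right[OF F S(1,2) S(3)[unfolded h], of b l]
  note left = singular_half_wave_left[OF F S(1,2) S(3)[unfolded h], of a l]
  show thesis
  proof (rule that[OF ab(1), of l])
    show "wave_conditions F l" by (rule right(1)) (use z p l F0 ab in auto)
    show "u = (\<lambda>t. V (max (t - b) 0 + min (t - a) 0))" if V: "wave_profile F V l" for V
    proof
      fix t
      consider "t \<le> a" | "a \<le> t" "t \<le> b" | "b \<le> t" by linarith
      then show "u t = V (max (t - b) 0 + min (t - a) 0)"
      proof cases
        case 1
        have "u t = V (t - a)" by (rule left(2)) (use z p l F0 ab V 1 in auto)
        then show ?thesis using 1 ab by simp
      next
        case 2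
        then show ?thesis using z[of t] wave_profile.zero[OF V] by simp
      next
        case 3
        have "u t = V (t - b)" by (rule right(2)) (use z p l F0 ab V 3 in auto)
        then show ?thesis using 3 ab by simp
      qed
    qed
  qed
qed

text \<open>
  The zero may belong to the exceptional set, so the energy level is found as a limit from the right,
  where \<open>u\<close> and \<open>deriv u\<close> tend to \<open>0\<close>. Both halves fit the same profile; with no pause between them, the ramp is
  a mere translation.
\<close>

lemma solitary_wave_classification:
  assumes F: "\<And>x. real_analytic_at F x" and u: "solitary_wave F u"
  obtains l c where "wave_conditions F l" "\<And>V. wave_profile F V l \<Longrightarrow> u = (\<lambda>t. V (t - c))"
proof -
  have "singular_TWS F u" using u by (simp add: solitary_wave_def)
  then obtain h S where S: "TWS F u" "countable S" "classical_energy_solution_on F h (- S) u"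
    by (rule singular_TWS_energy)
  obtain c l where c: "{t. u t = 0} = {c}"
    "(deriv u \<longlongrightarrow> 0) (at c within {t. u differentiable (at t)})"
    and l: "l > 0" "(u \<longlongrightarrow> l) at_top" "(u \<longlongrightarrow> l) at_bot"
    using u unfolding solitary_wave_def by blast
  have z: "u t = 0 \<longleftrightarrow> t = c" for t using c(1) by blast
  have p: "u t > 0" if "t \<noteq> c" for t
    using z[of t] that S(1) by (auto simp: TWS_def less_le)
  note reg = singular_TWS_regular_where_positive[OF F S p]
  have lim: "(deriv u \<longlongrightarrow> 0) (at c within A)" if "c \<notin> A" for A
  proof (rule tendsto_within_subset[OF c(2)], rule subsetI)
    fix x assume "x \<in> A"
    then have "x \<noteq> c" using that by blast
    from reg(1)[OF this] show "x \<in> {t. u differentiable (at t)}"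
      by (auto simp: real_differentiable_def)
  qed
  have h: "h = F 0"
  proof -
    have uc: "(u \<longlongrightarrow> 0) (at_right c)"
    proof -
      have "(u \<longlongrightarrow> u c) (at c)" using S(1) by (auto simp: TWS_def continuous_on_def)
      then show ?thesis using z[of c] by (auto intro: tendsto_within_subset)
    qed
    have "((\<lambda>t. u t * (deriv u t)\<^sup>2 / 2 + F (u t)) \<longlongrightarrow> 0 * 0\<^sup>2 / 2 + F 0) (at_right c)"
      by (intro tendsto_intros uc lim isCont_tendsto_compose[OF real_analytic_at_isCont[OF F]]) simp_all
    moreover have "\<forall>\<^sub>F t in at_right c. u t * (deriv u t)\<^sup>2 / 2 + F (u t) = h"
      using eventually_at_right_less[of c]
    proof eventually_elim
      case (elim t)
      then show ?case using reg(3)[of t] by (simp add: energy_def)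
    qed
    ultimately have "((\<lambda>t. h) \<longlongrightarrow> 0 * 0\<^sup>2 / 2 + F 0) (at_right c)" by (rule Lim_transform_eventually)
    then have "h = 0 * 0\<^sup>2 / 2 + F 0" by (rule tendsto_unique[OF trivial_limit_at_right_real tendsto_const])
    then show ?thesis by simp
  qed
  note right = singular_half_wave_right[OF F S(1,2) S(3)[unfolded h], of c l]
  note left = singular_half_wave_left[OF F S(1,2) S(3)[unfolded h], of c l]
  have limr: "(deriv u \<longlongrightarrow> 0) (at_right c)" and liml: "(deriv u \<longlongrightarrow> 0) (at_left c)"
    by (rule lim; simp)+
  show thesis
  proof (rule that[of l c])
    show "wave_conditions F l" by (rule right(1)) (use z p l limr in auto)
    show "u = (\<lambda>t. V (t - c))" if V: "wave_profile F V l" for V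
    proof
      fix t
      show "u t = V (t - c)"
      proof (cases "t \<le> c")
        case True
        show ?thesis by (rule left(2)) (use z p l liml V True in auto)
      next
        case False
        show ?thesis by (rule right(2)) (use z p l limr V False in auto)
      qed
    qed
  qed
qed

context wave_profile
begin

lemma front_max: "front F (\<lambda>t. V (max (t - T) 0))"
proof -
  have sing: "singular_TWS F (\<lambda>t. V (max (t - T) 0))"
    using ramp_strong_singular[OF ramp_right, of T T "T + 1"] by (simp add: singular_TWS_def)
  have "filterlim (\<lambda>t. max (t - T) 0) at_top at_top"
  proof (rule filterlim_at_top_mono)
    show "filterlim (\<lambda>t. - T + t) at_top at_top"
      by (rule filterlim_tendsto_add_at_top[OF tendsto_const filterlim_ident])
  qed (auto intro!: always_eventually)
  then have lim: "((\<lambda>t. V (max (t - T) 0)) \<longlongrightarrow> m) at_top" by (rule filterlim_compose[OF limit])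
  have "(\<forall>t\<le>T. V (max (t - T) 0) = 0) \<and> (\<forall>t>T. V (max (t - T) 0) > 0)"
    using pos by simp
  then show ?thesis unfolding front_def using sing lim m_pos by blast
qed

lemma two_sided_limits:
  assumes "a \<le> b"
  shows "((\<lambda>t. V (max (t - b) 0 + min (t - a) 0)) \<longlongrightarrow> m) at_top"
    "((\<lambda>t. V (max (t - b) 0 + min (t - a) 0)) \<longlongrightarrow> m) at_bot"
proof -
  have "filterlim (\<lambda>t. - b + t) at_top at_top"
    by (rule filterlim_tendsto_add_at_top[OF tendsto_const filterlim_ident])
  then have "((\<lambda>t. V (- b + t)) \<longlongrightarrow> m) at_top" by (rule filterlim_compose[OF limit])
  then show "((\<lambda>t. V (max (t - b) 0 + min (t - a) 0)) \<longlongrightarrow> m) at_top"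
    by (rule Lim_transform_eventually)
      (rule eventually_mono[OF eventually_gt_at_top[of b]], use assms in simp)
  have "filterlim (\<lambda>t. - a + t) at_bot at_bot"
    unfolding filterlim_at_bot
  proof
    show "\<forall>\<^sub>F t in at_bot. - a + t \<le> Z" for Z
      by (rule eventually_mono[OF eventually_le_at_bot[of "Z + a"]]) simp
  qed
  then have "((\<lambda>t. V (- a + t)) \<longlongrightarrow> m) at_bot" by (rule filterlim_compose[OF limit_at_bot])
  then show "((\<lambda>t. V (max (t - b) 0 + min (t - a) 0)) \<longlongrightarrow> m) at_bot"
    by (rule Lim_transform_eventually)
      (rule eventually_mono[OF eventually_le_at_bot[of a]], use assms in simp)
qed

lemma two_sided_zeros:
  "a \<le> b \<Longrightarrow> {t. V (max (t - b) 0 + min (t - a) 0) = 0} = {a..b}"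
  unfolding eq_0_iff by (auto simp: max_def min_def split: if_splits)

lemma two_sided_strong_singular:
  "a \<le> b \<Longrightarrow> strong_singular_TWS F (\<lambda>t. V (max (t - b) 0 + min (t - a) 0))"
  using ramp_strong_singular[OF ramp_two_sided, of a b a "b + 1"] by simp

lemma plateau_wave_two_sided:
  "a < b \<Longrightarrow> plateau_wave F (\<lambda>t. V (max (t - b) 0 + min (t - a) 0))"
  unfolding plateau_wave_def
  using two_sided_strong_singular[of a b] two_sided_zeros[of a b] two_sided_limits[of a b] m_pos
  by (auto simp: singular_TWS_def less_imp_le simp del: atLeastAtMost_iff)

lemma shift_strong_singular: "strong_singular_TWS F (\<lambda>t. V (t - c))"
proof -
  have "max (t - c) 0 + min (t - c) 0 = t - c" for t by (simp add: max_def min_def)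
  then show ?thesis using two_sided_strong_singular[of c c] by simp
qed

lemma solitary_wave_shift: "solitary_wave F (\<lambda>t. V (t - c))"
proof -
  have eq: "max (t - c) 0 + min (t - c) 0 = t - c" for t by (simp add: max_def min_def)
  have "((\<lambda>t. V (t - c)) \<longlongrightarrow> m) at_top" "((\<lambda>t. V (t - c)) \<longlongrightarrow> m) at_bot"
    using two_sided_limits[of c c] by (simp_all add: eq)
  moreover have "{t. V (t - c) = 0} = {c}" by (auto simp: eq_0_iff)
  moreover have "(deriv (\<lambda>t. V (t - c)) \<longlongrightarrow> 0) (at c within A)" for A
  proof -
    have r: "ramp (\<lambda>t. t - c)" using ramp_two_sided[of c c] by (simp add: eq)
    have "deriv (\<lambda>t. V (t - c)) = (\<lambda>t. deriv V (t - c))" by (rule ext, rule ramp_deriv[OF r])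
    moreover have "isCont (\<lambda>t. deriv V (t - c)) c"
      using ramp_deriv_continuous[OF r] by (simp add: continuous_on_eq_continuous_at)
    ultimately have "(deriv (\<lambda>t. V (t - c)) \<longlongrightarrow> 0) (at c)" by (simp add: isCont_def)
    then show ?thesis by (rule tendsto_within_subset) simp
  qed
  ultimately show ?thesis unfolding solitary_wave_def
    using shift_strong_singular m_pos by (auto simp: singular_TWS_def)
qed

lemma max_not_class_C2: "\<not> class_C2 (\<lambda>t. V (max (t - T) 0))"
  by (rule kink_not_class_C2[OF ramp_right, of T _ "{..<T}" "{T<..}"])
    (auto simp: eventually_at_filter intro!: always_eventually)

lemma min_not_class_C2: "\<not> class_C2 (\<lambda>t. V (min (t - T) 0))"
  by (rule kink_not_class_C2[OF ramp_left, of T _ "{T<..}" "{..<T}"])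
    (auto simp: eventually_at_filter intro!: always_eventually)

lemma two_sided_not_class_C2:
  assumes "a < b"
  shows "\<not> class_C2 (\<lambda>t. V (max (t - b) 0 + min (t - a) 0))"
proof (rule kink_not_class_C2[of _ b "{..<b}" "{b<..}"])
  show "ramp (\<lambda>t. max (t - b) 0 + min (t - a) 0)" using assms by (intro ramp_two_sided) simp
  show "\<forall>\<^sub>F t in at_left b. max (t - b) 0 + min (t - a) 0 = 0"
    using eventually_at_left_real[OF assms] by eventually_elim simp
  show "\<forall>\<^sub>F t in at_right b. max (t - b) 0 + min (t - a) 0 = t - b"
    using eventually_at_right_less[of b] by eventually_elim (use assms in simp)
qed (use assms in auto)

lemma real_analytic_on_pieces:
  "(\<And>t. t \<in> X \<Longrightarrow> u t = V (t - c)) \<Longrightarrow> real_analytic_on u X"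
  "(\<And>t. t \<in> X \<Longrightarrow> u t = 0) \<Longrightarrow> real_analytic_on u X"
proof -
  show "real_analytic_on u X" if "\<And>t. t \<in> X \<Longrightarrow> u t = V (t - c)"
    by (rule real_analytic_on_cong_subset[OF analytic_shift that])
  have "real_analytic_on (\<lambda>t. 0) UNIV"
    using real_analytic_at_affine[of 0 0] by (simp add: real_analytic_on_UNIV_iff)
  then show "real_analytic_on u X" if "\<And>t. t \<in> X \<Longrightarrow> u t = 0"
    by (rule real_analytic_on_cong_subset) (rule that)
qed

end

lemma real_analytic_on_subset: "real_analytic_on f Y \<Longrightarrow> X \<subseteq> Y \<Longrightarrow> real_analytic_on f X"
  unfolding real_analytic_on_def by (meson subsetD)

lemma connected_avoiding_point:
  fixes T :: real
  assumes "connected C" "T \<notin> C"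
  shows "C \<subseteq> {..<T} \<or> C \<subseteq> {T<..}"
proof (rule ccontr)
  assume "\<not> (C \<subseteq> {..<T} \<or> C \<subseteq> {T<..})"
  then obtain x y where "x \<in> C" "x \<notin> {..<T}" "y \<in> C" "y \<notin> {T<..}" by blast
  then have "x \<in> C" "T \<le> x" "y \<in> C" "y \<le> T" by simp_all
  then have "T \<in> C" using connectedD_interval[OF assms(1), of y x T] by blast
  then show False using assms(2) by simp
qed

lemma piecewise_analytic_one_break:
  assumes "real_analytic_on u {..T}" "real_analytic_on u {T..}"
  shows "piecewise_analytic u"
  unfolding piecewise_analytic_def
proof (intro exI[of _ "{T}"] conjI ballI)
  fix C assume C: "C \<in> components (- {T})"
  then have "C \<subseteq> {..<T} \<or> C \<subseteq> {T<..}"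
    using in_components_connected in_components_subset by (intro connected_avoiding_point) blast+
  then have "closure C \<subseteq> {..T} \<or> closure C \<subseteq> {T..}"
    by (metis closure_greaterThan closure_lessThan closure_mono)
  then show "real_analytic_on u (closure C)" using assms real_analytic_on_subset by blast
qed simp

lemma piecewise_analytic_two_breaks:
  assumes "a < b" "real_analytic_on u {..a}" "real_analytic_on u {a..b}" "real_analytic_on u {b..}"
  shows "piecewise_analytic u"
  unfolding piecewise_analytic_def
proof (intro exI[of _ "{a, b}"] conjI ballI)
  fix C assume C: "C \<in> components (- {a, b})"
  then have con: "connected C" "a \<notin> C" "b \<notin> C"
    using in_components_connected in_components_subset by blast+
  have "C \<subseteq> {..a} \<or> C \<subseteq> {a..b} \<or> C \<subseteq> {b..}"
    using connected_avoiding_point[OF con(1,2)] connected_avoiding_point[OF con(1,3)] by force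
  then have "closure C \<subseteq> {..a} \<or> closure C \<subseteq> {a..b} \<or> closure C \<subseteq> {b..}"
    by (metis closed_atMost closed_atLeast closed_atLeastAtMost closure_minimal)
  then show "real_analytic_on u (closure C)" using assms real_analytic_on_subset by blast
qed simp

lemma front_or_plateau_properties:
  assumes F: "\<And>x. real_analytic_at F x" and u: "front F u \<or> plateau_wave F u"
  shows "strong_singular_TWS F u \<and> u C1_differentiable_on UNIV \<and> \<not> class_C2 u \<and> piecewise_analytic u"
  using u
proof
  assume "front F u"
  then obtain l T g where l: "wave_conditions F l" "\<And>V. wave_profile F V l \<Longrightarrow> u = (\<lambda>t. V (g t))"
    "g = (\<lambda>t. max (t - T) 0) \<or> g = (\<lambda>t. min (t - T) 0)"
    using front_classification[OF F] by metis
  obtain V where V: "wave_profile F V l" using wave_profile_exists[OF F l(1)] .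
  interpret wave_profile F V l by (rule V)
  have uV: "u = (\<lambda>t. V (g t))" by (rule l(2)[OF V])
  from l(3) show ?thesis
  proof
    assume g: "g = (\<lambda>t. max (t - T) 0)"
    have "piecewise_analytic u"
      by (rule piecewise_analytic_one_break[of _ T]; (rule real_analytic_on_pieces(2) real_analytic_on_pieces(1)[of _ _ T]); simp add: uV g)
    then show ?thesis
      using ramp_strong_singular[OF ramp_right, of T T "T + 1"] ramp_C1[OF ramp_right] max_not_class_C2
      by (simp add: uV g)
  next
    assume g: "g = (\<lambda>t. min (t - T) 0)"
    have "real_analytic_on u {..T}" by (rule real_analytic_on_pieces(1)[of _ _ T]) (simp add: uV g)
    moreover have "real_analytic_on u {T..}" by (rule real_analytic_on_pieces(2)) (simp add: uV g)
    ultimately have "piecewise_analytic u" by (rule piecewise_analytic_one_break)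
    then show ?thesis
      using ramp_strong_singular[OF ramp_left, of T T "T - 1"] ramp_C1[OF ramp_left] min_not_class_C2
      by (simp add: uV g)
  qed
next
  assume "plateau_wave F u"
  then obtain l a b where ab: "a < b" and l: "wave_conditions F l"
    "\<And>V. wave_profile F V l \<Longrightarrow> u = (\<lambda>t. V (max (t - b) 0 + min (t - a) 0))"
    using plateau_wave_classification[OF F] by metis
  obtain V where V: "wave_profile F V l" using wave_profile_exists[OF F l(1)] .
  interpret wave_profile F V l by (rule V)
  have uV: "u = (\<lambda>t. V (max (t - b) 0 + min (t - a) 0))" by (rule l(2)[OF V])
  have "real_analytic_on u {..a}" by (rule real_analytic_on_pieces(1)[of _ _ a]) (use ab in \<open>simp add: uV\<close>)
  moreover have "real_analytic_on u {a..b}" by (rule real_analytic_on_pieces(2)) (use ab in \<open>simp add: uV\<close>)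
  moreover have "real_analytic_on u {b..}" by (rule real_analytic_on_pieces(1)[of _ _ b]) (use ab in \<open>simp add: uV\<close>)
  ultimately have "piecewise_analytic u" by (rule piecewise_analytic_two_breaks[OF ab])
  then show ?thesis
    using two_sided_strong_singular[of a b] ramp_C1[OF ramp_two_sided[of a b]] two_sided_not_class_C2[OF ab] ab
    by (simp add: uV)
qed

lemma solitary_wave_properties:
  assumes F: "\<And>x. real_analytic_at F x" and u: "solitary_wave F u"
  shows "strong_singular_TWS F u \<and> classical_solution F u \<and> real_analytic_on u UNIV"
proof -
  obtain l c where l: "wave_conditions F l" "\<And>V. wave_profile F V l \<Longrightarrow> u = (\<lambda>t. V (t - c))"
    using solitary_wave_classification[OF F u] by metis
  obtain V where V: "wave_profile F V l" using wave_profile_exists[OF F l(1)] .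
  interpret wave_profile F V l by (rule V)
  show ?thesis unfolding l(2)[OF V]
    using shift_strong_singular shift_classical_solution analytic_shift by blast
qed

theorem proposition11:
  fixes F :: "real \<Rightarrow> real"
  assumes "real_analytic_on F UNIV"
  shows
    "((\<exists>u. front F u) \<and> (\<exists>u. solitary_wave F u) \<and> (\<exists>u. plateau_wave F u) \<longleftrightarrow>
        deriv F 0 = 0 \<and> deriv (deriv F) 0 < 0 \<and>
        (\<exists>m>0. F m = F 0 \<and> (\<forall>x\<in>{0<..<m}. F x < F 0) \<and> deriv F m = 0)) \<and>
     (\<forall>u. solitary_wave F u \<longrightarrow>
        strong_singular_TWS F u \<and> classical_solution F u \<and> real_analytic_on u UNIV) \<and>
     (\<forall>u. front F u \<or> plateau_wave F u \<longrightarrow>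
        strong_singular_TWS F u \<and> u C1_differentiable_on UNIV \<and> \<not> class_C2 u \<and>
        piecewise_analytic u) \<and>
     (\<forall>u. front F u \<longrightarrow> finite_time_decay_right u \<or> finite_time_decay_left u)"
proof -
  have F: "real_analytic_at F x" for x using assms by (simp add: real_analytic_on_UNIV_iff)
  have "(\<exists>u. front F u) \<and> (\<exists>u. solitary_wave F u) \<and> (\<exists>u. plateau_wave F u) \<longleftrightarrow> (\<exists>m. wave_conditions F m)"
  proof
    assume "(\<exists>u. front F u) \<and> (\<exists>u. solitary_wave F u) \<and> (\<exists>u. plateau_wave F u)"
    then show "\<exists>m. wave_conditions F m" using front_classification[OF F] by metis
  next
    assume "\<exists>m. wave_conditions F m"
    then obtain m V where V: "wave_profile F V m" using wave_profile_exists[OF F] by metis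
    show "(\<exists>u. front F u) \<and> (\<exists>u. solitary_wave F u) \<and> (\<exists>u. plateau_wave F u)"
      using wave_profile.front_max[OF V] wave_profile.solitary_wave_shift[OF V]
        wave_profile.plateau_wave_two_sided[OF V zero_less_one] by blast
  qed
  moreover have "finite_time_decay_right u \<or> finite_time_decay_left u" if "front F u" for u
    using that unfolding front_def finite_time_decay_right_def finite_time_decay_left_def by blast
  ultimately show ?thesis
    using solitary_wave_properties[OF F] front_or_plateau_properties[OF F]
    unfolding wave_conditions_def by blast
qed

end
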